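(* Let $Q$ be the infinitesimal generator of an ergodic regular-jump Markov chain $\{(X(t),J(t));t\ge 0\}$ on $\mathbb F$ with stationary distribution $\pi$, and assume that for each $n\in\mathbb N$ the LC-block-augmented truncation ${}_{(n)}Q$ has a unique closed communicating class in $\mathbb F_n$. Let $Q^\ast$ be the infinitesimal generator of an ergodic Markov chain with state space $\mathbb F$ and stationary distribution $\pi^\ast$. Suppose there exist $b>0$, $c>0$, $K\in\mathbb Z_+$ and a column vector $v\ge e/c$ on $\mathbb F$ such that $$Qv\le -c\,v+b\,1_{\mathbb F_K}.$$ Let $\beta>0$ and fix any $N\in\{K,K+1,\dots\}$ such that $O<[\Phi^{(\beta)}_{\mathbb F_N}]_{\mathbb F_K}\le[\Phi^{(\beta)}]_{\mathbb F_K}$. Suppose that $$\|Q^\ast-Q\|_v<\frac{1}{C^{(\beta)}_{K,N}},\qquad\text{where}\quad C^{(\beta)}_{K,N}=\frac{b+1}{c}\left(1+b+\frac{2bc}{\beta\,\overline\phi^{(\beta)}_{K,N}}\right).$$ Then $$\|\pi^\ast-\pi\|_v\le\frac bc\cdot\frac{C^{(\beta)}_{K,N}\|Q^\ast-Q\|_v}{1-C^{(\beta)}_{K,N}\|Q^\ast-Q\|_v}.$$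
   Context: Notation: $\mathbb Z_+=\{0,1,2,\dots\}$, $\mathbb N=\{1,2,\dots\}$. For $k\in\mathbb Z_+$, $\mathbb S_k=\{0,1,\dots,S_k\}$ with $S_k\in\mathbb Z_+$, and $S_k=S_1$ for all $k\in\mathbb N$. Levels: $\mathbb L_k=\{k\}\times\mathbb S_k$; $\mathbb F=\bigcup_{k\ge0}\mathbb L_k$, $\mathbb F_n=\bigcup_{k=0}^n\mathbb L_k$. $e$ is a column vector of ones, $1_{\mathbb C}$ is the column indicator vector of $\mathbb C\subseteq\mathbb F$, $O$ the zero matrix; inequalities of vectors and matrices are entrywise. For a column vector $v$ on $\mathbb F$, a row vector $x=(x(k,i))$ and a matrix $Z=(z(k,i;\ell,j))$ on $\mathbb F$: $\|x\|_v=\sum_{(k,i)\in\mathbb F}|x(k,i)|\,v(k,i)$ and $\|Z\|_v=\sup_{(k,i)\in\mathbb F}\frac{\sum_{(\ell,j)\in\mathbb F}|z(k,i;\ell,j)|\,v(\ell,j)}{v(k,i)}$. $\{(X(t),J(t))\}$ is a continuous-time regular-jump (non-explosive) Markov chain with state space $\mathbb F$, transition matrix function $P^{(t)}=(p^{(t)}(k,i;\ell,j))$ and stable, conservative infinitesimal generator $Q=(q(k,i;\ell,j))$ with blocks $Q(k;\ell)=(q(k,i;\ell,j))_{i\in\mathbb S_k,\,j\in\mathbb S_\ell}$. Ergodic means irreducible and positive recurrent; $\pi$ is the unique stationary distribution (row vector, $\pi Q=0$, $\pi e=1$). For $n\in\mathbb N$, the last-column-block-augmented (LC-block-augmented) truncation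 ${}_{(n)}Q$ of $Q$ is the conservative $q$-matrix on $\mathbb F$ with blocks $${}_{(n)}Q(k;\ell)=\begin{cases}Q(k;\ell),&k\in\mathbb Z_+,\ 0\le\ell\le n-1,\\ Q(k;n)+\sum_{m>n,\,m\ne k}Q(k;m),&k\in\mathbb Z_+,\ \ell=n,\\ Q(k;k),&k=\ell\ge n+1,\\ O,&\text{otherwise.}\end{cases}$$ For $\beta>0$: $\Phi^{(\beta)}=\int_0^\infty\beta e^{-\beta t}P^{(t)}\,dt$. For $N\ge K$, $Q_{\mathbb F_N}=(q(k,i;\ell,j))_{(k,i),(\ell,j)\in\mathbb F_N}$ is the northwest-corner truncation of $Q$, and $\Phi^{(\beta)}_{\mathbb F_N}=(\phi^{(\beta)}_{\mathbb F_N}(k,i;\ell,j))=\int_0^\infty\beta e^{-\beta t}\exp\{Q_{\mathbb F_N}t\}\,dt=(I-Q_{\mathbb F_N}/\beta)^{-1}$. $[\,\cdot\,]_{\mathbb F_K}$ denotes the $|\mathbb F_K|\times|\mathbb F_K|$ northwest corner of a matrix (rows and columns in $\mathbb F_K$). Finally $\overline\phi^{(\beta)}_{K,N}=\sup_{(\ell,j)\in\mathbb F_N}\min_{(k,i)\in\mathbb F_K}\phi^{(\beta)}_{\mathbb F_N}(k,i;\ell,j)$. *)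

theory Defs
  imports "HOL-Probability.Probability"
begin

text \<open>
  Matrices and vectors indexed by a set \<open>F\<close> of states are total functions on the ambient type;
  only their values on \<open>F\<close> are ever used.
\<close>

subsection \<open>Continuous-time regular-jump Markov chains\<close>

text \<open>
  The state space carries the discrete topology, so right-continuity at \<open>t\<close> means that the path
  is constant on some \<open>[t, t + \<epsilon>)\<close>, and \<open>t > 0\<close> is a discontinuity iff the path is not constant
  on any neighbourhood of \<open>t\<close>.  Finitely many discontinuities in every bounded interval is
  non-explosion.
\<close>

definition regular_jump_path :: "(real \<Rightarrow> 's) \<Rightarrow> bool" where
  "regular_jump_path f \<longleftrightarrow>
     (\<forall>t\<ge>0. \<forall>\<^sub>F s in at_right t. f s = f t) \<and>
     (\<forall>T. finite {t. 0 < t \<and> t \<le> T \<and> \<not> (\<forall>\<^sub>F s in at t. f s = f t)})"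

text \<open>
  A chain is a process \<open>X\<close> together with its laws \<open>M x\<close>, where \<open>M x\<close> is the conditional law
  given \<open>X 0 = x\<close>.
\<close>

definition trans_fun ::
    "('s \<Rightarrow> 'w measure) \<Rightarrow> (real \<Rightarrow> 'w \<Rightarrow> 's) \<Rightarrow> real \<Rightarrow> 's \<Rightarrow> 's \<Rightarrow> real" where
  "trans_fun M X t x y = \<P>(\<omega> in M x. X t \<omega> = y)"

text \<open>
  The last condition is the time-homogeneous Markov property: at time \<open>s\<close> the chain is in \<open>y\<close>,
  and \<open>X u = a u\<close> for \<open>u \<in> U\<close> is an arbitrary event of the past at finitely many times.
\<close>

definition regular_jump_markov_chain ::
    "'s set \<Rightarrow> ('s \<Rightarrow> 'w measure) \<Rightarrow> (real \<Rightarrow> 'w \<Rightarrow> 's) \<Rightarrow> bool" where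
  "regular_jump_markov_chain F M X \<longleftrightarrow>
     countable F \<and>
     (\<forall>x\<in>F. prob_space (M x) \<and>
        (\<forall>t\<ge>0. X t \<in> M x \<rightarrow>\<^sub>M count_space F) \<and>
        (AE \<omega> in M x. X 0 \<omega> = x) \<and>
        (AE \<omega> in M x. regular_jump_path (\<lambda>t. X t \<omega>)) \<and>
        (\<forall>s\<ge>0. \<forall>t\<ge>0. \<forall>y\<in>F. \<forall>z\<in>F. \<forall>U a. finite U \<longrightarrow> U \<subseteq> {0..s} \<longrightarrow>
           \<P>(\<omega> in M x. X s \<omega> = y \<and> (\<forall>u\<in>U. X u \<omega> = a u)) > 0 \<longrightarrow>
           \<P>(\<omega> in M x. X (s + t) \<omega> = z \<bar> X s \<omega> = y \<and> (\<forall>u\<in>U. X u \<omega> = a u))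
             = trans_fun M X t y z))"

text \<open>Stability is the finiteness of the limits, i.e. that \<open>Q\<close> is real-valued.\<close>

definition infinitesimal_generator ::
    "'s set \<Rightarrow> ('s \<Rightarrow> 'w measure) \<Rightarrow> (real \<Rightarrow> 'w \<Rightarrow> 's) \<Rightarrow> ('s \<Rightarrow> 's \<Rightarrow> real) \<Rightarrow> bool" where
  "infinitesimal_generator F M X Q \<longleftrightarrow>
     (\<forall>x\<in>F. \<forall>y\<in>F.
        ((\<lambda>t. (trans_fun M X t x y - of_bool (x = y)) / t) \<longlongrightarrow> Q x y) (at_right 0)) \<and>
     (\<forall>x\<in>F. (Q x has_sum 0) F)"

subsection \<open>Communication, recurrence, stationarity\<close>

definition accessible :: "'s set \<Rightarrow> ('s \<Rightarrow> 's \<Rightarrow> real) \<Rightarrow> 's \<Rightarrow> 's \<Rightarrow> bool" where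
  "accessible F Q x y \<longleftrightarrow> (x, y) \<in> {(z, w). z \<in> F \<and> w \<in> F \<and> z \<noteq> w \<and> Q z w > 0}\<^sup>*"

definition irreducible_generator :: "'s set \<Rightarrow> ('s \<Rightarrow> 's \<Rightarrow> real) \<Rightarrow> bool" where
  "irreducible_generator F Q \<longleftrightarrow> (\<forall>x\<in>F. \<forall>y\<in>F. accessible F Q x y)"

definition closed_communicating_class ::
    "'s set \<Rightarrow> ('s \<Rightarrow> 's \<Rightarrow> real) \<Rightarrow> 's set \<Rightarrow> bool" where
  "closed_communicating_class F Q C \<longleftrightarrow>
     (\<exists>x\<in>F. C = {y\<in>F. accessible F Q x y \<and> accessible F Q y x}) \<and>
     (\<forall>x\<in>C. \<forall>y\<in>F. accessible F Q x y \<longrightarrow> y \<in> C)"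

text \<open>First time in \<open>x\<close> after having left \<open>x\<close>; \<open>\<infinity>\<close> if there is none.\<close>

definition return_time :: "(real \<Rightarrow> 'w \<Rightarrow> 's) \<Rightarrow> 's \<Rightarrow> 'w \<Rightarrow> ennreal" where
  "return_time X x \<omega> =
     (INF t\<in>{t. 0 \<le> t \<and> X t \<omega> = x \<and> (\<exists>s. 0 \<le> s \<and> s < t \<and> X s \<omega> \<noteq> x)}. ennreal t)"

definition positive_recurrent ::
    "'s set \<Rightarrow> ('s \<Rightarrow> 'w measure) \<Rightarrow> (real \<Rightarrow> 'w \<Rightarrow> 's) \<Rightarrow> bool" where
  "positive_recurrent F M X \<longleftrightarrow> (\<forall>x\<in>F. (\<integral>\<^sup>+ \<omega>. return_time X x \<omega> \<partial>M x) < \<infinity>)"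

definition ergodic_chain ::
    "'s set \<Rightarrow> ('s \<Rightarrow> 'w measure) \<Rightarrow> (real \<Rightarrow> 'w \<Rightarrow> 's) \<Rightarrow> ('s \<Rightarrow> 's \<Rightarrow> real) \<Rightarrow> bool" where
  "ergodic_chain F M X Q \<longleftrightarrow>
     regular_jump_markov_chain F M X \<and> infinitesimal_generator F M X Q \<and>
     irreducible_generator F Q \<and> positive_recurrent F M X"

definition stationary_distribution ::
    "'s set \<Rightarrow> ('s \<Rightarrow> 's \<Rightarrow> real) \<Rightarrow> ('s \<Rightarrow> real) \<Rightarrow> bool" where
  "stationary_distribution F Q \<pi> \<longleftrightarrow>
     (\<forall>x\<in>F. \<pi> x \<ge> 0) \<and> (\<pi> has_sum 1) F \<and>
     (\<forall>y\<in>F. ((\<lambda>x. \<pi> x * Q x y) has_sum 0) F)"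

subsection \<open>Weighted norms\<close>

definition row_vnorm :: "'s set \<Rightarrow> ('s \<Rightarrow> real) \<Rightarrow> ('s \<Rightarrow> real) \<Rightarrow> ennreal" where
  "row_vnorm F v x = (\<Sum>\<^sub>\<infinity>y\<in>F. ennreal (\<bar>x y\<bar> * v y))"

definition mat_vnorm :: "'s set \<Rightarrow> ('s \<Rightarrow> real) \<Rightarrow> ('s \<Rightarrow> 's \<Rightarrow> real) \<Rightarrow> ennreal" where
  "mat_vnorm F v Z = (SUP x\<in>F. (\<Sum>\<^sub>\<infinity>y\<in>F. ennreal (\<bar>Z x y\<bar> * v y)) / ennreal (v x))"

subsection \<open>The level structure and the LC-block-augmented truncation\<close>

definition lev :: "(nat \<Rightarrow> nat) \<Rightarrow> nat \<Rightarrow> (nat \<times> nat) set" where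
  "lev S k = {k} \<times> {0..S k}"

definition levels :: "(nat \<Rightarrow> nat) \<Rightarrow> (nat \<times> nat) set" where
  "levels S = (\<Union>k. lev S k)"

definition levels_upto :: "(nat \<Rightarrow> nat) \<Rightarrow> nat \<Rightarrow> (nat \<times> nat) set" where
  "levels_upto S n = (\<Union>k\<in>{0..n}. lev S k)"

text \<open>Used for \<open>n \<ge> 1\<close> only; then level \<open>n\<close> and all higher levels have the same phases.\<close>

definition LC_trunc ::
    "nat \<Rightarrow> (nat \<times> nat \<Rightarrow> nat \<times> nat \<Rightarrow> real) \<Rightarrow> nat \<times> nat \<Rightarrow> nat \<times> nat \<Rightarrow> real" where
  "LC_trunc n Q = (\<lambda>(k, i) (l, j).
     if l < n then Q (k, i) (l, j)
     else if l = n then Q (k, i) (n, j) + (\<Sum>\<^sub>\<infinity>m\<in>{m. m > n \<and> m \<noteq> k}. Q (k, i) (m, j))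
     else if k = l then Q (k, i) (l, j)
     else 0)"

subsection \<open>Resolvent matrices\<close>

definition resolvent :: "(real \<Rightarrow> 's \<Rightarrow> 's \<Rightarrow> real) \<Rightarrow> real \<Rightarrow> 's \<Rightarrow> 's \<Rightarrow> real" where
  "resolvent P \<beta> x y = (LBINT t:{0..}. \<beta> * exp (- \<beta> * t) * P t x y)"

primrec mat_power :: "'s set \<Rightarrow> ('s \<Rightarrow> 's \<Rightarrow> real) \<Rightarrow> nat \<Rightarrow> 's \<Rightarrow> 's \<Rightarrow> real" where
  "mat_power A Z 0 = (\<lambda>x y. of_bool (x = y))"
| "mat_power A Z (Suc m) = (\<lambda>x y. \<Sum>z\<in>A. Z x z * mat_power A Z m z y)"

text \<open>\<open>exp {Z t}\<close> for the finite square matrix \<open>Z\<close> indexed by the finite set \<open>A\<close>.\<close>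

definition mat_exp :: "'s set \<Rightarrow> ('s \<Rightarrow> 's \<Rightarrow> real) \<Rightarrow> real \<Rightarrow> 's \<Rightarrow> 's \<Rightarrow> real" where
  "mat_exp A Z t x y = (\<Sum>m. mat_power A Z m x y * t ^ m / fact m)"

definition trunc_resolvent ::
    "(nat \<Rightarrow> nat) \<Rightarrow> (nat \<times> nat \<Rightarrow> nat \<times> nat \<Rightarrow> real) \<Rightarrow> real \<Rightarrow> nat \<Rightarrow>
      nat \<times> nat \<Rightarrow> nat \<times> nat \<Rightarrow> real" where
  "trunc_resolvent S Q \<beta> N = resolvent (mat_exp (levels_upto S N) Q) \<beta>"

definition phi_bar ::
    "(nat \<Rightarrow> nat) \<Rightarrow> (nat \<times> nat \<Rightarrow> nat \<times> nat \<Rightarrow> real) \<Rightarrow> real \<Rightarrow> nat \<Rightarrow> nat \<Rightarrow> real" where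
  "phi_bar S Q \<beta> K N =
     (SUP y\<in>levels_upto S N. MIN x\<in>levels_upto S K. trunc_resolvent S Q \<beta> N x y)"

definition C_const ::
    "(nat \<Rightarrow> nat) \<Rightarrow> (nat \<times> nat \<Rightarrow> nat \<times> nat \<Rightarrow> real) \<Rightarrow>
      real \<Rightarrow> real \<Rightarrow> real \<Rightarrow> nat \<Rightarrow> nat \<Rightarrow> real" where
  "C_const S Q b c \<beta> K N =
     (b + 1) / c * (1 + b + 2 * b * c / (\<beta> * phi_bar S Q \<beta> K N))"

end

theory Submission
  imports Defs "HOL-Real_Asymp.Real_Asymp"
begin

text \<open>
  The proof works with the Markov kernel \<open>\<Phi>\<close>, the \<open>\<beta>\<close>-resolvent of \<open>Q\<close>, rather than with \<open>Q\<close> itself,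
  whose jump rates may be unbounded, and it compares \<open>\<pi>'\<close> and \<open>\<pi>\<close> directly, without a deviation matrix.

  Let \<open>\<nu> = \<pi>' (Q' - Q)\<close>, so that \<open>\<pi>' Q = - \<nu>\<close> and \<open>\<parallel>\<nu>\<parallel>\<^sub>v \<le> \<parallel>Q' - Q\<parallel>\<^sub>v (\<pi>' v)\<close>. In resolvent form this reads
  \<open>\<pi>' = (\<pi>' + \<nu> / \<beta>) \<Phi>\<close>, and \<open>\<pi> = \<pi> \<Phi>\<close> (\<open>perturbed_stationary_resolvent\<close>). Both identities rest on
  non-explosion. Truncating to finite sets only gives inequalities, and these are equalities because
  \<open>\<Phi>\<close>, the increasing limit of the truncated resolvents, is stochastic. That it is stochastic follows
  from the fact that a regular jump path visits finitely many states in bounded time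
  (\<open>resolvent_row_sum_tendsto_1\<close>).

  The drift condition passes from \<open>Q\<close> to \<open>\<Phi>\<close> (\<open>\<Phi>_drift\<close>), which yields \<open>\<pi> v \<le> b / c\<close>. Choose a state \<open>\<alpha>\<close> at
  which the supremum \<open>phi_bar\<close> is attained; since truncated resolvents increase to \<open>\<Phi>\<close>, the column
  \<open>\<Phi>(\<cdot>, \<alpha>)\<close> is at least \<open>phi_bar\<close> on the levels up to \<open>K\<close>. If \<open>\<mu> = \<pi>' - s \<pi>\<close> with \<open>s\<close> chosen such that
  \<open>\<mu> \<Phi>\<close> vanishes at \<open>\<alpha>\<close>, then in \<open>\<mu> = (\<mu> + \<nu> / \<beta>) \<Phi>\<close> the column of \<open>\<alpha>\<close> may be deleted from the first
  term. The remaining kernel has a strict drift without an exceptional set, for a test function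
  between \<open>v\<close> and \<open>v + 2 b / (\<beta> phi_bar)\<close>, and summing \<open>\<bar>\<mu>\<bar>\<close> against it gives
  \<open>c \<parallel>\<mu>\<parallel>\<^sub>v \<le> (1 + 2 b c / (\<beta> phi_bar)) \<parallel>\<nu>\<parallel>\<^sub>v\<close> (\<open>signed_measure_bound\<close>).

  Returning from \<open>\<mu>\<close> to \<open>\<pi>' - \<pi>\<close> costs a factor \<open>1 + b\<close> (\<open>stationary_perturbation_bound\<close>). With
  \<open>\<pi>' v \<le> b / c + \<parallel>\<pi>' - \<pi>\<parallel>\<^sub>v\<close> the norm \<open>D = \<parallel>\<pi>' - \<pi>\<parallel>\<^sub>v\<close> satisfies \<open>D \<le> C \<delta> (b / c + D)\<close>, where
  \<open>\<delta> = \<parallel>Q' - Q\<parallel>\<^sub>v\<close>, and solving for \<open>D\<close> gives the claim.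
\<close>

section \<open>Exponentials and resolvents of finite matrices\<close>

lemma mat_power_bounded:
  assumes A: "finite A"
  obtains c where "c \<ge> 0" "\<And>x y m. x \<in> A \<Longrightarrow> y \<in> A \<Longrightarrow> \<bar>mat_power A Z m x y\<bar> \<le> c ^ m"
proof
  define c where "c = (\<Sum>x\<in>A. \<Sum>y\<in>A. \<bar>Z x y\<bar>)"
  show c0: "c \<ge> 0" by (simp add: c_def sum_nonneg)
  have row: "(\<Sum>z\<in>A. \<bar>Z x z\<bar>) \<le> c" if "x \<in> A" for x
    unfolding c_def using that A
    by (intro member_le_sum[of x A "\<lambda>x. \<Sum>y\<in>A. \<bar>Z x y\<bar>"]) (auto intro: sum_nonneg)
  show "\<bar>mat_power A Z m x y\<bar> \<le> c ^ m" if "x \<in> A" "y \<in> A" for x y m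
    using that(1)
  proof (induction m arbitrary: x)
    case (Suc m)
    have "\<bar>mat_power A Z (Suc m) x y\<bar> \<le> (\<Sum>z\<in>A. \<bar>Z x z\<bar> * \<bar>mat_power A Z m z y\<bar>)"
      by (auto simp flip: abs_mult)
    also have "\<dots> \<le> (\<Sum>z\<in>A. \<bar>Z x z\<bar> * c ^ m)"
      by (intro sum_mono mult_left_mono Suc.IH) auto
    also have "\<dots> \<le> c * c ^ m"
      unfolding sum_distrib_right[symmetric] using row[OF Suc.prems] c0 by (intro mult_right_mono) auto
    finally show ?case by simp
  qed auto
qed

lemma mat_power_Suc_right:
  assumes "finite A" "x \<in> A" "y \<in> A"
  shows "mat_power A Z (Suc m) x y = (\<Sum>z\<in>A. mat_power A Z m x z * Z z y)"
  using assms(2)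
proof (induction m arbitrary: x)
  case 0
  have "(\<Sum>z\<in>A. Z x z * of_bool (z = y)) = (\<Sum>z\<in>A. if z = y then Z x y else 0)"
    "(\<Sum>z\<in>A. of_bool (x = z) * Z z y) = (\<Sum>z\<in>A. if x = z then Z x y else 0)"
    by (intro sum.cong; simp)+
  then show ?case using assms 0 by simp
next
  case (Suc m)
  have "mat_power A Z (Suc (Suc m)) x y = (\<Sum>z\<in>A. Z x z * (\<Sum>w\<in>A. mat_power A Z m z w * Z w y))"
    unfolding mat_power.simps(2)[of A Z "Suc m"] by (intro sum.cong refl) (simp only: Suc.IH)
  also have "\<dots> = (\<Sum>w\<in>A. mat_power A Z (Suc m) x w * Z w y)"
    unfolding mat_power.simps(2) sum_distrib_left sum_distrib_right
    by (subst sum.swap) (simp add: mult.assoc)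
  finally show ?case .
qed

lemma mat_exp_series_summable:
  assumes "finite A" "x \<in> A" "y \<in> A"
  shows "summable (\<lambda>m. norm (mat_power A Z m x y * t ^ m / fact m))"
proof -
  obtain c where c: "c \<ge> 0" "\<And>x y m. x \<in> A \<Longrightarrow> y \<in> A \<Longrightarrow> \<bar>mat_power A Z m x y\<bar> \<le> c ^ m"
    using mat_power_bounded[OF assms(1)] by blast
  show ?thesis
  proof (rule summable_comparison_test')
    show "summable (\<lambda>m. (c * \<bar>t\<bar>) ^ m / fact m)"
      using summable_exp[of "c * \<bar>t\<bar>"] by (simp add: field_simps)
    show "norm (norm (mat_power A Z m x y * t ^ m / fact m)) \<le> (c * \<bar>t\<bar>) ^ m / fact m" for m
      using c(2)[of x y m] assms
      by (simp add: abs_mult power_abs power_mult_distrib divide_right_mono mult_right_mono)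
  qed
qed

lemma mat_exp_0: "mat_exp A Z 0 x y = of_bool (x = y)"
proof -
  have "mat_exp A Z 0 x y = (\<Sum>m\<in>{0}. mat_power A Z m x y * 0 ^ m / fact m)"
    unfolding mat_exp_def by (rule suminf_finite) auto
  then show ?thesis by simp
qed

lemma mat_exp_has_derivative:
  assumes A: "finite A" "x \<in> A" "y \<in> A"
  shows "((\<lambda>t. mat_exp A Z t x y) has_real_derivative (\<Sum>z\<in>A. Z x z * mat_exp A Z t z y)) (at t)"
proof -
  define a where "a m = mat_power A Z m x y / fact m" for m
  have s: "summable (\<lambda>m. mat_power A Z m z y * t ^ m / fact m)" if "z \<in> A" for t z
    by (rule summable_norm_cancel, rule mat_exp_series_summable) (use A that in auto)
  have "((\<lambda>t. \<Sum>m. a m * t ^ m) has_field_derivative (\<Sum>m. diffs a m * t ^ m)) (at t)"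
    by (rule termdiffs_strong_converges_everywhere) (use s[OF A(2)] in \<open>simp add: a_def\<close>)
  moreover have "(\<lambda>t. \<Sum>m. a m * t ^ m) = (\<lambda>t. mat_exp A Z t x y)"
    by (simp add: a_def mat_exp_def)
  moreover have "(\<Sum>m. diffs a m * t ^ m) = (\<Sum>m. \<Sum>z\<in>A. Z x z * (mat_power A Z m z y * t ^ m / fact m))"
  proof (rule suminf_cong)
    fix m
    have "diffs a m = mat_power A Z (Suc m) x y / fact m"
      by (simp add: diffs_def a_def del: mat_power.simps) 
    then show "diffs a m * t ^ m = (\<Sum>z\<in>A. Z x z * (mat_power A Z m z y * t ^ m / fact m))"
      by (simp add: sum_distrib_right sum_divide_distrib mult.assoc)
  qed
  moreover have "\<dots> = (\<Sum>z\<in>A. Z x z * mat_exp A Z t z y)"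
    unfolding mat_exp_def
    by (subst suminf_sum) (auto simp del: times_divide_eq_right intro!: summable_mult sum.cong suminf_mult s)
  ultimately show ?thesis by simp
qed

lemma mat_exp_commutes:
  assumes A: "finite A" "x \<in> A" "y \<in> A"
  shows "(\<Sum>z\<in>A. Z x z * mat_exp A Z t z y) = (\<Sum>z\<in>A. mat_exp A Z t x z * Z z y)"
proof -
  have s: "summable (\<lambda>m. mat_power A Z m z w * t ^ m / fact m)" if "z \<in> A" "w \<in> A" for t z w
    by (rule summable_norm_cancel, rule mat_exp_series_summable) (use A that in auto)
  have "(\<Sum>z\<in>A. Z x z * mat_exp A Z t z y) = (\<Sum>m. \<Sum>z\<in>A. Z x z * (mat_power A Z m z y * t ^ m / fact m))"
    unfolding mat_exp_def
    by (subst suminf_sum) (use A in \<open>auto simp del: times_divide_eq_right intro!: summable_mult sum.cong suminf_mult[symmetric] s\<close>)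
  also have "\<dots> = (\<Sum>m. \<Sum>z\<in>A. mat_power A Z m x z * t ^ m / fact m * Z z y)"
  proof (rule suminf_cong)
    fix m
    have "(\<Sum>z\<in>A. Z x z * (mat_power A Z m z y * t ^ m / fact m)) = mat_power A Z (Suc m) x y * t ^ m / fact m"
      by (simp add: sum_distrib_right sum_divide_distrib mult.assoc)
    also have "\<dots> = (\<Sum>z\<in>A. mat_power A Z m x z * t ^ m / fact m * Z z y)"
      unfolding mat_power_Suc_right[OF A]
      by (simp add: sum_distrib_left sum_divide_distrib mult_ac)
    finally show "(\<Sum>z\<in>A. Z x z * (mat_power A Z m z y * t ^ m / fact m)) = \<dots>" .
  qed
  also have "\<dots> = (\<Sum>z\<in>A. mat_exp A Z t x z * Z z y)"
    unfolding mat_exp_def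
    by (subst suminf_sum) (use A in \<open>auto simp del: times_divide_eq_left intro!: summable_mult2 sum.cong suminf_mult2[symmetric] s\<close>)
  finally show ?thesis .
qed

text \<open>
  The binomial theorem for \<open>Z + q I\<close>; it applies because \<open>I\<close> commutes with \<open>Z\<close>.
\<close>
lemma mat_power_shift:
  assumes A: "finite A" and x: "x \<in> A"
  shows "mat_power A (\<lambda>x y. Z x y + q * of_bool (x = y)) m x y =
           (\<Sum>j\<le>m. of_nat (m choose j) * q ^ (m - j) * mat_power A Z j x y)"
  using x
proof (induction m arbitrary: x)
  case (Suc m)
  let ?B = "\<lambda>x y. Z x y + q * of_bool (x = y)"
  let ?S = "\<lambda>z. \<Sum>j\<le>m. of_nat (m choose j) * q ^ (m - j) * mat_power A Z j z y"
  have "mat_power A ?B (Suc m) x y = (\<Sum>z\<in>A. ?B x z * ?S z)"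
    unfolding mat_power.simps(2) by (intro sum.cong refl) (simp only: Suc.IH)
  also have "\<dots> = (\<Sum>z\<in>A. Z x z * ?S z) + (\<Sum>z\<in>A. if x = z then q * ?S x else 0)"
    unfolding sum.distrib[symmetric] by (intro sum.cong) (auto simp: ring_distribs)
  also have "(\<Sum>z\<in>A. if x = z then q * ?S x else 0) = q * ?S x"
    using A Suc.prems by simp
  also have "(\<Sum>z\<in>A. Z x z * ?S z) = (\<Sum>j\<le>m. of_nat (m choose j) * q ^ (m - j) * mat_power A Z (Suc j) x y)"
    unfolding sum_distrib_left mat_power.simps(2) by (subst sum.swap) (simp add: mult_ac)
  also have "\<dots> + q * ?S x = (\<Sum>j\<le>Suc m. of_nat (Suc m choose j) * q ^ (Suc m - j) * mat_power A Z j x y)"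
  proof -
    have "q * ?S x = (\<Sum>j\<le>m. of_nat (m choose j) * q ^ (Suc m - j) * mat_power A Z j x y)"
      unfolding sum_distrib_left by (intro sum.cong) (auto simp: Suc_diff_le)
    also have "\<dots> = (\<Sum>j\<le>Suc m. of_nat (m choose j) * q ^ (Suc m - j) * mat_power A Z j x y)"
      by simp
    also have "\<dots> = q ^ Suc m * mat_power A Z 0 x y +
        (\<Sum>j\<le>m. of_nat (m choose Suc j) * q ^ (m - j) * mat_power A Z (Suc j) x y)"
      by (subst sum.atMost_Suc_shift) (simp del: mat_power.simps)
    finally have 1: "q * ?S x = \<dots>" .
    have 2: "(\<Sum>j\<le>Suc m. of_nat (Suc m choose j) * q ^ (Suc m - j) * mat_power A Z j x y)
       = q ^ Suc m * mat_power A Z 0 x y +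
        (\<Sum>j\<le>m. of_nat (Suc m choose Suc j) * q ^ (m - j) * mat_power A Z (Suc j) x y)"
      by (subst sum.atMost_Suc_shift) (simp del: mat_power.simps binomial_Suc_Suc)
    show ?thesis unfolding 1 2
      by (simp add: ring_distribs sum.distrib del: mat_power.simps)
  qed
  finally show ?case .
qed auto

text \<open>
  Uniformization: for large \<open>q\<close> the matrix \<open>Z + q I\<close> is nonnegative even when \<open>Z\<close> is a
  \<open>q\<close>-matrix, so that signs and sizes of \<open>exp (Z t)\<close> can be read off from a power series with
  nonnegative coefficients.
\<close>
lemma mat_exp_shift:
  assumes A: "finite A" "x \<in> A" "y \<in> A"
  shows "mat_exp A (\<lambda>x y. Z x y + q * of_bool (x = y)) t x y = exp (q * t) * mat_exp A Z t x y"
proof -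
  define a where "a m = mat_power A Z m x y * t ^ m / fact m" for m
  define e where "e m = (q * t) ^ m / fact m" for m :: nat
  have e: "summable (\<lambda>m. norm (e m))" "(\<Sum>m. e m) = exp (q * t)"
    using summable_norm_exp[of "q * t"] by (simp_all add: e_def exp_def field_simps)
  have a: "summable (\<lambda>m. norm (a m))"
    unfolding a_def by (rule mat_exp_series_summable[OF A])
  have "mat_power A (\<lambda>x y. Z x y + q * of_bool (x = y)) m x y * t ^ m / fact m
        = (\<Sum>i\<le>m. a i * e (m - i))" for m
    unfolding mat_power_shift[OF A(1,2)] sum_distrib_right sum_divide_distrib
  proof (rule sum.cong)
    fix j assume j: "j \<in> {..m}"
    then have "t ^ m = t ^ j * t ^ (m - j)" by (simp flip: power_add)
    then show "of_nat (m choose j) * q ^ (m - j) * mat_power A Z j x y * t ^ m / fact m = a j * e (m - j)"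
      using j by (simp add: a_def e_def binomial_fact power_mult_distrib)
  qed simp
  then show ?thesis
    using Cauchy_product_sums[OF a e(1)] by (simp add: mat_exp_def e(2) sums_iff a_def mult.commute)
qed

text \<open>
  The north-west corner of a conservative \<open>q\<close>-matrix: the missing columns only take mass away from
  the row sums.
\<close>
definition sub_generator :: "'s set \<Rightarrow> ('s \<Rightarrow> 's \<Rightarrow> real) \<Rightarrow> bool" where
  "sub_generator A Q \<longleftrightarrow> (\<forall>x\<in>A. \<forall>y\<in>A. x \<noteq> y \<longrightarrow> Q x y \<ge> 0) \<and> (\<forall>x\<in>A. (\<Sum>y\<in>A. Q x y) \<le> 0)"

text \<open>
  By uniformization with \<open>q \<ge> max \<bar>Q x x\<bar>\<close>, the matrix \<open>B = Q + q I\<close> is nonnegative with row sums at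
  most \<open>q\<close>, hence \<open>0 \<le> B ^ m \<le> q ^ m\<close> and \<open>0 \<le> exp (B t) \<le> exp (q t)\<close> entrywise. The bound by \<open>1\<close>
  is what makes the Laplace transform of \<open>exp (Q t)\<close> converge for every \<open>\<beta> > 0\<close>.
\<close>
lemma mat_exp_bounds:
  assumes A: "finite A" "x \<in> A" "y \<in> A" and Q: "sub_generator A Q" and t: "t \<ge> 0"
  shows "0 \<le> mat_exp A Q t x y" "mat_exp A Q t x y \<le> 1"
proof -
  define q where "q = (\<Sum>x\<in>A. \<bar>Q x x\<bar>)"
  define B where "B = (\<lambda>x y. Q x y + q * of_bool (x = y))"
  have q: "\<bar>Q x x\<bar> \<le> q" if "x \<in> A" for x
    unfolding q_def using that A by (intro member_le_sum[of x A "\<lambda>x. \<bar>Q x x\<bar>"]) auto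
  have B0: "B x y \<ge> 0" if "x \<in> A" "y \<in> A" for x y
    using that Q q[of x] by (cases "x = y") (auto simp: B_def sub_generator_def)
  have B1: "(\<Sum>y\<in>A. B x y) \<le> q" if "x \<in> A" for x
    using that Q A unfolding B_def sum.distrib by (simp add: sub_generator_def)
  have q0: "q \<ge> 0" by (simp add: q_def sum_nonneg)
  have P: "0 \<le> mat_power A B m x y \<and> mat_power A B m x y \<le> q ^ m" if "x \<in> A" for x m
    using that
  proof (induction m arbitrary: x)
    case (Suc m)
    have "(\<Sum>z\<in>A. B x z * mat_power A B m z y) \<le> (\<Sum>z\<in>A. B x z * q ^ m)"
      using Suc by (intro sum_mono mult_left_mono) (auto intro: B0)
    also have "\<dots> \<le> q * q ^ m"
      unfolding sum_distrib_right[symmetric] using B1 Suc.prems q0 by (intro mult_right_mono) auto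
    finally show ?case using Suc by (auto intro!: sum_nonneg mult_nonneg_nonneg B0)
  qed auto
  have sm: "summable (\<lambda>m. mat_power A B m x y * t ^ m / fact m)"
    by (rule summable_norm_cancel, rule mat_exp_series_summable) (use A in auto)
  have "mat_exp A B t x y \<le> (\<Sum>m. (q * t) ^ m / fact m)"
    unfolding mat_exp_def
  proof (rule suminf_le[OF _ sm])
    show "summable (\<lambda>m. (q * t) ^ m / fact m)"
      using summable_exp[of "q * t"] by (simp add: field_simps)
    show "mat_power A B m x y * t ^ m / fact m \<le> (q * t) ^ m / fact m" for m
      using P[OF A(2), of m] t by (auto simp: power_mult_distrib intro!: divide_right_mono mult_right_mono)
  qed
  also have "\<dots> = exp (q * t)" by (simp add: exp_def field_simps)
  finally have le: "mat_exp A B t x y \<le> exp (q * t)" .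
  have "0 \<le> mat_exp A B t x y"
    unfolding mat_exp_def by (rule suminf_nonneg[OF sm]) (use P[OF A(2)] t in auto)
  with le show "0 \<le> mat_exp A Q t x y" "mat_exp A Q t x y \<le> 1"
    unfolding B_def mat_exp_shift[OF A] by (auto simp: zero_le_mult_iff)
qed

lemma set_integrable_exp_minus:
  assumes "\<beta> > (0::real)"
  shows "set_integrable lborel {0..} (\<lambda>t. \<beta> * exp (- \<beta> * t))"
proof -
  have "(\<lambda>t. exp (- \<beta> * t)) absolutely_integrable_on {0..}"
    using assms by (intro nonnegative_absolutely_integrable_1 integrable_on_exp_minus_to_infinity) auto
  then have "set_integrable lborel {0..} (\<lambda>t. exp (- \<beta> * t))"
    by (simp add: set_integrable_def integrable_completion)
  then show ?thesis by simp
qed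

lemma set_integral_sum_finite:
  fixes g :: "'i \<Rightarrow> 'a \<Rightarrow> real"
  assumes "finite I" "\<And>i. i \<in> I \<Longrightarrow> set_integrable M S (g i)"
  shows "set_integrable M S (\<lambda>t. \<Sum>i\<in>I. g i t)"
    and "(LINT t:S|M. (\<Sum>i\<in>I. g i t)) = (\<Sum>i\<in>I. LINT t:S|M. g i t)"
  using assms(2) unfolding set_integrable_def set_lebesgue_integral_def scaleR_sum_right
  by (auto intro!: integrable_sum integral_sum simp del: real_scaleR_def scaleR_conv_of_real)

lemma resolvent_mat_exp_integrable:
  assumes A: "finite A" "x \<in> A" "y \<in> A" and Q: "sub_generator A Q" and \<beta>: "\<beta> > 0"
  shows "set_integrable lborel {0..} (\<lambda>t. \<beta> * exp (- \<beta> * t) * mat_exp A Q t x y)"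
proof (rule set_integrable_bound[OF set_integrable_exp_minus[OF \<beta>]])
  have "continuous_on UNIV (\<lambda>t. mat_exp A Q t x y)"
    using mat_exp_has_derivative[OF A, of Q] DERIV_isCont by (intro continuous_at_imp_continuous_on) blast
  from borel_measurable_continuous_onI[OF this] have [measurable]: "(\<lambda>t. mat_exp A Q t x y) \<in> borel_measurable borel" .
  show "set_borel_measurable lborel {0..} (\<lambda>t. \<beta> * exp (- \<beta> * t) * mat_exp A Q t x y)"
    unfolding set_borel_measurable_def by measurable
  show "AE t in lborel. t \<in> {0..} \<longrightarrow> norm (\<beta> * exp (- \<beta> * t) * mat_exp A Q t x y) \<le> norm (\<beta> * exp (- \<beta> * t))"
    using mat_exp_bounds[OF A Q] \<beta> by (intro AE_I2) (auto simp: abs_mult mult_le_cancel_left1)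
qed

lemma resolvent_mat_exp_nonneg:
  assumes A: "finite A" "x \<in> A" "y \<in> A" and Q: "sub_generator A Q" and \<beta>: "\<beta> > 0"
  shows "0 \<le> resolvent (mat_exp A Q) \<beta> x y"
  unfolding resolvent_def set_lebesgue_integral_def
  using mat_exp_bounds(1)[OF A Q] \<beta>
  by (intro Bochner_Integration.integral_nonneg) (auto simp: indicator_def)

text \<open>
  Integrate the derivative of \<open>\<beta> exp (- \<beta> t) exp (Q t)\<close> over \<open>[0, \<infinity>)\<close>: this is \<open>(\<beta> I - Q) \<Phi> = \<beta> I\<close>.
  Since \<open>Q\<close> commutes with its exponential, the order of the factors can be exchanged.
\<close>
lemma resolvent_mat_exp_backward:
  assumes A: "finite A" "x \<in> A" "y \<in> A" and Q: "sub_generator A Q" and \<beta>: "\<beta> > 0"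
  shows "(\<Sum>z\<in>A. Q x z * resolvent (mat_exp A Q) \<beta> z y) =
           \<beta> * resolvent (mat_exp A Q) \<beta> x y - \<beta> * of_bool (x = y)"
proof -
  let ?E = "mat_exp A Q" and ?R = "resolvent (mat_exp A Q) \<beta>"
  define F where "F t = \<beta> * exp (- \<beta> * t) * ?E t x y" for t
  define f where "f t = (\<Sum>z\<in>A. Q x z * (\<beta> * exp (- \<beta> * t) * ?E t z y)) - \<beta> * (\<beta> * exp (- \<beta> * t) * ?E t x y)" for t
  note int = resolvent_mat_exp_integrable[OF A(1) _ A(3) Q \<beta>, unfolded mult_minus_left]
  have cont: "isCont (\<lambda>t. ?E t z y) t" if "z \<in> A" for t z
    using mat_exp_has_derivative[OF A(1) that A(3), of Q] DERIV_isCont by blast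
  have fint: "set_integrable lborel {0..} f"
    unfolding f_def using A(2) \<beta>
    by (intro set_integral_diff set_integral_sum_finite A set_integrable_mult_right) (auto intro!: int)
  have fint': "set_integrable lborel {0<..} f"
    by (rule set_integrable_subset[OF fint]) auto
  have "(LBINT t:{0..}. f t) = (\<Sum>z\<in>A. Q x z * ?R z y) - \<beta> * ?R x y"
    unfolding f_def resolvent_def using A \<beta>
    by (subst set_integral_diff) (auto simp: set_integral_sum_finite(2) int
        intro!: int set_integral_sum_finite set_integrable_mult_right)
  moreover have "(LBINT t:{0..}. f t) = (LBINT t:{0<..}. f t)"
  proof (rule set_integral_cong_set)
    show "set_borel_measurable lborel {0<..} f"
      using fint' by (auto simp: set_borel_measurable_def set_integrable_def)
    show "set_borel_measurable lborel {0..} f"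
      using fint by (auto simp: set_borel_measurable_def set_integrable_def)
    show "AE x in lborel. (x \<in> {0<..}) = (x \<in> {0::real..})"
      using AE_lborel_singleton[of 0] by eventually_elim auto
  qed
  moreover have "(LBINT t=ereal 0..\<infinity>. f t) = 0 - F 0"
  proof (rule interval_integral_FTC_integrable)
    show "(F has_vector_derivative f t) (at t)" for t
      unfolding F_def f_def has_real_derivative_iff_has_vector_derivative[symmetric]
      by (rule derivative_eq_intros mat_exp_has_derivative[OF A] refl)+
         (simp add: sum_distrib_left algebra_simps)
    show "isCont f t" for t
      unfolding f_def using A by (auto intro!: continuous_intros cont)
    show "set_integrable lborel (einterval (ereal 0) \<infinity>) f"
      using fint' by simp
    have F: "isCont F t" for t
      unfolding F_def using A by (auto intro!: continuous_intros cont)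
    show "((F \<circ> real_of_ereal) \<longlongrightarrow> F 0) (at_right (ereal 0))"
      unfolding ereal_tendsto_simps using F[of 0] by (simp add: isCont_def filterlim_at_split)
    show "((F \<circ> real_of_ereal) \<longlongrightarrow> 0) (at_left \<infinity>)"
      unfolding ereal_tendsto_simps
    proof (rule Lim_null_comparison)
      show "\<forall>\<^sub>F t in at_top. norm (F t) \<le> \<beta> * exp (- \<beta> * t)"
        using eventually_ge_at_top[of 0]
        by eventually_elim
          (use mat_exp_bounds[OF A Q] \<beta> in \<open>auto simp: F_def abs_mult mult_le_cancel_left1\<close>)
      show "((\<lambda>t. \<beta> * exp (- \<beta> * t)) \<longlongrightarrow> 0) at_top"
        using \<beta> by real_asymp
    qed
  qed auto
  ultimately show ?thesis
    unfolding interval_integral_to_infinity_eq by (simp add: F_def mat_exp_0)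
qed

lemma resolvent_mat_exp_forward:
  assumes A: "finite A" "x \<in> A" "y \<in> A" and Q: "sub_generator A Q" and \<beta>: "\<beta> > 0"
  shows "(\<Sum>z\<in>A. resolvent (mat_exp A Q) \<beta> x z * Q z y) =
           \<beta> * resolvent (mat_exp A Q) \<beta> x y - \<beta> * of_bool (x = y)"
proof -
  note int = resolvent_mat_exp_integrable[OF A(1) _ _ Q \<beta>, unfolded mult_minus_left]
  have "(\<Sum>z\<in>A. resolvent (mat_exp A Q) \<beta> x z * Q z y) =
        (LBINT t:{0..}. (\<Sum>z\<in>A. \<beta> * exp (- \<beta> * t) * mat_exp A Q t x z * Q z y))"
    unfolding resolvent_def using A
    by (subst set_integral_sum_finite(2)) (auto intro!: set_integrable_mult_left int)
  also have "\<dots> = (LBINT t:{0..}. \<beta> * exp (- \<beta> * t) * (\<Sum>z\<in>A. mat_exp A Q t x z * Q z y))"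
    by (simp add: sum_distrib_left mult.assoc)
  also have "\<dots> = (LBINT t:{0..}. \<beta> * exp (- \<beta> * t) * (\<Sum>z\<in>A. Q x z * mat_exp A Q t z y))"
    unfolding mat_exp_commutes[OF A] ..
  also have "\<dots> = (LBINT t:{0..}. (\<Sum>z\<in>A. Q x z * (\<beta> * exp (- \<beta> * t) * mat_exp A Q t z y)))"
    by (simp add: sum_distrib_left mult_ac)
  also have "\<dots> = (\<Sum>z\<in>A. Q x z * resolvent (mat_exp A Q) \<beta> z y)"
    unfolding resolvent_def using A
    by (subst set_integral_sum_finite(2)) (auto intro!: set_integrable_mult_right int)
  also note resolvent_mat_exp_backward[OF A Q \<beta>]
  finally show ?thesis .
qed

text \<open>
  Multiplying the row vector \<open>z (\<beta> I - Q)\<close> by \<open>\<Phi>\<close> from the right gives back \<open>\<beta> z\<close>. As \<open>\<Phi>\<close> is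
  nonnegative, an inequality for \<open>z (\<beta> I - Q)\<close> therefore becomes an inequality for \<open>z\<close>.
\<close>
lemma resolvent_solves_row:
  assumes A: "finite A" "y \<in> A" and Q: "sub_generator A Q" and \<beta>: "\<beta> > 0"
  shows "(\<Sum>w\<in>A. (\<beta> * z w - (\<Sum>x\<in>A. z x * Q x w)) * resolvent (mat_exp A Q) \<beta> w y) = \<beta> * z y"
proof -
  let ?R = "resolvent (mat_exp A Q) \<beta>"
  have "(\<Sum>w\<in>A. (\<Sum>x\<in>A. z x * Q x w) * ?R w y) = (\<Sum>x\<in>A. z x * (\<Sum>w\<in>A. Q x w * ?R w y))"
    unfolding sum_distrib_left sum_distrib_right by (subst sum.swap) (simp add: mult.assoc)
  also have "\<dots> = (\<Sum>x\<in>A. z x * (\<beta> * ?R x y - \<beta> * of_bool (x = y)))"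
    by (intro sum.cong refl) (simp add: resolvent_mat_exp_backward[OF A(1) _ A(2) Q \<beta>])
  also have "\<dots> = (\<Sum>x\<in>A. \<beta> * z x * ?R x y) - (\<Sum>x\<in>A. if x = y then \<beta> * z y else 0)"
    unfolding sum_subtractf[symmetric] by (intro sum.cong) (auto simp: algebra_simps)
  finally show ?thesis using A by (simp add: left_diff_distrib sum_subtractf)
qed

lemma resolvent_solves_column:
  assumes A: "finite A" "x \<in> A" and Q: "sub_generator A Q" and \<beta>: "\<beta> > 0"
  shows "(\<Sum>w\<in>A. resolvent (mat_exp A Q) \<beta> x w * (\<beta> * f w - (\<Sum>y\<in>A. Q w y * f y))) = \<beta> * f x"
proof -
  let ?R = "resolvent (mat_exp A Q) \<beta>"
  have "(\<Sum>w\<in>A. ?R x w * (\<Sum>y\<in>A. Q w y * f y)) = (\<Sum>y\<in>A. (\<Sum>w\<in>A. ?R x w * Q w y) * f y)"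
    unfolding sum_distrib_left sum_distrib_right by (subst sum.swap) (simp add: mult.assoc)
  also have "\<dots> = (\<Sum>y\<in>A. (\<beta> * ?R x y - \<beta> * of_bool (x = y)) * f y)"
    by (intro sum.cong refl) (simp add: resolvent_mat_exp_forward[OF A _ Q \<beta>])
  also have "\<dots> = (\<Sum>y\<in>A. ?R x y * (\<beta> * f y)) - (\<Sum>y\<in>A. if x = y then \<beta> * f x else 0)"
    unfolding sum_subtractf[symmetric] by (intro sum.cong) (auto simp: algebra_simps)
  finally show ?thesis using A by (simp add: right_diff_distrib sum_subtractf)
qed

lemma resolvent_mat_exp_row_sum_le_1:
  assumes A: "finite A" "x \<in> A" and Q: "sub_generator A Q" and \<beta>: "\<beta> > 0"
  shows "(\<Sum>y\<in>A. resolvent (mat_exp A Q) \<beta> x y) \<le> 1"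
proof -
  have "(\<Sum>w\<in>A. resolvent (mat_exp A Q) \<beta> x w * \<beta>)
     \<le> (\<Sum>w\<in>A. resolvent (mat_exp A Q) \<beta> x w * (\<beta> * 1 - (\<Sum>y\<in>A. Q w y * 1)))"
    using Q by (intro sum_mono mult_left_mono resolvent_mat_exp_nonneg A Q \<beta>) (auto simp: sub_generator_def)
  also have "\<dots> = \<beta>"
    unfolding resolvent_solves_column[OF A Q \<beta>] by simp
  finally show ?thesis using \<beta> by (simp flip: sum_distrib_right)
qed

text \<open>
  A row of the resolvent on the larger set, restricted to \<open>A\<close>, satisfies the resolvent equation on
  \<open>A\<close> with the inflow from \<open>B - A\<close> as a nonnegative extra source term.
\<close>
lemma resolvent_mat_exp_mono:
  assumes B: "finite B" "A \<subseteq> B" and xy: "x \<in> A" "y \<in> A"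
    and QB: "sub_generator B Q" and QA: "sub_generator A Q" and \<beta>: "\<beta> > 0"
  shows "resolvent (mat_exp A Q) \<beta> x y \<le> resolvent (mat_exp B Q) \<beta> x y"
proof -
  let ?RA = "resolvent (mat_exp A Q) \<beta>" and ?RB = "resolvent (mat_exp B Q) \<beta>"
  have A: "finite A" using B finite_subset by blast
  have "\<beta> * ?RA x y = (\<Sum>w\<in>A. if w = x then \<beta> * ?RA x y else 0)"
    using A xy by simp
  also have "\<dots> \<le> (\<Sum>w\<in>A. (\<beta> * ?RB x w - (\<Sum>z\<in>A. ?RB x z * Q z w)) * ?RA w y)"
  proof (rule sum_mono)
    fix w assume w: "w \<in> A"
    have "(\<Sum>z\<in>A. ?RB x z * Q z w) \<le> (\<Sum>z\<in>B. ?RB x z * Q z w)"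
    proof (intro sum_mono2 mult_nonneg_nonneg resolvent_mat_exp_nonneg QB \<beta> B)
      show "0 \<le> Q z w" if "z \<in> B - A" for z
        using that w B QB unfolding sub_generator_def by (metis DiffE subsetD)
    qed (use B xy in auto)
    also have "\<dots> = \<beta> * ?RB x w - \<beta> * of_bool (x = w)"
      using B w xy by (intro resolvent_mat_exp_forward QB \<beta>) auto
    finally have "\<beta> * of_bool (x = w) * ?RA w y \<le> (\<beta> * ?RB x w - (\<Sum>z\<in>A. ?RB x z * Q z w)) * ?RA w y"
      using A w xy by (intro mult_right_mono resolvent_mat_exp_nonneg QA \<beta>) auto
    then show "(if w = x then \<beta> * ?RA x y else 0) \<le> (\<beta> * ?RB x w - (\<Sum>z\<in>A. ?RB x z * Q z w)) * ?RA w y"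
      by (cases "w = x") auto
  qed
  also have "\<dots> = \<beta> * ?RB x y"
    by (rule resolvent_solves_row[OF A xy(2) QA \<beta>])
  finally show ?thesis using \<beta> by simp
qed

section \<open>Non-explosion and truncated resolvents\<close>

text \<open>
  Every time has a neighbourhood in which the path takes at most two values: it is constant to the
  right by right-continuity, and to the left it is locally constant between two consecutive
  discontinuities. Compactness of \<open>[0, T]\<close> does the rest.
\<close>
lemma regular_jump_path_finite_range:
  fixes f :: "real \<Rightarrow> 's"
  assumes f: "regular_jump_path f"
  shows "finite (f ` {0..T})"
proof -
  define D where "D = {t. 0 < t \<and> t \<le> T \<and> \<not> (\<forall>\<^sub>F s in at t. f s = f t)}"
  have D: "finite D" using f unfolding regular_jump_path_def D_def by blast
  have "\<exists>e>0. finite (f ` ({t - e<..<t + e} \<inter> {0..T}))" if t: "t \<in> {0..T}" for t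
  proof -
    have "\<forall>\<^sub>F s in at_right t. f s = f t"
      using f t unfolding regular_jump_path_def by auto
    then obtain r where r: "r > t" "\<And>s. s > t \<Longrightarrow> s < r \<Longrightarrow> f s = f t"
      unfolding eventually_at_right_field by blast
    \<comment> \<open>The last discontinuity before \<open>t\<close>, or \<open>0\<close> if there is none; for \<open>t = 0\<close> any negative number will do.\<close>
    define l where "l = (if t = 0 then -1 else Max (insert 0 {d\<in>D. d < t}))"
    have l: "l < t" using D t by (auto simp: l_def)
    have left: "f s = f ((max l 0 + t) / 2)" if s: "s \<in> {0..T}" "l < s" "s < t" for s
    proof -
      have t0: "t > 0" using s by auto
      have l0: "l \<ge> 0" and lD: "d \<le> l" if "d \<in> D" "d < t" for d
        using D t0 that by (auto simp: l_def)
      have l00: "l \<ge> 0" using D t0 by (auto simp: l_def)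
      show ?thesis
      proof (rule connected_local_const[of "{l<..<t}"])
        show "\<forall>u\<in>{l<..<t}. \<forall>\<^sub>F w in at u within {l<..<t}. f u = f w"
        proof
          fix u assume u: "u \<in> {l<..<t}"
          have "u \<notin> D" using lD[of u] u by force
          moreover have "0 < u" "u \<le> T" using u t l00 by auto
          ultimately have "\<forall>\<^sub>F w in at u. f w = f u" unfolding D_def by auto
          then have "\<forall>\<^sub>F w in at u. f u = f w" by eventually_elim simp
          then show "\<forall>\<^sub>F w in at u within {l<..<t}. f u = f w"
            by (rule filter_leD[OF at_le, rotated]) simp
        qed
      qed (use s l00 in auto)
    qed
    define e where "e = min (r - t) (t - l)"
    have "f ` ({t - e<..<t + e} \<inter> {0..T}) \<subseteq> {f t, f ((max l 0 + t) / 2)}"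
    proof
      fix w assume "w \<in> f ` ({t - e<..<t + e} \<inter> {0..T})"
      then obtain s where s: "w = f s" "t - e < s" "s < t + e" "s \<in> {0..T}" by auto
      then have "l < s" "s < r" by (auto simp: e_def min_def split: if_splits)
      with s r(2)[of s] left[of s] show "w \<in> {f t, f ((max l 0 + t) / 2)}"
        by (cases s t rule: linorder_cases) auto
    qed
    then have "finite (f ` ({t - e<..<t + e} \<inter> {0..T}))" by (rule finite_subset) simp
    moreover have "e > 0" using r(1) l by (simp add: e_def)
    ultimately show ?thesis by blast
  qed
  then have "\<forall>t\<in>{0..T}. \<exists>e. e > 0 \<and> finite (f ` ({t - e<..<t + e} \<inter> {0..T}))" by simp
  then obtain e where "\<forall>t\<in>{0..T}. e t > 0 \<and> finite (f ` ({t - e t<..<t + e t} \<inter> {0..T}))"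
    by (rule bchoice[THEN exE])
  then have e: "\<And>t. t \<in> {0..T} \<Longrightarrow> e t > 0"
      "\<And>t. t \<in> {0..T} \<Longrightarrow> finite (f ` ({t - e t<..<t + e t} \<inter> {0..T}))" by blast+
  have "{0..T} \<subseteq> (\<Union>t\<in>{0..T}. {t - e t<..<t + e t})"
  proof
    fix t assume "t \<in> {0..T}"
    then show "t \<in> (\<Union>t\<in>{0..T}. {t - e t<..<t + e t})"
      using e(1)[of t] by (intro UN_I[of t]) auto
  qed
  then obtain C where C: "C \<subseteq> {0..T}" "finite C" "{0..T} \<subseteq> (\<Union>t\<in>C. {t - e t<..<t + e t})"
    using compactE_image[of "{0..T}" "{0..T}" "\<lambda>t. {t - e t<..<t + e t}"] by auto
  have "f ` {0..T} \<subseteq> (\<Union>t\<in>C. f ` ({t - e t<..<t + e t} \<inter> {0..T}))"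
    using C(3) by blast
  then show ?thesis
    by (rule finite_subset) (use C e(2) in blast)
qed

text \<open>
  The Markov property for a past event of the form \<open>X u \<in> A\<close>, \<open>u \<in> U\<close>: split the event according to
  the values that the path takes on \<open>U\<close>.
\<close>
lemma markov_property_finite_set:
  assumes chain: "regular_jump_markov_chain F M X" and x: "x \<in> F" and A: "finite A"
    and U: "finite U" "U \<subseteq> {0..s}" and st: "s \<ge> 0" "t \<ge> 0" and yz: "y \<in> F" "z \<in> F"
  shows "\<P>(\<omega> in M x. X (s + t) \<omega> = z \<and> X s \<omega> = y \<and> (\<forall>u\<in>U. X u \<omega> \<in> A)) =
           \<P>(\<omega> in M x. X s \<omega> = y \<and> (\<forall>u\<in>U. X u \<omega> \<in> A)) * trans_fun M X t y z"
proof -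
  interpret prob_space "M x" using chain x by (auto simp: regular_jump_markov_chain_def)
  have meas: "X t \<in> M x \<rightarrow>\<^sub>M count_space F" if "t \<ge> 0" for t
    using chain x that by (auto simp: regular_jump_markov_chain_def)
  have sets: "{\<omega>\<in>space (M x). X t \<omega> = w} \<in> events" if "t \<ge> 0" for t w
  proof (cases "w \<in> F")
    case True
    then show ?thesis using measurable_sets[OF meas[OF that], of "{w}"]
      by (auto simp: vimage_def Int_def conj_commute)
  next
    case False
    then have "{\<omega>\<in>space (M x). X t \<omega> = w} = {}"
      using measurable_space[OF meas[OF that]] by auto
    then show ?thesis by (simp only: sets.empty_sets)
  qed
  have setsU: "{\<omega>\<in>space (M x). \<forall>u\<in>U. X u \<omega> = a u} \<in> events" for a
    using U by (intro sets.sets_Collect_finite_All sets) auto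
  have ev1: "{\<omega>\<in>space (M x). X s \<omega> = y \<and> (\<forall>u\<in>U. X u \<omega> = a u)} \<in> events" for a
    using st by (intro sets.sets_Collect_conj sets setsU)
  have ev2: "{\<omega>\<in>space (M x). X (s + t) \<omega> = z \<and> X s \<omega> = y \<and> (\<forall>u\<in>U. X u \<omega> = a u)} \<in> events" for a
    using st by (intro sets.sets_Collect_conj sets setsU) auto
  have one: "\<P>(\<omega> in M x. X (s + t) \<omega> = z \<and> X s \<omega> = y \<and> (\<forall>u\<in>U. X u \<omega> = a u)) =
      \<P>(\<omega> in M x. X s \<omega> = y \<and> (\<forall>u\<in>U. X u \<omega> = a u)) * trans_fun M X t y z" for a
  proof (cases "\<P>(\<omega> in M x. X s \<omega> = y \<and> (\<forall>u\<in>U. X u \<omega> = a u)) > 0")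
    case True
    have "\<P>(\<omega> in M x. X (s + t) \<omega> = z \<bar> X s \<omega> = y \<and> (\<forall>u\<in>U. X u \<omega> = a u)) = trans_fun M X t y z"
      by (rule chain[unfolded regular_jump_markov_chain_def, THEN conjunct2, THEN bspec, OF x,
          THEN conjunct2, THEN conjunct2, THEN conjunct2, THEN conjunct2, rule_format, OF st yz U True])
    then show ?thesis using True by (auto simp: cond_prob_def field_simps)
  next
    case False
    then have "\<P>(\<omega> in M x. X s \<omega> = y \<and> (\<forall>u\<in>U. X u \<omega> = a u)) = 0"
      by (simp add: zero_less_measure_iff)
    moreover have "\<P>(\<omega> in M x. X (s + t) \<omega> = z \<and> X s \<omega> = y \<and> (\<forall>u\<in>U. X u \<omega> = a u)) \<le>
        \<P>(\<omega> in M x. X s \<omega> = y \<and> (\<forall>u\<in>U. X u \<omega> = a u))"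
      by (rule finite_measure_mono[OF _ ev1]) auto
    ultimately show ?thesis by (simp add: measure_le_0_iff)
  qed
  have split: "\<P>(\<omega> in M x. G \<omega> \<and> (\<forall>u\<in>U. X u \<omega> \<in> A)) =
      (\<Sum>a\<in>PiE U (\<lambda>_. A). \<P>(\<omega> in M x. G \<omega> \<and> (\<forall>u\<in>U. X u \<omega> = a u)))"
    if G: "\<And>a. {\<omega>\<in>space (M x). G \<omega> \<and> (\<forall>u\<in>U. X u \<omega> = a u)} \<in> events" for G
  proof -
    have "{\<omega>\<in>space (M x). G \<omega> \<and> (\<forall>u\<in>U. X u \<omega> \<in> A)} =
        (\<Union>a\<in>PiE U (\<lambda>_. A). {\<omega>\<in>space (M x). G \<omega> \<and> (\<forall>u\<in>U. X u \<omega> = a u)})"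
      (is "?L = ?R")
    proof (intro set_eqI iffI)
      fix \<omega> assume "\<omega> \<in> ?L"
      then show "\<omega> \<in> ?R"
        by (intro UN_I[of "restrict (\<lambda>u. X u \<omega>) U"]) auto
    qed (auto simp: PiE_iff)
    moreover have "prob ?R = (\<Sum>a\<in>PiE U (\<lambda>_. A). \<P>(\<omega> in M x. G \<omega> \<and> (\<forall>u\<in>U. X u \<omega> = a u)))"
    proof (rule finite_measure_finite_Union)
      show "disjoint_family_on (\<lambda>a. {\<omega>\<in>space (M x). G \<omega> \<and> (\<forall>u\<in>U. X u \<omega> = a u)}) (PiE U (\<lambda>_. A))"
        unfolding disjoint_family_on_def
      proof safe
        fix a b \<omega> assume ab: "a \<in> PiE U (\<lambda>_. A)" "b \<in> PiE U (\<lambda>_. A)" "a \<noteq> b"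
          and "\<forall>u\<in>U. X u \<omega> = a u" "\<forall>u\<in>U. X u \<omega> = b u"
        then have "a = b" by (intro PiE_ext[OF ab(1,2)]) simp
        then show "\<omega> \<in> {}" using ab by simp
      qed
    qed (use U A G in \<open>auto intro: finite_PiE\<close>)
    ultimately show ?thesis by simp
  qed
  show ?thesis
    using split[of "\<lambda>\<omega>. X (s + t) \<omega> = z \<and> X s \<omega> = y"] split[of "\<lambda>\<omega>. X s \<omega> = y"] ev1 ev2
    by (simp add: one sum_distrib_right)
qed


lemma finite_subset_incseq:
  fixes A :: "nat \<Rightarrow> 'a set"
  assumes "finite R" "R \<subseteq> (\<Union>n. A n)" "incseq A"
  shows "\<exists>n. R \<subseteq> A n"
  using assms(1,2)
proof induction
  case (insert z R)
  then obtain n m where "R \<subseteq> A n" "z \<in> A m" by auto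
  then have "insert z R \<subseteq> A (max n m)"
    using incseqD[OF assms(3), of n "max n m"] incseqD[OF assms(3), of m "max n m"] by auto
  then show ?case ..
qed simp

lemma generator_tendsto:
  assumes "infinitesimal_generator F M X Q" "x \<in> F" "y \<in> F"
  shows "((\<lambda>t. (trans_fun M X t x y - of_bool (x = y)) / t) \<longlongrightarrow> Q x y) (at_right 0)"
  using assms unfolding infinitesimal_generator_def by blast

lemma generator_off_diagonal_nonneg:
  assumes gen: "infinitesimal_generator F M X Q" and xy: "x \<in> F" "y \<in> F" "x \<noteq> y"
  shows "Q x y \<ge> 0"
proof (rule tendsto_lowerbound)
  show "((\<lambda>t. (trans_fun M X t x y - of_bool (x = y)) / t) \<longlongrightarrow> Q x y) (at_right 0)"
    using generator_tendsto[OF gen] xy by blast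
  show "\<forall>\<^sub>F t in at_right 0. 0 \<le> (trans_fun M X t x y - of_bool (x = y)) / t"
    using eventually_at_right_less[of 0]
    by eventually_elim (use xy in \<open>auto simp: trans_fun_def\<close>)
qed simp

lemma generator_sub_generator:
  assumes gen: "infinitesimal_generator F M X Q" and A: "finite A" "A \<subseteq> F"
  shows "sub_generator A Q"
  unfolding sub_generator_def
proof (intro conjI ballI impI)
  show "Q x y \<ge> 0" if "x \<in> A" "y \<in> A" "x \<noteq> y" for x y
    using generator_off_diagonal_nonneg[OF gen] that A by blast
  show "(\<Sum>y\<in>A. Q x y) \<le> 0" if x: "x \<in> A" for x
  proof (rule has_sum_mono2)
    show "(Q x has_sum 0) F" using gen x A by (auto simp: infinitesimal_generator_def)
    show "(Q x has_sum (\<Sum>y\<in>A. Q x y)) A" using A by simp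
    show "0 \<le> Q x y" if "y \<in> F - A" for y
      using generator_off_diagonal_nonneg[OF gen, of x y] that x A by blast
  qed (use A in auto)
qed

lemma resolvent_row_sum_equation:
  assumes A: "finite A" "x \<in> A" and Q: "sub_generator A Q" and \<beta>: "\<beta> > 0"
  defines "r \<equiv> \<lambda>x. \<Sum>y\<in>A. resolvent (mat_exp A Q) \<beta> x y"
  shows "(\<Sum>z\<in>A. Q x z * r z) = \<beta> * r x - \<beta>"
proof -
  have "(\<Sum>z\<in>A. Q x z * r z) = (\<Sum>y\<in>A. \<Sum>z\<in>A. Q x z * resolvent (mat_exp A Q) \<beta> z y)"
    unfolding r_def sum_distrib_left by (rule sum.swap)
  also have "\<dots> = (\<Sum>y\<in>A. \<beta> * resolvent (mat_exp A Q) \<beta> x y - \<beta> * of_bool (x = y))"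
    by (intro sum.cong refl resolvent_mat_exp_backward A Q \<beta>)
  also have "\<dots> = \<beta> * r x - \<beta>"
    using A by (simp add: sum_subtractf r_def flip: sum_distrib_left)
  finally show ?thesis .
qed

text \<open>
  Let \<open>r x\<close> be the row sums of the truncated resolvent, which solve \<open>(\<beta> I - Q) r = \<beta>\<close> on \<open>A\<close>. Over a
  short time \<open>h\<close> the discounted expectation of \<open>r\<close> thus changes at rate \<open>Q r - \<beta> r = - \<beta>\<close>.
\<close>
lemma resolvent_row_sum_one_step:
  assumes gen: "infinitesimal_generator F M X Q" and A: "finite A" "A \<subseteq> F"
    and \<beta>: "\<beta> > 0" and \<epsilon>: "\<epsilon> > 0"
  defines "r \<equiv> \<lambda>x. \<Sum>y\<in>A. resolvent (mat_exp A Q) \<beta> x y"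
  shows "\<forall>\<^sub>F h in at_right 0. \<forall>y\<in>A. exp (- \<beta> * h) * (\<Sum>z\<in>A. trans_fun M X h y z * r z) \<le> r y - h * (\<beta> - \<epsilon>)"
proof (rule eventually_ball_finite[OF A(1)], intro ballI)
  fix y assume y: "y \<in> A"
  define g where "g h = exp (- \<beta> * h) * (\<Sum>z\<in>A. (trans_fun M X h y z - of_bool (y = z)) / h * r z)
      + (exp (- \<beta> * h) - 1) / h * r y" for h
  have "((\<lambda>h. exp (- \<beta> * h)) \<longlongrightarrow> 1) (at_right 0)" by real_asymp
  moreover have "((\<lambda>h. (exp (- \<beta> * h) - 1) / h) \<longlongrightarrow> - \<beta>) (at_right 0)" by real_asymp
  moreover have "((\<lambda>h. (\<Sum>z\<in>A. (trans_fun M X h y z - of_bool (y = z)) / h * r z)) \<longlongrightarrow> (\<Sum>z\<in>A. Q y z * r z)) (at_right 0)"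
    using y A by (intro tendsto_sum tendsto_mult tendsto_const generator_tendsto[OF gen]; blast)
  ultimately have "(g \<longlongrightarrow> 1 * (\<Sum>z\<in>A. Q y z * r z) + (- \<beta>) * r y) (at_right 0)"
    unfolding g_def by (intro tendsto_add tendsto_mult tendsto_const)
  also have "1 * (\<Sum>z\<in>A. Q y z * r z) + (- \<beta>) * r y = - \<beta>"
    unfolding r_def using resolvent_row_sum_equation[OF A(1) y generator_sub_generator[OF gen A] \<beta>] by simp
  finally have "\<forall>\<^sub>F h in at_right 0. g h < - \<beta> + \<epsilon>"
    using \<epsilon> by (intro order_tendstoD) auto
  then show "\<forall>\<^sub>F h in at_right 0. exp (- \<beta> * h) * (\<Sum>z\<in>A. trans_fun M X h y z * r z) \<le> r y - h * (\<beta> - \<epsilon>)"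
    using eventually_at_right_less[of 0]
  proof eventually_elim
    case (elim h)
    have "h * g h = exp (- \<beta> * h) * (\<Sum>z\<in>A. (trans_fun M X h y z - of_bool (y = z)) * r z)
      + (exp (- \<beta> * h) - 1) * r y"
    proof -
      have "(\<Sum>z\<in>A. (trans_fun M X h y z - of_bool (y = z)) / h * r z) =
          (\<Sum>z\<in>A. (trans_fun M X h y z - of_bool (y = z)) * r z) / h"
        by (simp add: sum_divide_distrib)
      moreover have "h * (E * (s / h) + (E - 1) / h * q) = E * s + (E - 1) * q" for E s q :: real
        using elim by (simp add: field_simps)
      ultimately show ?thesis unfolding g_def by simp
    qed
    also have "(\<Sum>z\<in>A. (trans_fun M X h y z - of_bool (y = z)) * r z) = (\<Sum>z\<in>A. trans_fun M X h y z * r z) - (\<Sum>z\<in>A. if y = z then r y else 0)"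
      unfolding sum_subtractf[symmetric] by (intro sum.cong) (auto simp: algebra_simps)
    also have "(\<Sum>z\<in>A. if y = z then r y else 0) = r y"
      using A y by simp
    finally have "h * g h = exp (- \<beta> * h) * (\<Sum>z\<in>A. trans_fun M X h y z * r z) - r y"
      by (simp add: algebra_simps)
    moreover have "h * g h \<le> h * (- \<beta> + \<epsilon>)"
      using elim by (intro mult_left_mono) auto
    ultimately show ?case by (simp add: algebra_simps)
  qed
qed

text \<open>
  The row sum at \<open>x\<close> is the probability of staying in \<open>A\<close> up to an independent exponential time. To
  bound it from below, observe the chain at the times \<open>k h\<close>. The discounted expectation \<open>s k\<close> of \<open>r\<close>
  at time \<open>k h\<close>, on the event that the chain has been seen only in \<open>A\<close>, drops in each step by about
  \<open>\<beta> h \<gamma> ^ k\<close> times the probability of this event. It starts at \<open>r x\<close> and stays nonnegative, so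
  that \<open>r x\<close> exceeds the sum of the drops. Rational times suffice, which keeps the event
  measurable.
\<close>
lemma resolvent_row_sum_ge_stay_prob:
  assumes chain: "regular_jump_markov_chain F M X" and gen: "infinitesimal_generator F M X Q"
    and A: "finite A" "A \<subseteq> F" and \<beta>: "\<beta> > 0" and x: "x \<in> A"
  shows "\<P>(\<omega> in M x. \<forall>s\<in>\<rat> \<inter> {0..real T}. X s \<omega> \<in> A) * (1 - exp (- \<beta> * T))
           \<le> (\<Sum>y\<in>A. resolvent (mat_exp A Q) \<beta> x y)"
proof -
  define r where "r = (\<lambda>x. \<Sum>y\<in>A. resolvent (mat_exp A Q) \<beta> x y)"
  define p where "p = \<P>(\<omega> in M x. \<forall>s\<in>\<rat> \<inter> {0..real T}. X s \<omega> \<in> A)"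
  note Q = generator_sub_generator[OF gen A]
  have xF: "x \<in> F" using x A by auto
  interpret prob_space "M x" using chain xF by (auto simp: regular_jump_markov_chain_def)
  have meas: "X t \<in> M x \<rightarrow>\<^sub>M count_space F" if "t \<ge> 0" for t
    using chain xF that by (auto simp: regular_jump_markov_chain_def)
  have sets: "{\<omega>\<in>space (M x). X t \<omega> \<in> B} \<in> events" if "t \<ge> 0" for t B
  proof -
    have "{\<omega>\<in>space (M x). X t \<omega> \<in> B} = X t -` (B \<inter> F) \<inter> space (M x)"
      using measurable_space[OF meas[OF that]] by auto
    then show ?thesis using measurable_sets[OF meas[OF that], of "B \<inter> F"] by simp
  qed
  have sets1: "{\<omega>\<in>space (M x). X t \<omega> = w} \<in> events" if "t \<ge> 0" for t w
    using sets[OF that, of "{w}"] by simp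
  have r0: "r y \<ge> 0" if "y \<in> A" for y
    unfolding r_def by (intro sum_nonneg resolvent_mat_exp_nonneg A Q \<beta> that)
  have key: "(\<beta> - \<epsilon>) * (p * (1 - exp (- \<beta> * T))) \<le> \<beta> * r x" if \<epsilon>: "0 < \<epsilon>" "\<epsilon> < \<beta>" for \<epsilon>
  proof -
    obtain d where d: "d > 0" "\<And>h. 0 < h \<Longrightarrow> h < d \<Longrightarrow> 
        \<forall>y\<in>A. exp (- \<beta> * h) * (\<Sum>z\<in>A. trans_fun M X h y z * r z) \<le> r y - h * (\<beta> - \<epsilon>)"
      using resolvent_row_sum_one_step[OF gen A \<beta> \<epsilon>(1)] unfolding eventually_at_right_field r_def by blast
    obtain j where j: "inverse (real (Suc j)) < d" using reals_Archimedean[OF d(1)] by blast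
    define h where "h = inverse (real (Suc j))"
    have h: "h > 0" "h < d" using j by (auto simp: h_def)
    define \<gamma> where "\<gamma> = exp (- \<beta> * h)"
    have \<gamma>: "0 < \<gamma>" "\<gamma> < 1" using h \<beta> by (auto simp: \<gamma>_def)
    \<comment> \<open>The number of steps of length \<open>h\<close> that fill \<open>[0, T]\<close> exactly.\<close>
    define m where "m = T * Suc j"
    have mh: "real m * h = T" by (simp only: m_def h_def of_nat_mult mult.assoc) simp
    define U where "U k = (\<lambda>i. real i * h) ` {..k}" for k
    define a where "a k y = \<P>(\<omega> in M x. X (real k * h) \<omega> = y \<and> (\<forall>u\<in>U k. X u \<omega> \<in> A))" for k y
    have U: "finite (U k)" "U k \<subseteq> {0..real k * h}" for k
      using h by (auto simp: U_def)
    have evU: "{\<omega>\<in>space (M x). \<forall>u\<in>U k. X u \<omega> \<in> A} \<in> events" for k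
      using U(2)[of k] by (intro sets.sets_Collect_finite_All sets U) auto
    have a0: "a k y \<ge> 0" for k y by (simp add: a_def)
    have a_sum: "(\<Sum>y\<in>A. a k y) = \<P>(\<omega> in M x. \<forall>u\<in>U k. X u \<omega> \<in> A)" for k
    proof -
      have "\<P>(\<omega> in M x. \<forall>u\<in>U k. X u \<omega> \<in> A) =
          prob (\<Union>y\<in>A. {\<omega>\<in>space (M x). X (real k * h) \<omega> = y \<and> (\<forall>u\<in>U k. X u \<omega> \<in> A)})"
        by (intro arg_cong[where f = prob]) (auto simp: U_def)
      also have "\<dots> = (\<Sum>y\<in>A. a k y)"
        unfolding a_def using h
        by (intro finite_measure_finite_Union A) 
           (auto simp: disjoint_family_on_def intro!: sets.sets_Collect_conj sets1 evU)
      finally show ?thesis ..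
    qed
    have a_Suc: "a (Suc k) z = (\<Sum>y\<in>A. a k y * trans_fun M X h y z)" if z: "z \<in> A" for k z
    proof -
      have kh: "real (Suc k) * h = real k * h + h" by (simp add: algebra_simps)
      have UU: "U (Suc k) = insert (real k * h + h) (U k)"
        by (simp add: U_def atMost_Suc kh[symmetric])
      have "a (Suc k) z = prob (\<Union>y\<in>A. {\<omega>\<in>space (M x). X (real k * h + h) \<omega> = z \<and> X (real k * h) \<omega> = y \<and> (\<forall>u\<in>U k. X u \<omega> \<in> A)})"
        unfolding a_def kh UU using z by (intro arg_cong[where f = prob]) (auto simp: U_def)
      also have "\<dots> = (\<Sum>y\<in>A. \<P>(\<omega> in M x. X (real k * h + h) \<omega> = z \<and> X (real k * h) \<omega> = y \<and> (\<forall>u\<in>U k. X u \<omega> \<in> A)))"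
        using h
        by (intro finite_measure_finite_Union A) 
           (auto simp: disjoint_family_on_def intro!: sets.sets_Collect_conj sets1 evU)
      also have "\<dots> = (\<Sum>y\<in>A. a k y * trans_fun M X h y z)"
        unfolding a_def using h A z
        by (intro sum.cong refl markov_property_finite_set[OF chain xF A(1) U]) auto
      finally show ?thesis .
    qed
    define s where "s k = \<gamma> ^ k * (\<Sum>y\<in>A. a k y * r y)" for k
    have step: "s (Suc k) \<le> s k - h * (\<beta> - \<epsilon>) * p * \<gamma> ^ k" if k: "k \<le> m" for k
    proof -
      have "(\<Sum>z\<in>A. a (Suc k) z * r z) = (\<Sum>z\<in>A. (\<Sum>y\<in>A. a k y * trans_fun M X h y z) * r z)"
        by (intro sum.cong refl) (simp add: a_Suc)
      also have "\<dots> = (\<Sum>y\<in>A. a k y * (\<Sum>z\<in>A. trans_fun M X h y z * r z))"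
        unfolding sum_distrib_left sum_distrib_right by (subst sum.swap) (simp add: mult.assoc)
      finally have "s (Suc k) = \<gamma> ^ k * (\<Sum>y\<in>A. a k y * (\<gamma> * (\<Sum>z\<in>A. trans_fun M X h y z * r z)))"
        by (simp add: s_def sum_distrib_left mult_ac)
      also have "\<dots> \<le> \<gamma> ^ k * (\<Sum>y\<in>A. a k y * (r y - h * (\<beta> - \<epsilon>)))"
        using d(2)[OF h] \<gamma> by (intro mult_left_mono sum_mono a0) (auto simp: \<gamma>_def)
      also have "\<dots> = s k - \<gamma> ^ k * (h * (\<beta> - \<epsilon>)) * (\<Sum>y\<in>A. a k y)"
        by (simp add: s_def right_diff_distrib sum_subtractf sum_distrib_left sum_distrib_right mult_ac)
      also have "\<dots> \<le> s k - \<gamma> ^ k * (h * (\<beta> - \<epsilon>)) * p"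
      proof -
        have "real k * h \<le> T" using k h mh by (metis mult_right_mono less_imp_le of_nat_mono)
        then have "U k \<subseteq> {0..real T}" using U(2)[of k] by force
        moreover have "U k \<subseteq> \<rat>" by (auto simp: U_def h_def)
        ultimately have "U k \<subseteq> \<rat> \<inter> {0..real T}" by blast
        then have "p \<le> (\<Sum>y\<in>A. a k y)"
          unfolding p_def a_sum by (intro finite_measure_mono evU) auto
        then show ?thesis
          using \<gamma> h \<epsilon> by (intro diff_left_mono mult_left_mono) auto
      qed
      finally show ?thesis by (simp add: mult_ac)
    qed
    have "s k \<le> s 0 - h * (\<beta> - \<epsilon>) * p * (\<Sum>i<k. \<gamma> ^ i)" if "k \<le> m" for k
      using that
    proof (induction k)
      case (Suc k)
      then show ?case using step[of k] by (simp add: algebra_simps)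
    qed simp
    from this[of m] have "h * (\<beta> - \<epsilon>) * p * (\<Sum>i<m. \<gamma> ^ i) \<le> s 0 - s m" by simp
    also have "\<dots> \<le> s 0"
      using \<gamma> by (auto simp: s_def intro!: mult_nonneg_nonneg sum_nonneg a0 r0)
    also have "s 0 \<le> (\<Sum>y\<in>A. if y = x then r x else 0)"
      unfolding s_def power_0 mult_1
    proof (rule sum_mono)
      fix y assume y: "y \<in> A"
      have "AE \<omega> in M x. X 0 \<omega> = x" using chain xF by (auto simp: regular_jump_markov_chain_def)
      then have "a 0 y \<le> \<P>(\<omega> in M x. x = y)"
        unfolding a_def
      proof (intro finite_measure_mono_AE)
        assume "AE \<omega> in M x. X 0 \<omega> = x"
        then show "AE \<omega> in M x. \<omega> \<in> {\<omega>\<in>space (M x). X (real 0 * h) \<omega> = y \<and> (\<forall>u\<in>U 0. X u \<omega> \<in> A)} \<longrightarrow>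
            \<omega> \<in> {\<omega>\<in>space (M x). x = y}"
          by eventually_elim auto
      qed auto
      then have "a 0 y \<le> of_bool (y = x)" by (auto simp: prob_space)
      then show "a 0 y * r y \<le> (if y = x then r x else 0)"
        using r0[OF y] a0[of 0 y] mult_right_mono[of "a 0 y" 1 "r y"] by (auto split: if_splits)
    qed
    also have "\<dots> = r x" using A x by simp
    also have "(\<Sum>i<m. \<gamma> ^ i) = (1 - \<gamma> ^ m) / (1 - \<gamma>)"
      using \<gamma> by (simp add: sum_gp_strict)
    also have "\<gamma> ^ m = exp (- \<beta> * T)"
      unfolding \<gamma>_def mh[symmetric] by (simp flip: exp_of_nat_mult add: mult_ac)
    finally have "h * (\<beta> - \<epsilon>) * p * ((1 - exp (- \<beta> * T)) / (1 - \<gamma>)) \<le> r x" .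
    then have "(\<beta> - \<epsilon>) * (p * (1 - exp (- \<beta> * T))) * h \<le> r x * (1 - \<gamma>)"
      using \<gamma> by (simp add: field_simps)
    also have "\<dots> \<le> r x * (\<beta> * h)"
      using exp_ge_add_one_self[of "- \<beta> * h"] r0[OF x] by (intro mult_left_mono) (auto simp: \<gamma>_def)
    finally show ?thesis using h by (simp add: mult_ac)
  qed
  have "\<beta> * (p * (1 - exp (- \<beta> * T))) \<le> \<beta> * r x"
  proof (rule tendsto_upperbound)
    show "((\<lambda>\<epsilon>. (\<beta> - \<epsilon>) * (p * (1 - exp (- \<beta> * T)))) \<longlongrightarrow> \<beta> * (p * (1 - exp (- \<beta> * T)))) (at_right 0)"
      by (auto intro!: tendsto_eq_intros)
    show "\<forall>\<^sub>F \<epsilon> in at_right 0. (\<beta> - \<epsilon>) * (p * (1 - exp (- \<beta> * T))) \<le> \<beta> * r x"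
      using eventually_at_right_real[OF \<beta>] by eventually_elim (rule key, auto)
  qed simp
  then show ?thesis using \<beta> by (simp add: r_def p_def)
qed

text \<open>
  This is the only place where non-explosion enters: a path visits finitely many states in \<open>[0, T]\<close>,
  so it is confined to \<open>A n\<close> with probability tending to \<open>1\<close>.
\<close>
lemma resolvent_row_sum_tendsto_1:
  assumes chain: "regular_jump_markov_chain F M X" and gen: "infinitesimal_generator F M X Q"
    and A: "\<And>n. finite (A n)" "incseq A" "(\<Union>n. A n) = F" and \<beta>: "\<beta> > 0" and x: "x \<in> F"
  shows "(\<lambda>n. \<Sum>y\<in>A n. resolvent (mat_exp (A n) Q) \<beta> x y) \<longlonglongrightarrow> 1"
proof -
  define r where "r n = (\<Sum>y\<in>A n. resolvent (mat_exp (A n) Q) \<beta> x y)" for n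
  have AF: "A n \<subseteq> F" for n using A(3) by auto
  interpret prob_space "M x" using chain x by (auto simp: regular_jump_markov_chain_def)
  have meas: "X t \<in> M x \<rightarrow>\<^sub>M count_space F" if "t \<ge> 0" for t
    using chain x that by (auto simp: regular_jump_markov_chain_def)
  have sets: "{\<omega>\<in>space (M x). X t \<omega> \<in> B} \<in> events" if "t \<ge> 0" for t B
  proof -
    have "{\<omega>\<in>space (M x). X t \<omega> \<in> B} = X t -` (B \<inter> F) \<inter> space (M x)"
      using measurable_space[OF meas[OF that]] by auto
    then show ?thesis using measurable_sets[OF meas[OF that], of "B \<inter> F"] by simp
  qed
  obtain n0 where n0: "x \<in> A n0" using A(3) x by auto
  have xA: "x \<in> A n" if "n \<ge> n0" for n using A(2) n0 that by (auto simp: incseq_def)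
  have upper: "r n \<le> 1" if "n \<ge> n0" for n
    unfolding r_def by (intro resolvent_mat_exp_row_sum_le_1 A xA that generator_sub_generator[OF gen] AF \<beta>)
  define D where "D T n = {\<omega>\<in>space (M x). \<forall>s\<in>\<rat> \<inter> {0..real T}. X s \<omega> \<in> A n}" for T :: nat and n
  have evD: "D T n \<in> events" for T n
    unfolding D_def by (intro sets.sets_Collect_countable_All' sets)
      (auto intro: countable_subset[OF _ countable_rat])
  have stay: "(\<lambda>n. prob (D T n)) \<longlonglongrightarrow> 1" for T
  proof -
    have "(\<lambda>n. prob (D T n)) \<longlonglongrightarrow> prob (\<Union>n. D T n)"
    proof (rule finite_Lim_measure_incseq)
      show "incseq (D T)"
        unfolding incseq_def D_def using incseqD[OF A(2)] by blast
    qed (use evD in auto)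
    also have "prob (\<Union>n. D T n) = 1"
    proof (rule prob_eq_1[THEN iffD2])
      have "AE \<omega> in M x. regular_jump_path (\<lambda>t. X t \<omega>)"
        using chain x by (auto simp: regular_jump_markov_chain_def)
      then show "AE \<omega> in M x. \<omega> \<in> (\<Union>n. D T n)"
      proof (rule AE_mp, intro AE_I2 impI)
        fix \<omega> assume \<omega>: "\<omega> \<in> space (M x)" and "regular_jump_path (\<lambda>t. X t \<omega>)"
        then have "finite ((\<lambda>t. X t \<omega>) ` {0..real T})" (is "finite ?R")
          by (intro regular_jump_path_finite_range)
        moreover have "?R \<subseteq> (\<Union>n. A n)"
          using measurable_space[OF meas \<omega>] A(3) by auto
        ultimately obtain n where "?R \<subseteq> A n"
          using finite_subset_incseq A(2) by metis
        then show "\<omega> \<in> (\<Union>n. D T n)" using \<omega> by (intro UN_I[of n]) (auto simp: D_def)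
      qed
    qed (use evD in auto)
    finally show ?thesis .
  qed
  have "r \<longlonglongrightarrow> 1"
  proof (rule order_tendstoI)
    fix a :: real assume "a > 1"
    then show "\<forall>\<^sub>F n in sequentially. r n < a"
      using upper by (intro eventually_mono[OF eventually_ge_at_top[of n0]]) (rule le_less_trans)
  next
    fix a :: real assume a: "a < 1"
    have "(\<lambda>T. 1 - exp (- \<beta> * real T)) \<longlonglongrightarrow> 1" using \<beta> by real_asymp
    then have "\<forall>\<^sub>F T in sequentially. a < 1 - exp (- \<beta> * real T)"
      using a by (rule order_tendstoD)
    then obtain T :: nat where T: "a < 1 - exp (- \<beta> * real T)"
      by (auto simp: eventually_sequentially)
    have "(\<lambda>n. prob (D T n) * (1 - exp (- \<beta> * real T))) \<longlonglongrightarrow> 1 * (1 - exp (- \<beta> * real T))"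
      by (intro tendsto_mult stay tendsto_const)
    then have "\<forall>\<^sub>F n in sequentially. a < prob (D T n) * (1 - exp (- \<beta> * real T))"
      using T by (intro order_tendstoD) auto
    then show "\<forall>\<^sub>F n in sequentially. a < r n"
      using eventually_ge_at_top[of n0]
    proof eventually_elim
      case (elim n)
      then show ?case
        using resolvent_row_sum_ge_stay_prob[OF chain gen A(1) AF \<beta> xA[OF elim(2)], of T]
        by (simp add: r_def D_def)
    qed
  qed
  then show ?thesis unfolding r_def .
qed

section \<open>The resolvent kernel of a non-explosive generator\<close>

lemma infsum_dominated_convergence:
  fixes f :: "nat \<Rightarrow> 'a \<Rightarrow> real"
  assumes lim: "\<And>x. x \<in> F \<Longrightarrow> (\<lambda>n. f n x) \<longlonglongrightarrow> g x"
    and bound: "\<And>n x. x \<in> F \<Longrightarrow> \<bar>f n x\<bar> \<le> w x" and w: "w summable_on F"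
  shows "g summable_on F" "(\<lambda>n. \<Sum>\<^sub>\<infinity>x\<in>F. f n x) \<longlonglongrightarrow> (\<Sum>\<^sub>\<infinity>x\<in>F. g x)"
proof -
  have conv: "Infinite_Sum.abs_summable_on h F \<longleftrightarrow> integrable (count_space F) h" for h :: "'a \<Rightarrow> real"
    unfolding abs_summable_on_def[symmetric] by (rule abs_summable_equivalent)
  have conv': "integral\<^sup>L (count_space F) h = (\<Sum>\<^sub>\<infinity>x\<in>F. h x)" if "integrable (count_space F) h" for h :: "'a \<Rightarrow> real"
    using infsetsum_infsum[of h F] that unfolding abs_summable_on_def infsetsum_def by blast
  have w': "integrable (count_space F) w"
    using w conv summable_on_iff_abs_summable_on_real by blast
  have AE1: "AE x in count_space F. (\<lambda>n. f n x) \<longlonglongrightarrow> g x"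
    using lim by (simp add: AE_count_space)
  have AE2: "AE x in count_space F. norm (f n x) \<le> w x" for n
    using bound by (simp add: AE_count_space)
  have g: "integrable (count_space F) g"
    by (rule integrable_dominated_convergence[OF _ _ w' AE1 AE2]) simp_all
  have f: "integrable (count_space F) (f n)" for n
    by (rule integrable_dominated_convergence2[OF _ _ w' AE1 AE2]) simp_all
  show "g summable_on F"
    using g conv[of g] by (blast intro: abs_summable_summable)
  have "(\<lambda>n. integral\<^sup>L (count_space F) (f n)) \<longlonglongrightarrow> integral\<^sup>L (count_space F) g"
    by (rule integral_dominated_convergence[OF _ _ w' AE1 AE2]) simp_all
  then show "(\<lambda>n. \<Sum>\<^sub>\<infinity>x\<in>F. f n x) \<longlonglongrightarrow> (\<Sum>\<^sub>\<infinity>x\<in>F. g x)"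
    by (simp only: conv' f g)
qed

text \<open>
  Fubini's theorem for a signed row vector times a signed matrix.
\<close>
lemma infsum_signed_kernel_swap:
  fixes f k l :: "'a \<Rightarrow> real" and K :: "'a \<Rightarrow> 'b \<Rightarrow> real"
  assumes k: "\<And>x. x \<in> F \<Longrightarrow> (K x has_sum k x) G"
    and l: "\<And>x. x \<in> F \<Longrightarrow> ((\<lambda>y. \<bar>K x y\<bar>) has_sum l x) G"
    and f: "(\<lambda>x. \<bar>f x\<bar> * l x) summable_on F"
  shows "y \<in> G \<Longrightarrow> (\<lambda>x. f x * K x y) summable_on F"
    and "((\<lambda>y. \<Sum>\<^sub>\<infinity>x\<in>F. f x * K x y) has_sum (\<Sum>\<^sub>\<infinity>x\<in>F. f x * k x)) G"
proof -
  have "(\<lambda>(x, y). \<bar>f x\<bar> * \<bar>K x y\<bar>) summable_on (F \<times> G)"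
  proof (rule summable_on_SigmaI[where g = "\<lambda>x. \<bar>f x\<bar> * l x"])
    show "((\<lambda>y. case (x, y) of (x, y) \<Rightarrow> \<bar>f x\<bar> * \<bar>K x y\<bar>) has_sum \<bar>f x\<bar> * l x) G" if "x \<in> F" for x
      unfolding prod.case by (rule has_sum_cmult_right[OF l[OF that]])
  qed (use f in simp_all)
  then have "(\<lambda>p. norm ((\<lambda>(x, y). f x * K x y) p)) summable_on (F \<times> G)"
    by (rule summable_on_cong[THEN iffD1, rotated]) (auto simp: abs_mult)
  then have s: "(\<lambda>(x, y). f x * K x y) summable_on (F \<times> G)"
    by (rule abs_summable_summable)
  then have s': "(\<lambda>(y, x). f x * K x y) summable_on (G \<times> F)"
    by (subst (asm) summable_on_swap) (simp add: case_prod_unfold)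
  show col: "(\<lambda>x. f x * K x y) summable_on F" if "y \<in> G" for y
    using summable_on_SigmaD1[OF s' that] .
  obtain T where T: "((\<lambda>(x, y). f x * K x y) has_sum T) (F \<times> G)"
    using s by (auto simp: summable_on_def)
  then have T': "((\<lambda>(y, x). f x * K x y) has_sum T) (G \<times> F)"
    by (subst (asm) has_sum_swap) (simp add: case_prod_unfold)
  have "((\<lambda>x. f x * k x) has_sum T) F"
  proof (rule has_sum_SigmaD[OF T])
    show "((\<lambda>y. case (x, y) of (x, y) \<Rightarrow> f x * K x y) has_sum f x * k x) G" if "x \<in> F" for x
      unfolding prod.case by (rule has_sum_cmult_right[OF k[OF that]])
  qed
  then have "T = (\<Sum>\<^sub>\<infinity>x\<in>F. f x * k x)" by (simp add: infsumI)
  moreover have "((\<lambda>y. \<Sum>\<^sub>\<infinity>x\<in>F. f x * K x y) has_sum T) G"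
  proof (rule has_sum_SigmaD[OF T'])
    show "((\<lambda>x. case (y, x) of (y, x) \<Rightarrow> f x * K x y) has_sum (\<Sum>\<^sub>\<infinity>x\<in>F. f x * K x y)) F" if "y \<in> G" for y
      unfolding prod.case by (rule has_sum_infsum[OF col[OF that]])
  qed
  ultimately show "((\<lambda>y. \<Sum>\<^sub>\<infinity>x\<in>F. f x * K x y) has_sum (\<Sum>\<^sub>\<infinity>x\<in>F. f x * k x)) G" by simp
qed

lemma infsum_kernel_swap:
  fixes f k :: "'a \<Rightarrow> real" and K :: "'a \<Rightarrow> 'b \<Rightarrow> real"
  assumes K: "\<And>x y. x \<in> F \<Longrightarrow> y \<in> G \<Longrightarrow> K x y \<ge> 0"
    and k: "\<And>x. x \<in> F \<Longrightarrow> (K x has_sum k x) G"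
    and f: "(\<lambda>x. \<bar>f x\<bar> * k x) summable_on F"
  shows "y \<in> G \<Longrightarrow> (\<lambda>x. f x * K x y) summable_on F"
    and "((\<lambda>y. \<Sum>\<^sub>\<infinity>x\<in>F. f x * K x y) has_sum (\<Sum>\<^sub>\<infinity>x\<in>F. f x * k x)) G"
proof -
  have l: "((\<lambda>y. \<bar>K x y\<bar>) has_sum k x) G" if "x \<in> F" for x
    using k[OF that] by (rule has_sum_cong[THEN iffD1, rotated]) (simp add: K that)
  show "y \<in> G \<Longrightarrow> (\<lambda>x. f x * K x y) summable_on F"
    and "((\<lambda>y. \<Sum>\<^sub>\<infinity>x\<in>F. f x * K x y) has_sum (\<Sum>\<^sub>\<infinity>x\<in>F. f x * k x)) G"
    by (rule infsum_signed_kernel_swap[OF k l f], assumption+)+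
qed

text \<open>
  A conservative \<open>q\<close>-matrix with an exhaustion of the state space by finite sets. The assumption \<open>mass\<close>
  is non-explosion: the truncated resolvents lose no mass in the limit.
\<close>
locale nonexplosive_generator =
  fixes F :: "'s set" and Q :: "'s \<Rightarrow> 's \<Rightarrow> real" and A :: "nat \<Rightarrow> 's set" and \<beta> :: real
  assumes finite_A: "\<And>n. finite (A n)" and incseq_A: "incseq A" and Union_A: "(\<Union>n. A n) = F"
    and \<beta>_pos: "\<beta> > 0"
    and off_diagonal_nonneg: "\<And>x y. x \<in> F \<Longrightarrow> y \<in> F \<Longrightarrow> x \<noteq> y \<Longrightarrow> Q x y \<ge> 0"
    and sub_generator_A: "\<And>n. sub_generator (A n) Q"
    and mass: "\<And>x. x \<in> F \<Longrightarrow> (\<lambda>n. \<Sum>y\<in>A n. resolvent (mat_exp (A n) Q) \<beta> x y) \<longlonglongrightarrow> 1"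
begin

text \<open>The truncated resolvents, extended by \<open>0\<close> so that they increase with \<open>n\<close>.\<close>
definition R :: "nat \<Rightarrow> 's \<Rightarrow> 's \<Rightarrow> real" where
  "R n x y = (if x \<in> A n \<and> y \<in> A n then resolvent (mat_exp (A n) Q) \<beta> x y else 0)"

text \<open>
  The resolvent \<open>\<beta> (\<beta> I - Q)\<^sup>-\<^sup>1\<close> of the minimal transition function of \<open>Q\<close>, which under non-explosion is
  the transition function of every chain generated by \<open>Q\<close>.
\<close>
definition \<Phi> :: "'s \<Rightarrow> 's \<Rightarrow> real" where
  "\<Phi> x y = (SUP n. R n x y)"

lemma A_subset_F: "A n \<subseteq> F" using Union_A by blast

lemma R_nonneg: "R n x y \<ge> 0"
  by (simp add: R_def resolvent_mat_exp_nonneg finite_A sub_generator_A \<beta>_pos)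

lemma R_row_le_1: "x \<in> A n \<Longrightarrow> (\<Sum>y\<in>A n. R n x y) \<le> 1"
  using resolvent_mat_exp_row_sum_le_1[OF finite_A _ sub_generator_A \<beta>_pos, of x n] by (simp add: R_def)

lemma R_le_1: "R n x y \<le> 1"
proof (cases "x \<in> A n \<and> y \<in> A n")
  case True
  then have "R n x y \<le> (\<Sum>y\<in>A n. R n x y)"
    by (intro member_le_sum) (auto simp: R_nonneg finite_A)
  then show ?thesis using R_row_le_1 True by force
qed (auto simp: R_def)

lemma R_mono: "m \<le> n \<Longrightarrow> R m x y \<le> R n x y"
proof (cases "x \<in> A m \<and> y \<in> A m")
  case True
  assume "m \<le> n"
  then have sub: "A m \<subseteq> A n" using incseqD[OF incseq_A] by blast
  show ?thesis
    using resolvent_mat_exp_mono[OF finite_A sub _ _ sub_generator_A sub_generator_A \<beta>_pos, of x y] True sub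
    by (auto simp: R_def)
qed (auto simp: R_def resolvent_mat_exp_nonneg finite_A sub_generator_A \<beta>_pos)

lemma R_le_\<Phi>: "R n x y \<le> \<Phi> x y"
  unfolding \<Phi>_def by (rule cSUP_upper) (auto intro!: bdd_aboveI[of _ 1] simp: R_le_1)

lemma R_tendsto_\<Phi>: "(\<lambda>n. R n x y) \<longlonglongrightarrow> \<Phi> x y"
  unfolding \<Phi>_def
  by (rule LIMSEQ_incseq_SUP) (auto intro!: bdd_aboveI[of _ 1] incseq_SucI R_mono simp: R_le_1)

lemma \<Phi>_nonneg: "\<Phi> x y \<ge> 0"
  using R_nonneg R_le_\<Phi> order_trans by blast

lemma eventually_subset_A: "finite G \<Longrightarrow> G \<subseteq> F \<Longrightarrow> \<forall>\<^sub>F n in sequentially. G \<subseteq> A n"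
proof -
  assume "finite G" "G \<subseteq> F"
  then obtain m where "G \<subseteq> A m" using finite_subset_incseq incseq_A Union_A by metis
  then show ?thesis
    using incseqD[OF incseq_A] by (intro eventually_sequentiallyI[of m]) blast
qed

text \<open>Fatou's lemma for a row of \<open>\<Phi>\<close>: bounds that are uniform in \<open>n\<close> pass to the limit.\<close>
lemma \<Phi>_sum_le:
  assumes x: "x \<in> F" and f: "\<And>y. y \<in> F \<Longrightarrow> f y \<ge> 0"
    and le: "\<And>n. x \<in> A n \<Longrightarrow> (\<Sum>y\<in>A n. R n x y * f y) \<le> B"
  shows "(\<lambda>y. \<Phi> x y * f y) summable_on F" "(\<Sum>\<^sub>\<infinity>y\<in>F. \<Phi> x y * f y) \<le> B"
proof -
  have fin: "(\<Sum>y\<in>G. \<Phi> x y * f y) \<le> B" if G: "finite G" "G \<subseteq> F" for G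
  proof (rule LIMSEQ_le_const2)
    show "(\<lambda>n. \<Sum>y\<in>G. R n x y * f y) \<longlonglongrightarrow> (\<Sum>y\<in>G. \<Phi> x y * f y)"
      by (intro tendsto_sum tendsto_mult R_tendsto_\<Phi> tendsto_const)
    have "\<forall>\<^sub>F n in sequentially. insert x G \<subseteq> A n"
      using x G by (intro eventually_subset_A) auto
    then have "\<forall>\<^sub>F n in sequentially. (\<Sum>y\<in>G. R n x y * f y) \<le> B"
    proof eventually_elim
      case (elim n)
      have "(\<Sum>y\<in>G. R n x y * f y) \<le> (\<Sum>y\<in>A n. R n x y * f y)"
        using elim f A_subset_F[of n]
        by (intro sum_mono2 finite_A mult_nonneg_nonneg R_nonneg) auto
      with le elim show ?case by force
    qed
    then show "\<exists>N. \<forall>n\<ge>N. (\<Sum>y\<in>G. R n x y * f y) \<le> B"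
      by (simp add: eventually_sequentially)
  qed
  show s: "(\<lambda>y. \<Phi> x y * f y) summable_on F"
    using fin f by (intro nonneg_bdd_above_summable_on bdd_aboveI[of _ B]) (auto simp: \<Phi>_nonneg)
  show "(\<Sum>\<^sub>\<infinity>y\<in>F. \<Phi> x y * f y) \<le> B"
    using s fin by (intro infsum_le_finite_sums) auto
qed

lemma \<Phi>_stochastic:
  assumes x: "x \<in> F"
  shows "(\<Phi> x has_sum 1) F"
proof -
  have s: "\<Phi> x summable_on F" and le: "(\<Sum>\<^sub>\<infinity>y\<in>F. \<Phi> x y) \<le> 1"
    using \<Phi>_sum_le[OF x, of "\<lambda>_. 1" 1] R_row_le_1 by auto
  have "1 \<le> (\<Sum>\<^sub>\<infinity>y\<in>F. \<Phi> x y)"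
  proof (rule LIMSEQ_le_const2[OF mass[OF x]])
    obtain m where m: "\<And>n. n \<ge> m \<Longrightarrow> x \<in> A n"
      using eventually_subset_A[of "{x}"] x by (auto simp: eventually_sequentially)
    have "(\<Sum>y\<in>A n. resolvent (mat_exp (A n) Q) \<beta> x y) \<le> (\<Sum>\<^sub>\<infinity>y\<in>F. \<Phi> x y)" if "n \<ge> m" for n
    proof -
      have "(\<Sum>y\<in>A n. resolvent (mat_exp (A n) Q) \<beta> x y) = (\<Sum>y\<in>A n. R n x y)"
        using m[OF that] by (simp add: R_def)
      also have "\<dots> \<le> (\<Sum>y\<in>A n. \<Phi> x y)" by (intro sum_mono R_le_\<Phi>)
      also have "\<dots> \<le> (\<Sum>\<^sub>\<infinity>y\<in>F. \<Phi> x y)"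
        using A_subset_F by (intro finite_sum_le_infsum s finite_A) (auto simp: \<Phi>_nonneg)
      finally show ?thesis .
    qed
    then show "\<exists>N. \<forall>n\<ge>N. (\<Sum>y\<in>A n. resolvent (mat_exp (A n) Q) \<beta> x y) \<le> (\<Sum>\<^sub>\<infinity>y\<in>F. \<Phi> x y)" by blast
  qed
  with le s show ?thesis by (simp add: has_sum_iff)
qed

text \<open>
  The drift condition says \<open>(\<beta> I - Q) v \<ge> (\<beta> + c) v - b 1\<^sub>K\<close>, also for the truncations of \<open>Q\<close>.
  Applying the nonnegative resolvents turns it into a drift condition for the Markov kernel \<open>\<Phi>\<close>, for
  which all sums converge absolutely, however large the jump rates are.
\<close>
lemma \<Phi>_drift:
  assumes v: "\<And>x. x \<in> F \<Longrightarrow> v x \<ge> 0" and K: "finite K" "K \<subseteq> F" and b: "b \<ge> 0" and c: "c \<ge> 0"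
    and summable: "\<And>x. x \<in> F \<Longrightarrow> (\<lambda>y. Q x y * v y) summable_on F"
    and drift: "\<And>x. x \<in> F \<Longrightarrow> (\<Sum>\<^sub>\<infinity>y\<in>F. Q x y * v y) \<le> - c * v x + b * indicator K x"
    and x: "x \<in> F"
  shows "(\<lambda>y. \<Phi> x y * v y) summable_on F"
    and "(\<beta> + c) * (\<Sum>\<^sub>\<infinity>y\<in>F. \<Phi> x y * v y) \<le> \<beta> * v x + b * (\<Sum>y\<in>K. \<Phi> x y)"
proof -
  let ?B = "\<beta> * v x + b * (\<Sum>y\<in>K. \<Phi> x y)"
  have "(\<Sum>w\<in>A n. R n x w * ((\<beta> + c) * v w)) \<le> ?B" if xn: "x \<in> A n" for n
  proof -
    have trunc: "(\<Sum>y\<in>A n. Q w y * v y) \<le> - c * v w + b * indicator K w" if w: "w \<in> A n" for w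
    proof -
      have wF: "w \<in> F" using w A_subset_F by auto
      have "(\<Sum>y\<in>A n. Q w y * v y) \<le> (\<Sum>\<^sub>\<infinity>y\<in>F. Q w y * v y)"
        using A_subset_F w wF by (intro finite_sum_le_infsum summable finite_A)
          (auto intro!: mult_nonneg_nonneg v off_diagonal_nonneg)
      with drift[OF wF] show ?thesis by simp
    qed
    have "(\<Sum>w\<in>A n. R n x w * ((\<beta> + c) * v w - b * indicator K w)) \<le>
        (\<Sum>w\<in>A n. R n x w * (\<beta> * v w - (\<Sum>y\<in>A n. Q w y * v y)))"
      using trunc by (intro sum_mono mult_left_mono R_nonneg) (auto simp: algebra_simps)
    also have "\<dots> = \<beta> * v x"
      using resolvent_solves_column[OF finite_A xn sub_generator_A \<beta>_pos, of v] xn by (simp add: R_def)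
    finally have "(\<Sum>w\<in>A n. R n x w * ((\<beta> + c) * v w)) \<le> \<beta> * v x + (\<Sum>w\<in>A n. R n x w * (b * indicator K w))"
      by (simp add: right_diff_distrib sum_subtractf)
    also have "(\<Sum>w\<in>A n. R n x w * (b * indicator K w)) = (\<Sum>w\<in>A n. if w \<in> K then b * R n x w else 0)"
      by (intro sum.cong) auto
    also have "\<dots> = b * (\<Sum>w\<in>A n \<inter> K. R n x w)"
      by (simp only: sum.inter_restrict[OF finite_A, symmetric] sum_distrib_left)
    also have "\<dots> \<le> b * (\<Sum>w\<in>K. \<Phi> x w)"
      using b K by (intro mult_left_mono order_trans[OF sum_mono[OF R_le_\<Phi>] sum_mono2]) (auto simp: \<Phi>_nonneg)
    finally show ?thesis by simp
  qed
  from \<Phi>_sum_le[OF x _ this] have *: "(\<lambda>y. \<Phi> x y * ((\<beta> + c) * v y)) summable_on F"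
      "(\<Sum>\<^sub>\<infinity>y\<in>F. \<Phi> x y * ((\<beta> + c) * v y)) \<le> ?B"
    using v c \<beta>_pos by auto
  have eq: "(\<lambda>y. \<Phi> x y * ((\<beta> + c) * v y)) = (\<lambda>y. (\<beta> + c) * (\<Phi> x y * v y))" by (auto simp: mult_ac)
  have "\<beta> + c \<noteq> 0" using \<beta>_pos c by simp
  then show s: "(\<lambda>y. \<Phi> x y * v y) summable_on F"
    using *(1) unfolding eq by (simp add: summable_on_cmult_right')
  show "(\<beta> + c) * (\<Sum>\<^sub>\<infinity>y\<in>F. \<Phi> x y * v y) \<le> ?B"
    using *(2) unfolding eq by (simp add: infsum_cmult_right')
qed

text \<open>
  Formally, \<open>\<pi> Q = - \<nu>\<close> means \<open>\<pi> (\<beta> I - Q) = \<beta> \<pi> + \<nu>\<close>, and one multiplies by \<open>\<Phi> / \<beta>\<close>. The interchange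
  of sums that this requires may fail when the jump rates are unbounded. On the truncations it is
  legitimate, but there the inflow from outside adds a nonnegative term, which leaves
  \<open>\<pi> \<ge> (\<pi> + \<nu> / \<beta>) \<Phi>\<close>. Both sides have total mass \<open>1\<close> because \<open>\<Phi>\<close> is stochastic and \<open>\<nu>\<close> has
  total mass \<open>0\<close>, and so they agree.
\<close>
lemma perturbed_stationary_resolvent:
  assumes \<pi>: "\<And>x. x \<in> F \<Longrightarrow> \<pi> x \<ge> 0" "(\<pi> has_sum 1) F"
    and \<nu>: "(\<lambda>x. \<bar>\<nu> x\<bar>) summable_on F" "(\<nu> has_sum 0) F"
    and eq: "\<And>y. y \<in> F \<Longrightarrow> ((\<lambda>x. \<pi> x * Q x y) has_sum (- \<nu> y)) F"
    and y: "y \<in> F"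
  shows "((\<lambda>x. (\<pi> x + \<nu> x / \<beta>) * \<Phi> x y) has_sum \<pi> y) F"
proof -
  define \<sigma> where "\<sigma> x = \<pi> x + \<nu> x / \<beta>" for x
  have \<pi>s: "\<pi> summable_on F" using \<pi>(2) by (rule has_sum_imp_summable)
  note \<nu>s = \<nu>(1)
  define w where "w x = \<pi> x + \<bar>\<nu> x\<bar> / \<beta>" for x
  have ws: "w summable_on F"
    unfolding w_def divide_inverse using \<pi>s \<nu>s by (intro summable_on_add summable_on_cmult_left)
  have \<sigma>w: "\<bar>\<sigma> x\<bar> \<le> w x" if "x \<in> F" for x
    using \<pi>(1)[OF that] \<beta>_pos abs_triangle_ineq[of "\<pi> x" "\<nu> x / \<beta>"] by (simp add: \<sigma>_def w_def abs_divide)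
  have \<sigma>s: "(\<lambda>x. \<bar>\<sigma> x\<bar> * 1) summable_on F"
    using summable_on_comparison_test[OF ws, of "\<lambda>x. \<bar>\<sigma> x\<bar>"] \<sigma>w by simp
  have \<sigma>1: "(\<sigma> has_sum 1) F"
    unfolding \<sigma>_def divide_inverse using has_sum_add[OF \<pi>(2) has_sum_cmult_left[OF \<nu>(2), of "inverse \<beta>"]] by simp
  define \<psi> where "\<psi> y = (\<Sum>\<^sub>\<infinity>x\<in>F. \<sigma> x * \<Phi> x y)" for y
  have col: "(\<lambda>x. \<sigma> x * \<Phi> x y) summable_on F" if "y \<in> F" for y
    by (rule infsum_kernel_swap(1)[where k = "\<lambda>_. 1", OF _ \<Phi>_stochastic \<sigma>s that]) (simp_all add: \<Phi>_nonneg)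
  have \<psi>1: "(\<psi> has_sum 1) F"
    using infsum_kernel_swap(2)[where K = \<Phi> and k = "\<lambda>_. 1", OF \<Phi>_nonneg \<Phi>_stochastic \<sigma>s] infsumI[OF \<sigma>1]
    unfolding \<psi>_def by simp
  have le: "\<psi> y \<le> \<pi> y" if y: "y \<in> F" for y
  proof -
    have "(\<lambda>n. \<Sum>\<^sub>\<infinity>x\<in>F. \<sigma> x * R n x y) \<longlonglongrightarrow> \<psi> y"
      unfolding \<psi>_def
    proof (rule infsum_dominated_convergence[OF _ _ ws])
      show "(\<lambda>n. \<sigma> x * R n x y) \<longlonglongrightarrow> \<sigma> x * \<Phi> x y" for x
        by (intro tendsto_mult tendsto_const R_tendsto_\<Phi>)
      show "\<bar>\<sigma> x * R n x y\<bar> \<le> w x" if "x \<in> F" for n x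
        using \<sigma>w[OF that] mult_mono[OF \<sigma>w[OF that] R_le_1[of n x y]] R_nonneg[of n x y] by (simp add: abs_mult)
    qed
    moreover have "(\<Sum>\<^sub>\<infinity>x\<in>F. \<sigma> x * R n x y) \<le> \<pi> y" if yn: "y \<in> A n" for n
    proof -
      have "(\<Sum>\<^sub>\<infinity>x\<in>F. \<sigma> x * R n x y) = (\<Sum>\<^sub>\<infinity>x\<in>A n. \<sigma> x * R n x y)"
        by (rule infsum_cong_neutral) (use A_subset_F[of n] in \<open>auto simp: R_def\<close>)
      also have "\<dots> = (\<Sum>x\<in>A n. \<sigma> x * R n x y)"
        by (rule infsum_finite[OF finite_A])
      finally have "(\<Sum>\<^sub>\<infinity>x\<in>F. \<sigma> x * R n x y) * \<beta> = (\<Sum>x\<in>A n. \<sigma> x * R n x y) * \<beta>" by simp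
      also have "\<dots> \<le> (\<Sum>x\<in>A n. (\<beta> * \<pi> x - (\<Sum>z\<in>A n. \<pi> z * Q z x)) * R n x y)"
        unfolding sum_distrib_right
      proof (rule sum_mono)
        fix x assume x: "x \<in> A n"
        have xF: "x \<in> F" using x A_subset_F by auto
        have "(\<Sum>z\<in>A n. \<pi> z * Q z x) \<le> - \<nu> x"
        proof (rule has_sum_mono2[OF _ eq[OF xF]])
          show "((\<lambda>z. \<pi> z * Q z x) has_sum (\<Sum>z\<in>A n. \<pi> z * Q z x)) (A n)"
            using finite_A by simp
          show "0 \<le> \<pi> z * Q z x" if "z \<in> F - A n" for z
            using that x xF by (intro mult_nonneg_nonneg \<pi> off_diagonal_nonneg) auto
        qed (rule A_subset_F)
        moreover have "\<sigma> x * \<beta> = \<beta> * \<pi> x + \<nu> x"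
          using \<beta>_pos by (simp add: \<sigma>_def algebra_simps)
        ultimately have "\<sigma> x * \<beta> \<le> \<beta> * \<pi> x - (\<Sum>z\<in>A n. \<pi> z * Q z x)" by simp
        from mult_right_mono[OF this R_nonneg[of n x y]]
        show "\<sigma> x * R n x y * \<beta> \<le> (\<beta> * \<pi> x - (\<Sum>z\<in>A n. \<pi> z * Q z x)) * R n x y"
          by (simp add: mult_ac)
      qed
      also have "\<dots> = \<beta> * \<pi> y"
        using resolvent_solves_row[OF finite_A yn sub_generator_A \<beta>_pos, of \<pi>] yn by (simp add: R_def)
      finally show ?thesis using \<beta>_pos by (simp add: mult.commute)
    qed
    moreover have "\<forall>\<^sub>F n in sequentially. y \<in> A n"
      using eventually_subset_A[of "{y}"] y by simp
    ultimately show ?thesis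
      by (intro tendsto_upperbound[of "\<lambda>n. \<Sum>\<^sub>\<infinity>x\<in>F. \<sigma> x * R n x y"]) (auto elim: eventually_mono)
  qed
  have "((\<lambda>y. \<pi> y - \<psi> y) has_sum (1 - 1)) F"
    using has_sum_add[OF \<pi>(2) has_sum_uminusI[OF \<psi>1]] by simp
  then have "\<pi> y - \<psi> y = 0"
    using nonneg_has_sum_le_0D[of "\<lambda>y. \<pi> y - \<psi> y" F 0 y] le y by simp
  then have "\<psi> y = \<pi> y" by simp
  then show ?thesis
    using col[OF y] by (simp add: has_sum_iff \<psi>_def \<sigma>_def)
qed

end

section \<open>Signed measures and Markov kernels with a drift\<close>

lemma infsum_signed_kernel_contraction:
  fixes f l :: "'a \<Rightarrow> real" and K :: "'a \<Rightarrow> 'b \<Rightarrow> real"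
  assumes l: "\<And>x. x \<in> F \<Longrightarrow> ((\<lambda>y. \<bar>K x y\<bar>) has_sum l x) G"
    and f: "(\<lambda>x. \<bar>f x\<bar> * l x) summable_on F"
  shows "(\<lambda>y. \<bar>\<Sum>\<^sub>\<infinity>x\<in>F. f x * K x y\<bar>) summable_on G"
    and "(\<Sum>\<^sub>\<infinity>y\<in>G. \<bar>\<Sum>\<^sub>\<infinity>x\<in>F. f x * K x y\<bar>) \<le> (\<Sum>\<^sub>\<infinity>x\<in>F. \<bar>f x\<bar> * l x)"
proof -
  have f': "(\<lambda>x. \<bar>\<bar>f x\<bar>\<bar> * l x) summable_on F" using f by simp
  have swap1: "(\<lambda>x. \<bar>f x\<bar> * \<bar>K x y\<bar>) summable_on F" if "y \<in> G" for y
    by (rule infsum_kernel_swap(1)[OF abs_ge_zero l f' that])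
  have swap2: "((\<lambda>y. \<Sum>\<^sub>\<infinity>x\<in>F. \<bar>f x\<bar> * \<bar>K x y\<bar>) has_sum (\<Sum>\<^sub>\<infinity>x\<in>F. \<bar>f x\<bar> * l x)) G"
    by (rule infsum_kernel_swap(2)[OF abs_ge_zero l f'])
  have le: "\<bar>\<Sum>\<^sub>\<infinity>x\<in>F. f x * K x y\<bar> \<le> (\<Sum>\<^sub>\<infinity>x\<in>F. \<bar>f x\<bar> * \<bar>K x y\<bar>)" if y: "y \<in> G" for y
    using norm_infsum_bound[of "\<lambda>x. f x * K x y" F] swap1[OF y] by (simp add: abs_mult)
  show s: "(\<lambda>y. \<bar>\<Sum>\<^sub>\<infinity>x\<in>F. f x * K x y\<bar>) summable_on G"
    by (rule summable_on_comparison_test[OF has_sum_imp_summable[OF swap2] le]) simp_all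
  show "(\<Sum>\<^sub>\<infinity>y\<in>G. \<bar>\<Sum>\<^sub>\<infinity>x\<in>F. f x * K x y\<bar>) \<le> (\<Sum>\<^sub>\<infinity>x\<in>F. \<bar>f x\<bar> * l x)"
    by (rule has_sum_mono[OF has_sum_infsum[OF s] swap2 le])
qed

lemma infsum_kernel_contraction:
  fixes f k :: "'a \<Rightarrow> real" and K :: "'a \<Rightarrow> 'b \<Rightarrow> real"
  assumes K: "\<And>x y. x \<in> F \<Longrightarrow> y \<in> G \<Longrightarrow> K x y \<ge> 0"
    and k: "\<And>x. x \<in> F \<Longrightarrow> (K x has_sum k x) G"
    and f: "(\<lambda>x. \<bar>f x\<bar> * k x) summable_on F"
  shows "(\<lambda>y. \<bar>\<Sum>\<^sub>\<infinity>x\<in>F. f x * K x y\<bar>) summable_on G"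
    and "(\<Sum>\<^sub>\<infinity>y\<in>G. \<bar>\<Sum>\<^sub>\<infinity>x\<in>F. f x * K x y\<bar>) \<le> (\<Sum>\<^sub>\<infinity>x\<in>F. \<bar>f x\<bar> * k x)"
proof -
  have l: "((\<lambda>y. \<bar>K x y\<bar>) has_sum k x) G" if "x \<in> F" for x
    using k[OF that] by (rule has_sum_cong[THEN iffD1, rotated]) (simp add: K that)
  show "(\<lambda>y. \<bar>\<Sum>\<^sub>\<infinity>x\<in>F. f x * K x y\<bar>) summable_on G"
    and "(\<Sum>\<^sub>\<infinity>y\<in>G. \<bar>\<Sum>\<^sub>\<infinity>x\<in>F. f x * K x y\<bar>) \<le> (\<Sum>\<^sub>\<infinity>x\<in>F. \<bar>f x\<bar> * k x)"
    by (rule infsum_signed_kernel_contraction[OF l f], assumption)+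
qed

text \<open>
  If \<open>\<pi> v\<close> is known to be finite, then \<open>\<pi> v = \<pi> \<Phi> v \<le> q \<pi> v + d\<close> is all there is to prove. To avoid
  this assumption, replace \<open>v\<close> by \<open>w = min v m\<close>: then \<open>\<pi> (w - \<Phi> w) = 0\<close>, where \<open>w - \<Phi> w\<close> is at
  least \<open>(1 - q) v - d\<close> on a given finite set, once \<open>m\<close> is large, and at least \<open>- d\<close> elsewhere.
\<close>
lemma invariant_moment_bound:
  fixes \<Phi> :: "'a \<Rightarrow> 'a \<Rightarrow> real" and v \<pi> :: "'a \<Rightarrow> real" and q d :: real
  assumes \<Phi>: "\<And>x y. x \<in> F \<Longrightarrow> y \<in> F \<Longrightarrow> \<Phi> x y \<ge> 0" "\<And>x. x \<in> F \<Longrightarrow> (\<Phi> x has_sum 1) F"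
    and v: "\<And>x. x \<in> F \<Longrightarrow> v x \<ge> 0"
    and V: "\<And>x. x \<in> F \<Longrightarrow> (\<lambda>y. \<Phi> x y * v y) summable_on F"
      "\<And>x. x \<in> F \<Longrightarrow> (\<Sum>\<^sub>\<infinity>y\<in>F. \<Phi> x y * v y) \<le> q * v x + d"
    and qd: "0 \<le> q" "q < 1" "d \<ge> 0"
    and \<pi>: "\<And>x. x \<in> F \<Longrightarrow> \<pi> x \<ge> 0" "(\<pi> has_sum 1) F"
      "\<And>y. y \<in> F \<Longrightarrow> ((\<lambda>x. \<pi> x * \<Phi> x y) has_sum \<pi> y) F"
  shows "(\<lambda>x. \<pi> x * v x) summable_on F" "(\<Sum>\<^sub>\<infinity>x\<in>F. \<pi> x * v x) \<le> d / (1 - q)"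
proof -
  have fin: "(\<Sum>x\<in>G. \<pi> x * v x) \<le> d / (1 - q)" if G: "finite G" "G \<subseteq> F" for G
  proof -
    define m where "m = (\<Sum>x\<in>G. v x + q * v x + d)"
    have mG: "v x \<le> m" "q * v x + d \<le> m" if "x \<in> G" for x
    proof -
      have "v x + q * v x + d \<le> m"
        unfolding m_def using that G v qd by (intro member_le_sum) auto
      moreover have "0 \<le> v x" "0 \<le> q * v x" using v qd that G by auto
      ultimately show "v x \<le> m" "q * v x + d \<le> m" using qd by linarith+
    qed
    have m0: "m \<ge> 0"
      unfolding m_def using v qd G by (intro sum_nonneg add_nonneg_nonneg mult_nonneg_nonneg) auto
    define w where "w x = min (v x) m" for x
    have w: "0 \<le> w x" "w x \<le> v x" "w x \<le> m" if "x \<in> F" for x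
      using v[OF that] m0 by (auto simp: w_def)
    define P where "P x = (\<Sum>\<^sub>\<infinity>y\<in>F. \<Phi> x y * w y)" for x
    have sP: "((\<lambda>y. \<Phi> x y * w y) has_sum P x) F" if x: "x \<in> F" for x
      unfolding P_def
      by (rule has_sum_infsum, rule summable_on_comparison_test[OF V(1)[OF x]])
        (use w \<Phi>(1) x in \<open>auto intro!: mult_left_mono mult_nonneg_nonneg\<close>)
    have P0: "0 \<le> P x" if x: "x \<in> F" for x
      by (rule has_sum_nonneg[OF sP[OF x]]) (use w \<Phi>(1) x in auto)
    have P1: "P x \<le> q * v x + d" if x: "x \<in> F" for x
    proof -
      have "P x \<le> (\<Sum>\<^sub>\<infinity>y\<in>F. \<Phi> x y * v y)"
        by (rule has_sum_mono[OF sP[OF x] has_sum_infsum[OF V(1)[OF x]]])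
          (use w \<Phi>(1) x in \<open>auto intro!: mult_left_mono\<close>)
      with V(2)[OF x] show ?thesis by simp
    qed
    have P2: "P x \<le> m" if x: "x \<in> F" for x
    proof -
      have "P x \<le> 1 * m"
        by (rule has_sum_mono[OF sP[OF x] has_sum_cmult_left[OF \<Phi>(2)[OF x]]])
          (use w \<Phi>(1) x in \<open>auto intro!: mult_left_mono\<close>)
      then show ?thesis by simp
    qed
    have \<pi>m: "(\<lambda>x. \<pi> x * m) summable_on F"
      using \<pi>(2) by (intro summable_on_cmult_left) (rule has_sum_imp_summable)
    have s\<pi>P: "(\<lambda>x. \<pi> x * P x) summable_on F"
      by (rule summable_on_comparison_test[OF \<pi>m]) (use P0 P2 \<pi>(1) in \<open>auto intro!: mult_left_mono\<close>)
    have s\<pi>P': "(\<lambda>x. \<bar>\<pi> x\<bar> * P x) summable_on F"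
      using s\<pi>P by (rule summable_on_cong[THEN iffD1, rotated]) (simp add: \<pi>(1))
    have "((\<lambda>y. \<Sum>\<^sub>\<infinity>x\<in>F. \<pi> x * (\<Phi> x y * w y)) has_sum (\<Sum>\<^sub>\<infinity>x\<in>F. \<pi> x * P x)) F"
      by (rule infsum_kernel_swap(2)[OF _ sP s\<pi>P']) (use w \<Phi>(1) in auto)
    then have 1: "((\<lambda>y. \<pi> y * w y) has_sum (\<Sum>\<^sub>\<infinity>x\<in>F. \<pi> x * P x)) F"
    proof (rule has_sum_cong[THEN iffD1, rotated])
      fix y assume y: "y \<in> F"
      have "((\<lambda>x. \<pi> x * (\<Phi> x y * w y)) has_sum (\<pi> y * w y)) F"
        using has_sum_cmult_left[OF \<pi>(3)[OF y], of "w y"] by (simp add: mult.assoc)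
      then show "(\<Sum>\<^sub>\<infinity>x\<in>F. \<pi> x * (\<Phi> x y * w y)) = \<pi> y * w y" by (rule infsumI)
    qed
    have "((\<lambda>x. \<pi> x * w x + - (\<pi> x * P x)) has_sum ((\<Sum>\<^sub>\<infinity>x\<in>F. \<pi> x * P x) + - (\<Sum>\<^sub>\<infinity>x\<in>F. \<pi> x * P x))) F"
      by (intro has_sum_add 1 has_sum_uminusI has_sum_infsum s\<pi>P)
    then have zero: "((\<lambda>x. \<pi> x * (w x - P x)) has_sum 0) F" by (simp add: algebra_simps)
    have ind: "((\<lambda>x. if x \<in> G then (1 - q) * (\<pi> x * v x) else 0) has_sum (\<Sum>x\<in>G. (1 - q) * (\<pi> x * v x))) F"
      by (rule has_sum_finite_neutralI[OF G]) auto
    have "((\<lambda>x. (if x \<in> G then (1 - q) * (\<pi> x * v x) else 0) + - (\<pi> x * d)) has_sum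
        ((\<Sum>x\<in>G. (1 - q) * (\<pi> x * v x)) + - (1 * d))) F"
      by (intro has_sum_add ind has_sum_uminusI has_sum_cmult_left \<pi>(2))
    then have "(\<Sum>x\<in>G. (1 - q) * (\<pi> x * v x)) + - (1 * d) \<le> 0"
    proof (rule has_sum_mono[OF _ zero])
      fix x assume x: "x \<in> F"
      have "(if x \<in> G then (1 - q) * v x else 0) - d \<le> w x - P x"
      proof (cases "x \<in> G")
        case True
        then show ?thesis using mG[OF True] P1[OF x] by (simp add: w_def algebra_simps)
      next
        case False
        show ?thesis
        proof (cases "v x \<le> m")
          case True
          have "q * v x \<le> 1 * v x" using qd v[OF x] by (intro mult_right_mono) auto
          then show ?thesis using True False P1[OF x] by (simp add: w_def)
        next
          case False
          then show ?thesis using \<open>x \<notin> G\<close> P2[OF x] qd by (simp add: w_def)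
        qed
      qed
      from mult_left_mono[OF this \<pi>(1)[OF x]]
      show "(if x \<in> G then (1 - q) * (\<pi> x * v x) else 0) + - (\<pi> x * d) \<le> \<pi> x * (w x - P x)"
        by (simp add: algebra_simps split: if_splits)
    qed
    then have "(1 - q) * (\<Sum>x\<in>G. \<pi> x * v x) \<le> d" by (simp add: sum_distrib_left)
    then show ?thesis using qd by (simp add: field_simps)
  qed
  show s: "(\<lambda>x. \<pi> x * v x) summable_on F"
    using fin v \<pi>(1) by (intro nonneg_bdd_above_summable_on bdd_aboveI[of _ "d / (1 - q)"]) auto
  show "(\<Sum>\<^sub>\<infinity>x\<in>F. \<pi> x * v x) \<le> d / (1 - q)"
    using s fin by (intro infsum_le_finite_sums) auto
qed

text \<open>
  The core estimate. By \<open>minor\<close>, each visit to \<open>K\<close> leads to \<open>\<alpha>\<close> with probability at least \<open>\<phi>\<close>, so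
  that the excess term \<open>b \<Phi> 1\<^sub>K\<close> in the drift condition can be compensated by the bounded function
  \<open>u = \<Phi> 1\<^sub>\<alpha>\<close>: the function \<open>W = v + 2 B - B u\<close> satisfies \<open>T W + (c / \<beta>) \<Phi> v \<le> W\<close> without any
  excess, where \<open>T\<close> is \<open>\<Phi>\<close> with the column of \<open>\<alpha>\<close> set to \<open>0\<close>. The hypothesis \<open>zero\<close> allows one to
  replace \<open>\<mu> \<Phi>\<close> by \<open>\<mu> T\<close>, so that \<open>\<mu> = \<mu> T + \<nu> \<Phi> / \<beta>\<close>. Taking absolute values and summing against
  \<open>W\<close> gives \<open>c \<bar>\<mu>\<bar> \<Phi> v \<le> \<bar>\<nu>\<bar> \<Phi> W\<close>, and one more step of the kernel replaces \<open>\<Phi> v\<close> by \<open>v\<close>.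
\<close>
lemma signed_measure_bound:
  fixes \<Phi> :: "'a \<Rightarrow> 'a \<Rightarrow> real" and v \<mu> \<nu> :: "'a \<Rightarrow> real" and b c \<beta> \<phi> :: real
  assumes \<Phi>: "\<And>x y. x \<in> F \<Longrightarrow> y \<in> F \<Longrightarrow> \<Phi> x y \<ge> 0" "\<And>x. x \<in> F \<Longrightarrow> (\<Phi> x has_sum 1) F"
    and v: "\<And>x. x \<in> F \<Longrightarrow> v x \<ge> 0"
    and K: "finite K" "K \<subseteq> F" and pos: "\<beta> > 0" "c > 0" "b \<ge> 0" "\<phi> > 0"
    and V: "\<And>x. x \<in> F \<Longrightarrow> (\<lambda>y. \<Phi> x y * v y) summable_on F"
      "\<And>x. x \<in> F \<Longrightarrow> (\<beta> + c) * (\<Sum>\<^sub>\<infinity>y\<in>F. \<Phi> x y * v y) \<le> \<beta> * v x + b * (\<Sum>y\<in>K. \<Phi> x y)"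
    and minor: "\<alpha> \<in> F" "\<And>x. x \<in> K \<Longrightarrow> \<phi> \<le> \<Phi> x \<alpha>"
    and \<mu>: "(\<lambda>x. \<bar>\<mu> x\<bar>) summable_on F" "(\<lambda>x. \<bar>\<mu> x\<bar> * v x) summable_on F"
    and \<nu>: "(\<lambda>x. \<bar>\<nu> x\<bar>) summable_on F" "(\<lambda>x. \<bar>\<nu> x\<bar> * v x) summable_on F"
    and eq: "\<And>y. y \<in> F \<Longrightarrow> ((\<lambda>x. (\<mu> x + \<nu> x / \<beta>) * \<Phi> x y) has_sum \<mu> y) F"
    and zero: "((\<lambda>x. \<mu> x * \<Phi> x \<alpha>) has_sum 0) F"
  defines "B \<equiv> b / (\<beta> * \<phi>)"
  shows "c * (\<Sum>\<^sub>\<infinity>x\<in>F. \<bar>\<mu> x\<bar> * v x) \<le> (\<Sum>\<^sub>\<infinity>x\<in>F. \<bar>\<nu> x\<bar> * v x) + 2 * B * (\<Sum>\<^sub>\<infinity>x\<in>F. \<bar>\<nu> x\<bar>)"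
proof -
  have B0: "B \<ge> 0" using pos by (simp add: B_def)
  define u where "u x = \<Phi> x \<alpha>" for x
  have u: "0 \<le> u x" "u x \<le> 1" if x: "x \<in> F" for x
  proof -
    show "0 \<le> u x" using \<Phi>(1)[OF x minor(1)] by (simp add: u_def)
    have "sum (\<Phi> x) {\<alpha>} \<le> 1"
      by (rule finite_sum_le_has_sum[OF \<Phi>(2)[OF x]]) (use \<Phi>(1) x minor(1) in auto)
    then show "u x \<le> 1" by (simp add: u_def)
  qed
  define V' where "V' x = (\<Sum>\<^sub>\<infinity>y\<in>F. \<Phi> x y * v y)" for x
  define U where "U x = (\<Sum>\<^sub>\<infinity>y\<in>F. \<Phi> x y * u y)" for x
  have sV: "((\<lambda>y. \<Phi> x y * v y) has_sum V' x) F" if "x \<in> F" for x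
    unfolding V'_def by (rule has_sum_infsum[OF V(1)[OF that]])
  have V0: "V' x \<ge> 0" if x: "x \<in> F" for x
    by (rule has_sum_nonneg[OF sV[OF x]]) (use \<Phi>(1) x v in auto)
  have sU: "((\<lambda>y. \<Phi> x y * u y) has_sum U x) F" if x: "x \<in> F" for x
    unfolding U_def
    by (rule has_sum_infsum, rule summable_on_comparison_test[OF has_sum_imp_summable[OF \<Phi>(2)[OF x]]])
      (use \<Phi>(1) x u in \<open>auto simp: mult_left_le\<close>)
  have small: "\<phi> * (\<Sum>y\<in>K. \<Phi> x y) \<le> U x" if x: "x \<in> F" for x
  proof -
    have "\<phi> * (\<Sum>y\<in>K. \<Phi> x y) \<le> (\<Sum>y\<in>K. \<Phi> x y * u y)"
      unfolding sum_distrib_left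
    proof (rule sum_mono)
      fix y assume y: "y \<in> K"
      have "\<Phi> x y * \<phi> \<le> \<Phi> x y * u y"
        using minor(2)[OF y] \<Phi>(1)[OF x, of y] K y by (intro mult_left_mono) (auto simp: u_def)
      then show "\<phi> * \<Phi> x y \<le> \<Phi> x y * u y" by (simp add: mult.commute)
    qed
    also have "\<dots> \<le> U x"
      by (rule finite_sum_le_has_sum[OF sU[OF x] K]) (use \<Phi>(1) x u in auto)
    finally show ?thesis .
  qed
  define q where "q = c / \<beta>"
  have q0: "q > 0" using pos by (simp add: q_def)
  have drift: "V' x + q * V' x \<le> v x + B * U x" if x: "x \<in> F" for x
  proof -
    have "(\<beta> + c) * V' x \<le> \<beta> * v x + b * (\<Sum>y\<in>K. \<Phi> x y)"
      using V(2)[OF x] by (simp add: V'_def)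
    also have "b * (\<Sum>y\<in>K. \<Phi> x y) \<le> b * (U x / \<phi>)"
      using small[OF x] pos by (intro mult_left_mono) (auto simp: field_simps)
    also have "\<beta> * v x + b * (U x / \<phi>) = \<beta> * (v x + B * U x)"
      using pos by (simp add: B_def field_simps)
    finally have "(\<beta> + c) * V' x \<le> \<beta> * (v x + B * U x)" by simp
    moreover have "(\<beta> + c) * V' x = \<beta> * (V' x + q * V' x)"
      using pos by (simp add: q_def field_simps)
    ultimately have "\<beta> * (V' x + q * V' x) \<le> \<beta> * (v x + B * U x)" by simp
    then show ?thesis using pos by simp
  qed
  \<comment> \<open>The constant \<open>2 B\<close> ensures \<open>W \<ge> B\<close> at \<open>\<alpha>\<close>, so that dropping the column of \<open>\<alpha>\<close> pays for \<open>B u\<close>.\<close>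
  define W where "W x = v x + 2 * B - B * u x" for x
  have W: "0 \<le> W x" "B \<le> W x" "W x \<le> v x + 2 * B" if x: "x \<in> F" for x
  proof -
    have "B * u x \<le> B * 1" "0 \<le> B * u x"
      using mult_left_mono[OF u(2)[OF x] B0] mult_nonneg_nonneg[OF B0 u(1)[OF x]] by auto
    then show "0 \<le> W x" "B \<le> W x" "W x \<le> v x + 2 * B" using v[OF x] B0 by (auto simp: W_def)
  qed
  define P where "P x = V' x + 2 * B - B * U x" for x
  have sP: "((\<lambda>y. \<Phi> x y * W y) has_sum P x) F" if x: "x \<in> F" for x
  proof -
    have "((\<lambda>y. \<Phi> x y * v y + \<Phi> x y * (2 * B) + - (\<Phi> x y * u y * B)) has_sum (V' x + 1 * (2 * B) + - (U x * B))) F"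
      by (intro has_sum_add has_sum_uminusI has_sum_cmult_left sV sU \<Phi> x)
    then show ?thesis by (simp add: W_def P_def algebra_simps)
  qed
  have P0: "P x \<ge> 0" if x: "x \<in> F" for x
    by (rule has_sum_nonneg[OF sP[OF x]]) (use \<Phi>(1) x W in auto)
  have P_le: "P x + q * V' x \<le> v x + 2 * B" if x: "x \<in> F" for x
    using drift[OF x] by (simp add: P_def algebra_simps)
  define T where "T x y = (if y = \<alpha> then 0 else \<Phi> x y)" for x y
  have T0: "T x y \<ge> 0" if "x \<in> F" "y \<in> F" for x y using \<Phi>(1) that by (simp add: T_def)
  define k where "k x = P x - u x * W \<alpha>" for x
  have sk: "((\<lambda>y. T x y * W y) has_sum k x) F" if x: "x \<in> F" for x
  proof -
    have "((\<lambda>y. if y = \<alpha> then u x * W \<alpha> else 0) has_sum (u x * W \<alpha>)) F"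
      by (rule has_sum_finite_neutralI[of "{\<alpha>}"]) (use minor in auto)
    from has_sum_add[OF sP[OF x] has_sum_uminusI[OF this]]
    have "((\<lambda>y. \<Phi> x y * W y + - (if y = \<alpha> then u x * W \<alpha> else 0)) has_sum k x) F"
      by (simp add: k_def)
    also have "(\<lambda>y. \<Phi> x y * W y + - (if y = \<alpha> then u x * W \<alpha> else 0)) = (\<lambda>y. T x y * W y)"
      by (auto simp: T_def u_def)
    finally show ?thesis .
  qed
  have k0: "k x \<ge> 0" if x: "x \<in> F" for x
    by (rule has_sum_nonneg[OF sk[OF x]]) (use T0 x W in auto)
  have k_le: "k x + q * V' x \<le> W x" if x: "x \<in> F" for x
  proof -
    have "u x * B \<le> u x * W \<alpha>" using W(2)[OF minor(1)] u[OF x] by (intro mult_left_mono) auto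
    then show ?thesis using P_le[OF x] by (simp add: k_def W_def algebra_simps)
  qed
  have sum_bound: "(\<lambda>x. \<bar>f x\<bar> * g x) summable_on F"
    if f: "(\<lambda>x. \<bar>f x\<bar>) summable_on F" "(\<lambda>x. \<bar>f x\<bar> * v x) summable_on F"
      and g: "\<And>x. x \<in> F \<Longrightarrow> 0 \<le> g x" "\<And>x. x \<in> F \<Longrightarrow> g x \<le> r * (v x + 2 * B)" for f g :: "'a \<Rightarrow> real" and r
  proof (rule summable_on_comparison_test)
    show "(\<lambda>x. (\<bar>f x\<bar> * v x + \<bar>f x\<bar> * (2 * B)) * r) summable_on F"
      by (intro summable_on_cmult_left summable_on_add f)
    show "\<bar>f x\<bar> * g x \<le> (\<bar>f x\<bar> * v x + \<bar>f x\<bar> * (2 * B)) * r" if "x \<in> F" for x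
      using mult_left_mono[OF g(2)[OF that], of "\<bar>f x\<bar>"] by (simp add: algebra_simps)
  qed (use g in auto)
  have qV: "q * V' x \<le> 1 * (v x + 2 * B)" if x: "x \<in> F" for x
    using P_le[OF x] P0[OF x] by simp
  then have V_le: "V' x \<le> inverse q * (v x + 2 * B)" if x: "x \<in> F" for x
    using q0 that by (simp add: field_simps)
  have k_le': "k x \<le> 1 * (v x + 2 * B)" and P_le': "P x \<le> 1 * (v x + 2 * B)"
    and W_le': "W x \<le> 1 * (v x + 2 * B)" if x: "x \<in> F" for x
  proof -
    have qV0: "0 \<le> q * V' x" using V0[OF x] q0 by simp
    have "k x \<le> W x" "P x \<le> v x + 2 * B"
      using k_le[OF x] P_le[OF x] add_increasing2[OF qV0 order_refl] order_trans by blast+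
    then show "k x \<le> 1 * (v x + 2 * B)" "P x \<le> 1 * (v x + 2 * B)" "W x \<le> 1 * (v x + 2 * B)"
      using W(3)[OF x] by simp_all
  qed
  have \<mu>V: "(\<lambda>x. \<bar>\<mu> x\<bar> * V' x) summable_on F" by (rule sum_bound[OF \<mu> V0 V_le])
  have \<nu>V: "(\<lambda>x. \<bar>\<nu> x\<bar> * V' x) summable_on F" by (rule sum_bound[OF \<nu> V0 V_le])
  have \<mu>k: "(\<lambda>x. \<bar>\<mu> x\<bar> * k x) summable_on F" by (rule sum_bound[OF \<mu> k0 k_le'])
  have \<nu>P: "(\<lambda>x. \<bar>\<nu> x\<bar> * P x) summable_on F" by (rule sum_bound[OF \<nu> P0 P_le'])
  have \<mu>W: "(\<lambda>x. \<bar>\<mu> x\<bar> * W x) summable_on F" by (rule sum_bound[OF \<mu> W(1) W_le'])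
  have \<mu>1: "(\<lambda>x. \<bar>\<mu> x\<bar> * 1) summable_on F" and \<nu>1: "(\<lambda>x. \<bar>\<nu> x\<bar> * 1) summable_on F"
    using \<mu>(1) \<nu>(1) by simp_all
  define a where "a y = (\<Sum>\<^sub>\<infinity>x\<in>F. \<mu> x * \<Phi> x y)" for y
  define d where "d y = (\<Sum>\<^sub>\<infinity>x\<in>F. \<nu> x * \<Phi> x y)" for y
  have sa: "((\<lambda>x. \<mu> x * \<Phi> x y) has_sum a y) F" and sd: "((\<lambda>x. \<nu> x * \<Phi> x y) has_sum d y) F" if y: "y \<in> F" for y
    unfolding a_def d_def
    by (rule has_sum_infsum, rule infsum_kernel_swap(1)[where k = "\<lambda>_. 1", OF \<Phi> \<mu>1 y], assumption+)
       (rule has_sum_infsum, rule infsum_kernel_swap(1)[where k = "\<lambda>_. 1", OF \<Phi> \<nu>1 y], assumption+)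
  have \<mu>_eq: "\<mu> y = a y + d y * inverse \<beta>" if y: "y \<in> F" for y
  proof -
    have "((\<lambda>x. \<mu> x * \<Phi> x y + \<nu> x * \<Phi> x y * inverse \<beta>) has_sum (a y + d y * inverse \<beta>)) F"
      by (intro has_sum_add has_sum_cmult_left sa sd y)
    moreover have "(\<lambda>x. \<mu> x * \<Phi> x y + \<nu> x * \<Phi> x y * inverse \<beta>) = (\<lambda>x. (\<mu> x + \<nu> x / \<beta>) * \<Phi> x y)"
      by (auto simp: field_simps)
    ultimately show ?thesis using eq[OF y] has_sum_unique by fastforce
  qed
  have aT: "((\<lambda>x. \<mu> x * T x y) has_sum a y) F" if y: "y \<in> F" for y
  proof (cases "y = \<alpha>")
    case True
    have "a \<alpha> = 0" using zero by (simp add: a_def infsumI)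
    then show ?thesis using True by (simp add: T_def)
  qed (use sa[OF y] in \<open>simp add: T_def\<close>)
  have abs_split: "(\<Sum>\<^sub>\<infinity>y\<in>F. \<bar>\<mu> y\<bar> * g y) \<le> A1 + A2 * inverse \<beta>"
    if g: "\<And>y. y \<in> F \<Longrightarrow> g y \<ge> 0" and s: "(\<lambda>y. \<bar>\<mu> y\<bar> * g y) summable_on F"
      and s1: "(\<lambda>y. \<bar>a y * g y\<bar>) summable_on F" "(\<Sum>\<^sub>\<infinity>y\<in>F. \<bar>a y * g y\<bar>) \<le> A1"
      and s2: "(\<lambda>y. \<bar>d y * g y\<bar>) summable_on F" "(\<Sum>\<^sub>\<infinity>y\<in>F. \<bar>d y * g y\<bar>) \<le> A2" for g A1 A2
  proof -
    have "(\<Sum>\<^sub>\<infinity>y\<in>F. \<bar>\<mu> y\<bar> * g y) \<le> (\<Sum>\<^sub>\<infinity>y\<in>F. \<bar>a y * g y\<bar>) + (\<Sum>\<^sub>\<infinity>y\<in>F. \<bar>d y * g y\<bar>) * inverse \<beta>"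
    proof (rule has_sum_mono[OF has_sum_infsum[OF s]])
      show "((\<lambda>y. \<bar>a y * g y\<bar> + \<bar>d y * g y\<bar> * inverse \<beta>) has_sum
          ((\<Sum>\<^sub>\<infinity>y\<in>F. \<bar>a y * g y\<bar>) + (\<Sum>\<^sub>\<infinity>y\<in>F. \<bar>d y * g y\<bar>) * inverse \<beta>)) F"
        by (intro has_sum_add has_sum_cmult_left has_sum_infsum s1 s2)
      fix y assume y: "y \<in> F"
      have "\<bar>\<mu> y\<bar> * g y \<le> (\<bar>a y\<bar> + \<bar>d y\<bar> * inverse \<beta>) * g y"
        using g[OF y] pos abs_triangle_ineq[of "a y" "d y * inverse \<beta>"] unfolding \<mu>_eq[OF y]
        by (intro mult_right_mono) (auto simp: abs_mult)
      then show "\<bar>\<mu> y\<bar> * g y \<le> \<bar>a y * g y\<bar> + \<bar>d y * g y\<bar> * inverse \<beta>"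
        using g[OF y] by (simp add: abs_mult algebra_simps)
    qed
    also have "\<dots> \<le> A1 + A2 * inverse \<beta>"
      using s1 s2 pos by (intro add_mono mult_right_mono) auto
    finally show ?thesis .
  qed
  have contr: "(\<lambda>y. \<bar>h y * g y\<bar>) summable_on F \<and> (\<Sum>\<^sub>\<infinity>y\<in>F. \<bar>h y * g y\<bar>) \<le> (\<Sum>\<^sub>\<infinity>x\<in>F. \<bar>f x\<bar> * l x)"
    if H: "\<And>x y. x \<in> F \<Longrightarrow> y \<in> F \<Longrightarrow> 0 \<le> H x y" and g: "\<And>y. y \<in> F \<Longrightarrow> 0 \<le> g y"
      and l: "\<And>x. x \<in> F \<Longrightarrow> ((\<lambda>y. H x y * g y) has_sum l x) F"
      and f: "(\<lambda>x. \<bar>f x\<bar> * l x) summable_on F"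
      and h: "\<And>y. y \<in> F \<Longrightarrow> ((\<lambda>x. f x * H x y) has_sum h y) F"
    for H :: "'a \<Rightarrow> 'a \<Rightarrow> real" and f g h l :: "'a \<Rightarrow> real"
  proof -
    have e: "\<bar>\<Sum>\<^sub>\<infinity>x\<in>F. f x * (H x y * g y)\<bar> = \<bar>h y * g y\<bar>" if "y \<in> F" for y
      using has_sum_cmult_left[OF h[OF that], of "g y"] by (simp add: mult.assoc infsumI)
    have Hg: "0 \<le> H x y * g y" if "x \<in> F" "y \<in> F" for x y using H g that by simp
    have "(\<lambda>y. \<bar>\<Sum>\<^sub>\<infinity>x\<in>F. f x * (H x y * g y)\<bar>) summable_on F"
      "(\<Sum>\<^sub>\<infinity>y\<in>F. \<bar>\<Sum>\<^sub>\<infinity>x\<in>F. f x * (H x y * g y)\<bar>) \<le> (\<Sum>\<^sub>\<infinity>x\<in>F. \<bar>f x\<bar> * l x)"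
      by (rule infsum_kernel_contraction[OF Hg l f], assumption+)+
    then show ?thesis
      using summable_on_cong[of F, OF e] infsum_cong[of F, OF e] by simp
  qed
  have main: "(\<Sum>\<^sub>\<infinity>x\<in>F. \<bar>\<mu> x\<bar> * W x) \<le> (\<Sum>\<^sub>\<infinity>x\<in>F. \<bar>\<mu> x\<bar> * k x) + (\<Sum>\<^sub>\<infinity>x\<in>F. \<bar>\<nu> x\<bar> * P x) * inverse \<beta>"
  proof -
    have "(\<lambda>y. \<bar>a y * W y\<bar>) summable_on F \<and> (\<Sum>\<^sub>\<infinity>y\<in>F. \<bar>a y * W y\<bar>) \<le> (\<Sum>\<^sub>\<infinity>x\<in>F. \<bar>\<mu> x\<bar> * k x)"
      by (rule contr[OF T0 W(1) sk \<mu>k aT])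
    moreover have "(\<lambda>y. \<bar>d y * W y\<bar>) summable_on F \<and> (\<Sum>\<^sub>\<infinity>y\<in>F. \<bar>d y * W y\<bar>) \<le> (\<Sum>\<^sub>\<infinity>x\<in>F. \<bar>\<nu> x\<bar> * P x)"
      by (rule contr[OF \<Phi>(1) W(1) sP \<nu>P sd])
    ultimately show ?thesis by (intro abs_split W \<mu>W) auto
  qed
  have main': "(\<Sum>\<^sub>\<infinity>x\<in>F. \<bar>\<mu> x\<bar> * v x) \<le> (\<Sum>\<^sub>\<infinity>x\<in>F. \<bar>\<mu> x\<bar> * V' x) + (\<Sum>\<^sub>\<infinity>x\<in>F. \<bar>\<nu> x\<bar> * V' x) * inverse \<beta>"
  proof -
    have "(\<lambda>y. \<bar>a y * v y\<bar>) summable_on F \<and> (\<Sum>\<^sub>\<infinity>y\<in>F. \<bar>a y * v y\<bar>) \<le> (\<Sum>\<^sub>\<infinity>x\<in>F. \<bar>\<mu> x\<bar> * V' x)"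
      by (rule contr[OF \<Phi>(1) v sV \<mu>V sa])
    moreover have "(\<lambda>y. \<bar>d y * v y\<bar>) summable_on F \<and> (\<Sum>\<^sub>\<infinity>y\<in>F. \<bar>d y * v y\<bar>) \<le> (\<Sum>\<^sub>\<infinity>x\<in>F. \<bar>\<nu> x\<bar> * V' x)"
      by (rule contr[OF \<Phi>(1) v sV \<nu>V sd])
    ultimately show ?thesis by (intro abs_split v \<mu>) auto
  qed
  have m1: "(\<Sum>\<^sub>\<infinity>x\<in>F. \<bar>\<mu> x\<bar> * k x) + (\<Sum>\<^sub>\<infinity>x\<in>F. \<bar>\<mu> x\<bar> * V' x) * q \<le> (\<Sum>\<^sub>\<infinity>x\<in>F. \<bar>\<mu> x\<bar> * W x)"
  proof (rule has_sum_mono)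
    show "((\<lambda>x. \<bar>\<mu> x\<bar> * k x + \<bar>\<mu> x\<bar> * V' x * q) has_sum (\<Sum>\<^sub>\<infinity>x\<in>F. \<bar>\<mu> x\<bar> * k x) + (\<Sum>\<^sub>\<infinity>x\<in>F. \<bar>\<mu> x\<bar> * V' x) * q) F"
      by (intro has_sum_add has_sum_cmult_left has_sum_infsum \<mu>k \<mu>V)
    show "\<bar>\<mu> x\<bar> * k x + \<bar>\<mu> x\<bar> * V' x * q \<le> \<bar>\<mu> x\<bar> * W x" if "x \<in> F" for x
      using mult_left_mono[OF k_le[OF that], of "\<bar>\<mu> x\<bar>"] by (simp add: algebra_simps)
  qed (intro has_sum_infsum \<mu>W)
  have m2: "(\<Sum>\<^sub>\<infinity>x\<in>F. \<bar>\<nu> x\<bar> * P x) + (\<Sum>\<^sub>\<infinity>x\<in>F. \<bar>\<nu> x\<bar> * V' x) * q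
      \<le> (\<Sum>\<^sub>\<infinity>x\<in>F. \<bar>\<nu> x\<bar> * v x) + (\<Sum>\<^sub>\<infinity>x\<in>F. \<bar>\<nu> x\<bar>) * (2 * B)"
  proof (rule has_sum_mono)
    show "((\<lambda>x. \<bar>\<nu> x\<bar> * P x + \<bar>\<nu> x\<bar> * V' x * q) has_sum (\<Sum>\<^sub>\<infinity>x\<in>F. \<bar>\<nu> x\<bar> * P x) + (\<Sum>\<^sub>\<infinity>x\<in>F. \<bar>\<nu> x\<bar> * V' x) * q) F"
      by (intro has_sum_add has_sum_cmult_left has_sum_infsum \<nu>P \<nu>V)
    show "((\<lambda>x. \<bar>\<nu> x\<bar> * v x + \<bar>\<nu> x\<bar> * (2 * B)) has_sum (\<Sum>\<^sub>\<infinity>x\<in>F. \<bar>\<nu> x\<bar> * v x) + (\<Sum>\<^sub>\<infinity>x\<in>F. \<bar>\<nu> x\<bar>) * (2 * B)) F"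
      by (intro has_sum_add has_sum_cmult_left has_sum_infsum \<nu>)
    show "\<bar>\<nu> x\<bar> * P x + \<bar>\<nu> x\<bar> * V' x * q \<le> \<bar>\<nu> x\<bar> * v x + \<bar>\<nu> x\<bar> * (2 * B)" if "x \<in> F" for x
      using mult_left_mono[OF P_le[OF that], of "\<bar>\<nu> x\<bar>"] by (simp add: algebra_simps)
  qed
  have c: "c = q * \<beta>" using pos by (simp add: q_def)
  have "c * (\<Sum>\<^sub>\<infinity>x\<in>F. \<bar>\<mu> x\<bar> * v x) \<le> c * (\<Sum>\<^sub>\<infinity>x\<in>F. \<bar>\<mu> x\<bar> * V' x) + q * (\<Sum>\<^sub>\<infinity>x\<in>F. \<bar>\<nu> x\<bar> * V' x)"
  proof -
    have e: "c * (y * inverse \<beta>) = q * y" for y using pos by (simp add: c)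
    from mult_left_mono[OF main', of c] pos show ?thesis
      unfolding distrib_left e by simp
  qed
  also have "c * (\<Sum>\<^sub>\<infinity>x\<in>F. \<bar>\<mu> x\<bar> * V' x) = \<beta> * ((\<Sum>\<^sub>\<infinity>x\<in>F. \<bar>\<mu> x\<bar> * V' x) * q)"
    by (simp add: c)
  also have "\<dots> \<le> \<beta> * ((\<Sum>\<^sub>\<infinity>x\<in>F. \<bar>\<nu> x\<bar> * P x) * inverse \<beta>)"
    using main m1 pos by (intro mult_left_mono) auto
  also have "\<dots> = (\<Sum>\<^sub>\<infinity>x\<in>F. \<bar>\<nu> x\<bar> * P x)" using pos by simp
  finally show ?thesis using m2 by (simp add: mult.commute)
qed

section \<open>Perturbation of stationary distributions\<close>

context nonexplosive_generator
begin

lemma stationary_resolvent: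
  assumes "stationary_distribution F Q \<pi>" "y \<in> F"
  shows "((\<lambda>x. \<pi> x * \<Phi> x y) has_sum \<pi> y) F"
  using perturbed_stationary_resolvent[of \<pi> "\<lambda>_. 0" y] assms
  by (simp add: stationary_distribution_def)

text \<open>
  Sum the drift condition of \<open>\<Phi>\<close> against \<open>\<pi> = \<pi> \<Phi>\<close>. Keeping \<open>\<pi> K\<close> on the right-hand side, instead of
  bounding it by \<open>1\<close>, later shows that \<open>\<pi> K > 0\<close>.
\<close>
lemma stationary_moment_bound:
  assumes \<pi>: "stationary_distribution F Q \<pi>"
    and v: "\<And>x. x \<in> F \<Longrightarrow> v x \<ge> 0" and K: "finite K" "K \<subseteq> F" and b: "b \<ge> 0" and c: "c > 0"
    and summable: "\<And>x. x \<in> F \<Longrightarrow> (\<lambda>y. Q x y * v y) summable_on F"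
    and drift: "\<And>x. x \<in> F \<Longrightarrow> (\<Sum>\<^sub>\<infinity>y\<in>F. Q x y * v y) \<le> - c * v x + b * indicator K x"
  shows "(\<lambda>x. \<pi> x * v x) summable_on F"
    and "c * (\<Sum>\<^sub>\<infinity>x\<in>F. \<pi> x * v x) \<le> b * (\<Sum>x\<in>K. \<pi> x)"
proof -
  have \<pi>0: "\<pi> x \<ge> 0" if "x \<in> F" for x using \<pi> that by (simp add: stationary_distribution_def)
  have \<pi>1: "(\<pi> has_sum 1) F" using \<pi> by (simp add: stationary_distribution_def)
  note inv = stationary_resolvent[OF \<pi>]
  define V where "V x = (\<Sum>\<^sub>\<infinity>y\<in>F. \<Phi> x y * v y)" for x
  have sV: "((\<lambda>y. \<Phi> x y * v y) has_sum V x) F" if x: "x \<in> F" for x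
    unfolding V_def
    by (rule has_sum_infsum[OF \<Phi>_drift(1)[OF v K b less_imp_le[OF c] summable drift x]])
  have V_le: "(\<beta> + c) * V x \<le> \<beta> * v x + b * (\<Sum>y\<in>K. \<Phi> x y)" if x: "x \<in> F" for x
    unfolding V_def
    by (rule \<Phi>_drift(2)[OF v K b less_imp_le[OF c] summable drift x])
  have V0: "V x \<ge> 0" if x: "x \<in> F" for x
    by (rule has_sum_nonneg[OF sV[OF x]]) (use \<Phi>_nonneg v in auto)
  have K1: "(\<Sum>y\<in>K. \<Phi> x y) \<le> 1" if x: "x \<in> F" for x
    by (rule finite_sum_le_has_sum[OF \<Phi>_stochastic[OF x] K]) (simp add: \<Phi>_nonneg)
  have bc: "\<beta> + c > 0" using \<beta>_pos c by simp
  have V_le': "V x \<le> \<beta> / (\<beta> + c) * v x + b / (\<beta> + c)" if x: "x \<in> F" for x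
  proof -
    have "(\<beta> + c) * V x \<le> \<beta> * v x + b"
      using V_le[OF x] mult_left_mono[OF K1[OF x] b] by simp
    then have "V x \<le> (\<beta> * v x + b) / (\<beta> + c)" using bc by (simp add: pos_le_divide_eq mult.commute)
    then show ?thesis by (simp add: add_divide_distrib)
  qed
  show s: "(\<lambda>x. \<pi> x * v x) summable_on F"
  proof (rule invariant_moment_bound(1)[OF \<Phi>_nonneg \<Phi>_stochastic v _ _ _ _ _ \<pi>0 \<pi>1 inv])
    show "(\<lambda>y. \<Phi> x y * v y) summable_on F" if "x \<in> F" for x
      using sV[OF that] by (rule has_sum_imp_summable)
    show "(\<Sum>\<^sub>\<infinity>y\<in>F. \<Phi> x y * v y) \<le> \<beta> / (\<beta> + c) * v x + b / (\<beta> + c)" if "x \<in> F" for x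
      using V_le'[OF that] by (simp add: V_def)
  qed (use \<beta>_pos c b in auto)
  have abs\<pi>: "(\<lambda>x. \<bar>\<pi> x\<bar> * V x) summable_on F"
  proof (rule summable_on_comparison_test)
    show "(\<lambda>x. \<beta> / (\<beta> + c) * (\<pi> x * v x) + \<pi> x * (b / (\<beta> + c))) summable_on F"
      by (intro summable_on_add summable_on_cmult_left summable_on_cmult_right s has_sum_imp_summable[OF \<pi>1])
    show "\<bar>\<pi> x\<bar> * V x \<le> \<beta> / (\<beta> + c) * (\<pi> x * v x) + \<pi> x * (b / (\<beta> + c))" if "x \<in> F" for x
      using mult_left_mono[OF V_le'[OF that] \<pi>0[OF that]] \<pi>0[OF that] by (simp add: algebra_simps)
  qed (use V0 in auto)
  have "((\<lambda>y. \<Sum>\<^sub>\<infinity>x\<in>F. \<pi> x * (\<Phi> x y * v y)) has_sum (\<Sum>\<^sub>\<infinity>x\<in>F. \<pi> x * V x)) F"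
    by (rule infsum_kernel_swap(2)[OF _ sV abs\<pi>]) (use v \<Phi>_nonneg in auto)
  then have "((\<lambda>y. \<pi> y * v y) has_sum (\<Sum>\<^sub>\<infinity>x\<in>F. \<pi> x * V x)) F"
  proof (rule has_sum_cong[THEN iffD1, rotated])
    fix y assume y: "y \<in> F"
    have "((\<lambda>x. \<pi> x * (\<Phi> x y * v y)) has_sum (\<pi> y * v y)) F"
      using has_sum_cmult_left[OF inv[OF y], of "v y"] by (simp add: mult.assoc)
    then show "(\<Sum>\<^sub>\<infinity>x\<in>F. \<pi> x * (\<Phi> x y * v y)) = \<pi> y * v y" by (rule infsumI)
  qed
  then have \<pi>V: "(\<Sum>\<^sub>\<infinity>x\<in>F. \<pi> x * V x) = (\<Sum>\<^sub>\<infinity>x\<in>F. \<pi> x * v x)" by (simp add: infsumI)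
  have s\<pi>V: "(\<lambda>x. \<pi> x * V x) summable_on F"
    using abs\<pi> by (rule summable_on_cong[THEN iffD1, rotated]) (simp add: \<pi>0)
  have abs\<pi>K: "(\<lambda>x. \<bar>\<pi> x\<bar> * (\<Sum>y\<in>K. \<Phi> x y)) summable_on F"
    by (rule summable_on_comparison_test[OF has_sum_imp_summable[OF \<pi>1]])
      (use K1 \<pi>0 in \<open>auto intro!: mult_nonneg_nonneg sum_nonneg \<Phi>_nonneg mult_left_le\<close>)
  then have s\<pi>K: "(\<lambda>x. \<pi> x * (\<Sum>y\<in>K. \<Phi> x y)) summable_on F"
    by (rule summable_on_cong[THEN iffD1, rotated]) (simp add: \<pi>0)
  have "((\<lambda>y. \<Sum>\<^sub>\<infinity>x\<in>F. \<pi> x * \<Phi> x y) has_sum (\<Sum>\<^sub>\<infinity>x\<in>F. \<pi> x * (\<Sum>y\<in>K. \<Phi> x y))) K"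
    by (rule infsum_kernel_swap(2)[OF _ _ abs\<pi>K]) (use K \<Phi>_nonneg in auto)
  then have "(\<Sum>\<^sub>\<infinity>x\<in>F. \<pi> x * (\<Sum>y\<in>K. \<Phi> x y)) = (\<Sum>y\<in>K. \<Sum>\<^sub>\<infinity>x\<in>F. \<pi> x * \<Phi> x y)"
    using has_sum_finite[OF K(1)] has_sum_unique by blast
  also have "\<dots> = (\<Sum>y\<in>K. \<pi> y)"
    by (rule sum.cong) (use K infsumI[OF inv] in auto)
  finally have \<pi>K: "(\<Sum>\<^sub>\<infinity>x\<in>F. \<pi> x * (\<Sum>y\<in>K. \<Phi> x y)) = (\<Sum>y\<in>K. \<pi> y)" .
  have "(\<beta> + c) * (\<Sum>\<^sub>\<infinity>x\<in>F. \<pi> x * V x) \<le> \<beta> * (\<Sum>\<^sub>\<infinity>x\<in>F. \<pi> x * v x) + b * (\<Sum>\<^sub>\<infinity>x\<in>F. \<pi> x * (\<Sum>y\<in>K. \<Phi> x y))"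
  proof (rule has_sum_mono)
    show "((\<lambda>x. (\<beta> + c) * (\<pi> x * V x)) has_sum ((\<beta> + c) * (\<Sum>\<^sub>\<infinity>x\<in>F. \<pi> x * V x))) F"
      by (intro has_sum_cmult_right has_sum_infsum s\<pi>V)
    show "((\<lambda>x. \<beta> * (\<pi> x * v x) + b * (\<pi> x * (\<Sum>y\<in>K. \<Phi> x y))) has_sum
        (\<beta> * (\<Sum>\<^sub>\<infinity>x\<in>F. \<pi> x * v x) + b * (\<Sum>\<^sub>\<infinity>x\<in>F. \<pi> x * (\<Sum>y\<in>K. \<Phi> x y)))) F"
      by (intro has_sum_add has_sum_cmult_right has_sum_infsum s s\<pi>K)
    show "(\<beta> + c) * (\<pi> x * V x) \<le> \<beta> * (\<pi> x * v x) + b * (\<pi> x * (\<Sum>y\<in>K. \<Phi> x y))" if "x \<in> F" for x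
      using mult_left_mono[OF V_le[OF that] \<pi>0[OF that]] by (simp add: algebra_simps)
  qed
  then show "c * (\<Sum>\<^sub>\<infinity>x\<in>F. \<pi> x * v x) \<le> b * (\<Sum>x\<in>K. \<pi> x)"
    unfolding \<pi>V \<pi>K by (simp add: algebra_simps)
qed

text \<open>
  Put \<open>\<Delta> = Q' - Q\<close> and \<open>\<nu> = \<pi>' \<Delta>\<close>. Then \<open>\<pi>' Q = - \<nu>\<close>, and \<open>\<nu>\<close> has \<open>v\<close>-norm at most \<open>\<delta> (\<pi>' v)\<close> and total
  mass \<open>0\<close>. Subtract from \<open>\<pi>'\<close> the multiple \<open>s \<pi>\<close> for which the difference \<open>\<mu>\<close> satisfies
  \<open>(\<mu> \<Phi>) \<alpha> = 0\<close>; this needs \<open>\<pi> \<alpha> > 0\<close>, which holds since the drift condition forces \<open>\<pi>\<close> to charge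
  \<open>K\<close>. The core estimate bounds \<open>\<mu>\<close>. Its total mass \<open>1 - s\<close> is then also small, and
  \<open>\<pi>' - \<pi> = \<mu> - (1 - s) \<pi>\<close>, which costs the factor \<open>1 + b\<close>.
\<close>
lemma stationary_perturbation_bound:
  fixes v \<pi> \<pi>' :: "'s \<Rightarrow> real" and b c \<delta> \<phi> :: real
  assumes Q': "nonexplosive_generator F Q' A \<beta>"
    and rows: "\<And>x. x \<in> F \<Longrightarrow> (Q x has_sum 0) F" "\<And>x. x \<in> F \<Longrightarrow> (Q' x has_sum 0) F"
    and \<pi>: "stationary_distribution F Q \<pi>" and \<pi>': "stationary_distribution F Q' \<pi>'"
    and b: "b > 0" and c: "c > 0" and v: "\<And>x. x \<in> F \<Longrightarrow> v x \<ge> 1 / c"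
    and K: "finite K" "K \<subseteq> F"
    and summable: "\<And>x. x \<in> F \<Longrightarrow> (\<lambda>y. Q x y * v y) summable_on F"
    and drift: "\<And>x. x \<in> F \<Longrightarrow> (\<Sum>\<^sub>\<infinity>y\<in>F. Q x y * v y) \<le> - c * v x + b * indicator K x"
    and minor: "\<phi> > 0" "\<alpha> \<in> F" "\<And>x. x \<in> K \<Longrightarrow> \<phi> \<le> \<Phi> x \<alpha>"
    and \<delta>: "0 \<le> \<delta>" "\<delta> < c"
    and close: "\<And>x. x \<in> F \<Longrightarrow> (\<lambda>y. \<bar>Q' x y - Q x y\<bar> * v y) summable_on F"
      "\<And>x. x \<in> F \<Longrightarrow> (\<Sum>\<^sub>\<infinity>y\<in>F. \<bar>Q' x y - Q x y\<bar> * v y) \<le> \<delta> * v x"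
  defines "D \<equiv> \<Sum>\<^sub>\<infinity>x\<in>F. \<bar>\<pi>' x - \<pi> x\<bar> * v x"
  shows "(\<lambda>x. \<bar>\<pi>' x - \<pi> x\<bar> * v x) summable_on F"
    and "D \<le> (b + 1) / c * (1 + 2 * b * c / (\<beta> * \<phi>)) * \<delta> * (b / c + D)"
proof -
  interpret Q': nonexplosive_generator F Q' A \<beta> by (rule Q')
  have v0': "v x \<ge> 0" if x: "x \<in> F" for x
    using v[OF x] c order_trans[of 0 "1 / c" "v x"] by simp
  have cv: "1 \<le> c * v x" if x: "x \<in> F" for x
    using v[OF x] c by (simp add: field_simps)
  have \<pi>0: "\<pi> x \<ge> 0" and \<pi>'0: "\<pi>' x \<ge> 0" if "x \<in> F" for x
    using \<pi> \<pi>' that by (simp_all add: stationary_distribution_def)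
  have \<pi>1: "(\<pi> has_sum 1) F" and \<pi>'1: "(\<pi>' has_sum 1) F"
    using \<pi> \<pi>' by (simp_all add: stationary_distribution_def)
  define \<Delta> where "\<Delta> x y = Q' x y - Q x y" for x y
  define m where "m x = (\<Sum>\<^sub>\<infinity>y\<in>F. \<bar>\<Delta> x y\<bar> * v y)" for x
  have sm: "((\<lambda>y. \<bar>\<Delta> x y\<bar> * v y) has_sum m x) F" if "x \<in> F" for x
    unfolding m_def \<Delta>_def by (rule has_sum_infsum[OF close(1)[OF that]])
  have m: "m x \<le> \<delta> * v x" if "x \<in> F" for x
    using close(2)[OF that] by (simp add: m_def \<Delta>_def)
  have m0: "m x \<ge> 0" if "x \<in> F" for x
    by (rule has_sum_nonneg[OF sm[OF that]]) (use v0' in auto)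
  have sm': "((\<lambda>y. \<bar>\<Delta> x y * v y\<bar>) has_sum m x) F" if "x \<in> F" for x
    using sm[OF that] by (rule has_sum_cong[THEN iffD1, rotated]) (simp add: abs_mult v0')
  have s\<Delta>v: "(\<lambda>y. \<Delta> x y * v y) summable_on F" if "x \<in> F" for x
    using has_sum_imp_summable[OF sm'[OF that]] abs_summable_summable[of "\<lambda>y. \<Delta> x y * v y" F] by simp
  have Q'v: "((\<lambda>y. Q' x y * v y) has_sum ((\<Sum>\<^sub>\<infinity>y\<in>F. Q x y * v y) + (\<Sum>\<^sub>\<infinity>y\<in>F. \<Delta> x y * v y))) F" if "x \<in> F" for x
    using has_sum_add[OF has_sum_infsum[OF summable[OF that]] has_sum_infsum[OF s\<Delta>v[OF that]]]
    by (simp add: \<Delta>_def algebra_simps)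
  \<comment> \<open>\<open>Q'\<close> inherits the drift condition with rate \<open>c - \<delta>\<close>, so that \<open>\<pi>' v\<close> is finite.\<close>
  have drift': "(\<Sum>\<^sub>\<infinity>y\<in>F. Q' x y * v y) \<le> - (c - \<delta>) * v x + b * indicator K x" if x: "x \<in> F" for x
  proof -
    have "(\<Sum>\<^sub>\<infinity>y\<in>F. \<Delta> x y * v y) \<le> m x"
      by (rule has_sum_mono[OF has_sum_infsum[OF s\<Delta>v[OF x]] sm'[OF x]]) simp
    then show ?thesis
      unfolding infsumI[OF Q'v[OF x]] using drift[OF x] m[OF x] by (simp add: algebra_simps)
  qed
  have s\<pi>: "(\<lambda>x. \<pi> x * v x) summable_on F" and \<pi>v: "c * (\<Sum>\<^sub>\<infinity>x\<in>F. \<pi> x * v x) \<le> b * (\<Sum>x\<in>K. \<pi> x)"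
    by (rule stationary_moment_bound[OF \<pi> v0' K less_imp_le[OF b] c summable drift], assumption+)+
  have s\<pi>': "(\<lambda>x. \<pi>' x * v x) summable_on F"
    by (rule Q'.stationary_moment_bound(1)[OF \<pi>' v0' K less_imp_le[OF b] _ has_sum_imp_summable[OF Q'v] drift'])
      (use \<delta> in auto)
  \<comment> \<open>From here on: \<open>\<pi> \<alpha> > 0\<close>, via \<open>1 \<le> c (\<pi> v) \<le> b (\<pi> K)\<close>.\<close>
  have "1 \<le> c * (\<Sum>\<^sub>\<infinity>x\<in>F. \<pi> x * v x)"
  proof (rule has_sum_mono[OF \<pi>1 has_sum_cmult_right[OF has_sum_infsum[OF s\<pi>]]])
    show "\<pi> x \<le> c * (\<pi> x * v x)" if "x \<in> F" for x
      using mult_left_mono[OF cv[OF that] \<pi>0[OF that]] by (simp add: mult_ac)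
  qed
  then have "0 < b * (\<Sum>x\<in>K. \<pi> x)" using \<pi>v by simp
  then have \<pi>K: "(\<Sum>x\<in>K. \<pi> x) > 0" using b by (simp add: zero_less_mult_iff)
  have "\<phi> * (\<Sum>x\<in>K. \<pi> x) \<le> (\<Sum>x\<in>K. \<pi> x * \<Phi> x \<alpha>)"
    unfolding sum_distrib_left
  proof (rule sum_mono)
    fix x assume x: "x \<in> K"
    then have "\<pi> x * \<phi> \<le> \<pi> x * \<Phi> x \<alpha>" using K \<pi>0 minor(3) by (intro mult_left_mono) auto
    then show "\<phi> * \<pi> x \<le> \<pi> x * \<Phi> x \<alpha>" by (simp add: mult.commute)
  qed
  also have "\<dots> \<le> \<pi> \<alpha>"
    by (rule finite_sum_le_has_sum[OF stationary_resolvent[OF \<pi> minor(2)] K]) (use \<pi>0 \<Phi>_nonneg in auto)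
  finally have \<pi>\<alpha>: "\<pi> \<alpha> > 0"
    using \<pi>K minor(1) by (smt (verit) mult_pos_pos)
  have \<pi>v': "(\<Sum>\<^sub>\<infinity>x\<in>F. \<pi> x * v x) \<le> b / c"
  proof -
    have "(\<Sum>x\<in>K. \<pi> x) \<le> 1" by (rule finite_sum_le_has_sum[OF \<pi>1 K]) (use \<pi>0 in auto)
    then have "c * (\<Sum>\<^sub>\<infinity>x\<in>F. \<pi> x * v x) \<le> b"
      using order_trans[OF \<pi>v mult_left_le] b by simp
    then show ?thesis using c by (simp add: field_simps)
  qed
  define \<nu> where "\<nu> y = (\<Sum>\<^sub>\<infinity>x\<in>F. \<pi>' x * \<Delta> x y)" for y
  define l where "l x = (\<Sum>\<^sub>\<infinity>y\<in>F. \<bar>\<Delta> x y\<bar>)" for x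
  have \<Delta>_le: "\<bar>\<Delta> x y\<bar> \<le> \<bar>\<Delta> x y\<bar> * v y * c" if "y \<in> F" for x y
    using mult_left_mono[OF cv[OF that], of "\<bar>\<Delta> x y\<bar>"] by (simp add: mult_ac)
  have sl: "((\<lambda>y. \<bar>\<Delta> x y\<bar>) has_sum l x) F" if x: "x \<in> F" for x
    unfolding l_def
    by (rule has_sum_infsum,
        rule summable_on_comparison_test[OF summable_on_cmult_left[OF has_sum_imp_summable[OF sm[OF x]], of c]])
      (use \<Delta>_le in auto)
  have l: "l x \<le> m x * c" if x: "x \<in> F" for x
    by (rule has_sum_mono[OF sl[OF x] has_sum_cmult_left[OF sm[OF x]]]) (use \<Delta>_le in auto)
  have l0: "l x \<ge> 0" if x: "x \<in> F" for x by (rule has_sum_nonneg[OF sl[OF x]]) simp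
  have \<pi>'m: "(\<lambda>x. \<bar>\<pi>' x\<bar> * m x) summable_on F"
  proof (rule summable_on_comparison_test[OF summable_on_cmult_left[OF s\<pi>', of \<delta>]])
    show "\<bar>\<pi>' x\<bar> * m x \<le> \<pi>' x * v x * \<delta>" if "x \<in> F" for x
      using mult_left_mono[OF m[OF that] \<pi>'0[OF that]] \<pi>'0[OF that] by (simp add: mult_ac)
  qed (use m0 in auto)
  have \<pi>'l: "(\<lambda>x. \<bar>\<pi>' x\<bar> * l x) summable_on F"
  proof (rule summable_on_comparison_test[OF summable_on_cmult_left[OF \<pi>'m, of c]])
    show "\<bar>\<pi>' x\<bar> * l x \<le> \<bar>\<pi>' x\<bar> * m x * c" if "x \<in> F" for x
      using mult_left_mono[OF l[OF that], of "\<bar>\<pi>' x\<bar>"] by (simp add: mult_ac)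
  qed (use l0 in auto)
  have \<Delta>0: "(\<Delta> x has_sum 0) F" if "x \<in> F" for x
    using has_sum_add[OF rows(2)[OF that] has_sum_uminusI[OF rows(1)[OF that]]] by (simp add: \<Delta>_def[abs_def])
  have s\<nu>: "((\<lambda>x. \<pi>' x * \<Delta> x y) has_sum \<nu> y) F" if y: "y \<in> F" for y
    unfolding \<nu>_def by (rule has_sum_infsum, rule infsum_signed_kernel_swap(1)[OF \<Delta>0 sl \<pi>'l y])
  have "(\<nu> has_sum (\<Sum>\<^sub>\<infinity>x\<in>F. \<pi>' x * 0)) F"
    unfolding \<nu>_def by (rule infsum_signed_kernel_swap(2)[OF \<Delta>0 sl \<pi>'l])
  then have \<nu>0: "(\<nu> has_sum 0) F" by simp
  have \<nu>s: "(\<lambda>y. \<bar>\<nu> y\<bar>) summable_on F"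
    unfolding \<nu>_def by (rule infsum_signed_kernel_contraction(1)[OF sl \<pi>'l])
  have \<nu>_eq: "\<bar>\<Sum>\<^sub>\<infinity>x\<in>F. \<pi>' x * (\<Delta> x y * v y)\<bar> = \<bar>\<nu> y\<bar> * v y" if y: "y \<in> F" for y
    using has_sum_cmult_left[OF s\<nu>[OF y], of "v y"] v0'[OF y] by (simp add: mult.assoc infsumI abs_mult)
  have "(\<lambda>y. \<bar>\<Sum>\<^sub>\<infinity>x\<in>F. \<pi>' x * (\<Delta> x y * v y)\<bar>) summable_on F"
    "(\<Sum>\<^sub>\<infinity>y\<in>F. \<bar>\<Sum>\<^sub>\<infinity>x\<in>F. \<pi>' x * (\<Delta> x y * v y)\<bar>) \<le> (\<Sum>\<^sub>\<infinity>x\<in>F. \<bar>\<pi>' x\<bar> * m x)"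
    by (rule infsum_signed_kernel_contraction[OF sm' \<pi>'m], assumption)+
  then have \<nu>v: "(\<lambda>y. \<bar>\<nu> y\<bar> * v y) summable_on F"
    and \<nu>v_le: "(\<Sum>\<^sub>\<infinity>y\<in>F. \<bar>\<nu> y\<bar> * v y) \<le> (\<Sum>\<^sub>\<infinity>x\<in>F. \<bar>\<pi>' x\<bar> * m x)"
    using summable_on_cong[of F, OF \<nu>_eq] infsum_cong[of F, OF \<nu>_eq] by simp_all
  have \<pi>'m_le: "(\<Sum>\<^sub>\<infinity>x\<in>F. \<bar>\<pi>' x\<bar> * m x) \<le> (\<Sum>\<^sub>\<infinity>x\<in>F. \<pi>' x * v x) * \<delta>"
  proof (rule has_sum_mono[OF has_sum_infsum[OF \<pi>'m] has_sum_cmult_left[OF has_sum_infsum[OF s\<pi>']]])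
    show "\<bar>\<pi>' x\<bar> * m x \<le> \<pi>' x * v x * \<delta>" if "x \<in> F" for x
      using mult_left_mono[OF m[OF that] \<pi>'0[OF that]] \<pi>'0[OF that] by (simp add: mult_ac)
  qed
  have eq': "((\<lambda>x. (\<pi>' x + \<nu> x / \<beta>) * \<Phi> x y) has_sum \<pi>' y) F" if y: "y \<in> F" for y
  proof (rule perturbed_stationary_resolvent[OF \<pi>'0 \<pi>'1 \<nu>s \<nu>0 _ y])
    fix z assume z: "z \<in> F"
    have "((\<lambda>x. \<pi>' x * Q' x z) has_sum 0) F" using \<pi>' z by (simp add: stationary_distribution_def)
    from has_sum_add[OF this has_sum_uminusI[OF s\<nu>[OF z]]]
    show "((\<lambda>x. \<pi>' x * Q x z) has_sum - \<nu> z) F" by (simp add: \<Delta>_def algebra_simps)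
  qed
  have abs\<pi>': "(\<lambda>x. \<bar>\<pi>' x\<bar> * 1) summable_on F"
    using has_sum_imp_summable[OF \<pi>'1] by (rule summable_on_cong[THEN iffD1, rotated]) (simp add: \<pi>'0)
  have s\<pi>'\<Phi>: "(\<lambda>x. \<pi>' x * \<Phi> x \<alpha>) summable_on F"
    by (rule infsum_kernel_swap(1)[where k = "\<lambda>_. 1", OF \<Phi>_nonneg \<Phi>_stochastic abs\<pi>' minor(2)])
  define s where "s = (\<Sum>\<^sub>\<infinity>x\<in>F. \<pi>' x * \<Phi> x \<alpha>) / \<pi> \<alpha>"
  define \<mu> where "\<mu> x = \<pi>' x - s * \<pi> x" for x
  have \<mu>sum: "(\<mu> has_sum (1 - s)) F"
    unfolding \<mu>_def using has_sum_add[OF \<pi>'1 has_sum_uminusI[OF has_sum_cmult_right[OF \<pi>1, of s]]] by simp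
  have \<mu>_le: "\<bar>\<mu> x\<bar> \<le> \<pi>' x + \<bar>s\<bar> * \<pi> x" if "x \<in> F" for x
    unfolding \<mu>_def using abs_triangle_ineq4[of "\<pi>' x" "s * \<pi> x"] \<pi>0[OF that] \<pi>'0[OF that] by (simp add: abs_mult)
  have \<mu>s: "(\<lambda>x. \<bar>\<mu> x\<bar>) summable_on F"
  proof (rule summable_on_comparison_test)
    show "(\<lambda>x. \<pi>' x + \<bar>s\<bar> * \<pi> x) summable_on F"
      by (intro summable_on_add summable_on_cmult_right has_sum_imp_summable[OF \<pi>1] has_sum_imp_summable[OF \<pi>'1])
  qed (use \<mu>_le in auto)
  have \<mu>vs: "(\<lambda>x. \<bar>\<mu> x\<bar> * v x) summable_on F"
  proof (rule summable_on_comparison_test)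
    show "(\<lambda>x. \<pi>' x * v x + \<bar>s\<bar> * (\<pi> x * v x)) summable_on F"
      by (intro summable_on_add summable_on_cmult_right s\<pi> s\<pi>')
    show "\<bar>\<mu> x\<bar> * v x \<le> \<pi>' x * v x + \<bar>s\<bar> * (\<pi> x * v x)" if "x \<in> F" for x
      using mult_right_mono[OF \<mu>_le[OF that] v0'[OF that]] by (simp add: algebra_simps)
  qed (use v0' in auto)
  have \<mu>eq: "((\<lambda>x. (\<mu> x + \<nu> x / \<beta>) * \<Phi> x y) has_sum \<mu> y) F" if y: "y \<in> F" for y
    using has_sum_add[OF eq'[OF y] has_sum_uminusI[OF has_sum_cmult_right[OF stationary_resolvent[OF \<pi> y], of s]]]
    by (simp add: \<mu>_def algebra_simps)
  have \<mu>0: "((\<lambda>x. \<mu> x * \<Phi> x \<alpha>) has_sum 0) F"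
    using has_sum_add[OF has_sum_infsum[OF s\<pi>'\<Phi>] has_sum_uminusI[OF has_sum_cmult_right[OF stationary_resolvent[OF \<pi> minor(2)], of s]]] \<pi>\<alpha>
    by (simp add: \<mu>_def s_def algebra_simps)
  define E where "E = (\<Sum>\<^sub>\<infinity>x\<in>F. \<bar>\<mu> x\<bar> * v x)"
  define N where "N = (\<Sum>\<^sub>\<infinity>x\<in>F. \<bar>\<nu> x\<bar> * v x)"
  have "c * E \<le> N + 2 * (b / (\<beta> * \<phi>)) * (\<Sum>\<^sub>\<infinity>x\<in>F. \<bar>\<nu> x\<bar>)"
    unfolding E_def N_def
    by (rule signed_measure_bound[OF \<Phi>_nonneg \<Phi>_stochastic v0' K \<beta>_pos c less_imp_le[OF b] minor(1)
          \<Phi>_drift(1)[OF v0' K less_imp_le[OF b] less_imp_le[OF c] summable drift]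
          \<Phi>_drift(2)[OF v0' K less_imp_le[OF b] less_imp_le[OF c] summable drift]
          minor(2,3) \<mu>s \<mu>vs \<nu>s \<nu>v \<mu>eq \<mu>0])
  also have "\<dots> \<le> N + 2 * (b / (\<beta> * \<phi>)) * (N * c)"
  proof (intro add_left_mono mult_left_mono)
    show "(\<Sum>\<^sub>\<infinity>x\<in>F. \<bar>\<nu> x\<bar>) \<le> N * c"
      unfolding N_def
    proof (rule has_sum_mono[OF has_sum_infsum[OF \<nu>s] has_sum_cmult_left[OF has_sum_infsum[OF \<nu>v]]])
      show "\<bar>\<nu> x\<bar> \<le> \<bar>\<nu> x\<bar> * v x * c" if "x \<in> F" for x
        using mult_left_mono[OF cv[OF that], of "\<bar>\<nu> x\<bar>"] by (simp add: mult_ac)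
    qed
  qed (use b \<beta>_pos minor(1) in auto)
  finally have cE: "c * E \<le> (1 + 2 * b * c / (\<beta> * \<phi>)) * N" by (simp add: algebra_simps)
  have s1: "\<bar>1 - s\<bar> \<le> c * E"
  proof -
    have "\<bar>1 - s\<bar> \<le> (\<Sum>\<^sub>\<infinity>x\<in>F. \<bar>\<mu> x\<bar>)"
      using norm_infsum_bound[of \<mu> F] \<mu>s infsumI[OF \<mu>sum] by simp
    also have "\<dots> \<le> c * E"
      unfolding E_def
    proof (rule has_sum_mono[OF has_sum_infsum[OF \<mu>s] has_sum_cmult_right[OF has_sum_infsum[OF \<mu>vs]]])
      show "\<bar>\<mu> x\<bar> \<le> c * (\<bar>\<mu> x\<bar> * v x)" if "x \<in> F" for x
        using mult_left_mono[OF cv[OF that], of "\<bar>\<mu> x\<bar>"] by (simp add: mult_ac)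
    qed
    finally show ?thesis .
  qed
  have D_le: "\<bar>\<pi>' x - \<pi> x\<bar> * v x \<le> \<bar>\<mu> x\<bar> * v x + \<bar>1 - s\<bar> * (\<pi> x * v x)" if "x \<in> F" for x
  proof -
    have "\<pi>' x - \<pi> x = \<mu> x + - ((1 - s) * \<pi> x)" by (simp add: \<mu>_def algebra_simps)
    then have "\<bar>\<pi>' x - \<pi> x\<bar> \<le> \<bar>\<mu> x\<bar> + \<bar>1 - s\<bar> * \<pi> x"
      using abs_triangle_ineq[of "\<mu> x" "- ((1 - s) * \<pi> x)"] \<pi>0[OF that] by (simp add: abs_mult)
    from mult_right_mono[OF this v0'[OF that]] show ?thesis by (simp add: algebra_simps)
  qed
  have sE: "((\<lambda>x. \<bar>\<mu> x\<bar> * v x + \<bar>1 - s\<bar> * (\<pi> x * v x)) has_sum (E + \<bar>1 - s\<bar> * (\<Sum>\<^sub>\<infinity>x\<in>F. \<pi> x * v x))) F"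
    unfolding E_def by (intro has_sum_add has_sum_cmult_right has_sum_infsum \<mu>vs s\<pi>)
  show sD: "(\<lambda>x. \<bar>\<pi>' x - \<pi> x\<bar> * v x) summable_on F"
    by (rule summable_on_comparison_test[OF has_sum_imp_summable[OF sE] D_le]) (use v0' in auto)
  have "D \<le> E + \<bar>1 - s\<bar> * (\<Sum>\<^sub>\<infinity>x\<in>F. \<pi> x * v x)"
    unfolding D_def by (rule has_sum_mono[OF has_sum_infsum[OF sD] sE D_le])
  also have "\<dots> \<le> E + (c * E) * (b / c)"
  proof -
    have "0 \<le> c * E" using s1 by linarith
    then show ?thesis
      by (intro add_left_mono mult_mono s1 \<pi>v') (auto intro!: infsum_nonneg mult_nonneg_nonneg \<pi>0 v0')
  qed
  also have "\<dots> = (b + 1) / c * (c * E)" using c by (simp add: field_simps)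
  also have "\<dots> \<le> (b + 1) / c * ((1 + 2 * b * c / (\<beta> * \<phi>)) * N)"
    using b c by (intro mult_left_mono cE) auto
  also have "\<dots> \<le> (b + 1) / c * ((1 + 2 * b * c / (\<beta> * \<phi>)) * (\<delta> * (b / c + D)))"
  proof (intro mult_left_mono)
    have "(\<Sum>\<^sub>\<infinity>x\<in>F. \<pi>' x * v x) \<le> (\<Sum>\<^sub>\<infinity>x\<in>F. \<pi> x * v x) + D"
      unfolding D_def
    proof (rule has_sum_mono[OF has_sum_infsum[OF s\<pi>'] has_sum_add[OF has_sum_infsum[OF s\<pi>] has_sum_infsum[OF sD]]])
      show "\<pi>' x * v x \<le> \<pi> x * v x + \<bar>\<pi>' x - \<pi> x\<bar> * v x" if "x \<in> F" for x
        using mult_right_mono[OF _ v0'[OF that], of "\<pi>' x" "\<pi> x + \<bar>\<pi>' x - \<pi> x\<bar>"] by (simp add: algebra_simps)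
    qed
    then have "(\<Sum>\<^sub>\<infinity>x\<in>F. \<pi>' x * v x) * \<delta> \<le> (b / c + D) * \<delta>"
      using \<pi>v' \<delta> by (intro mult_right_mono) auto
    then show "N \<le> \<delta> * (b / c + D)"
      using \<nu>v_le \<pi>'m_le by (simp add: N_def mult.commute)
  qed (use b c \<beta>_pos minor(1) in auto)
  finally show "D \<le> (b + 1) / c * (1 + 2 * b * c / (\<beta> * \<phi>)) * \<delta> * (b / c + D)"
    by (simp add: mult.assoc)
qed

end

section \<open>Block-structured chains\<close>

lemma ergodic_chain_nonexplosive_generator:
  assumes "ergodic_chain F M X Q"
    and A: "\<And>n. finite (A n)" "incseq A" "(\<Union>n. A n) = F" and \<beta>: "\<beta> > 0"
  shows "nonexplosive_generator F Q A \<beta>"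
proof
  have chain: "regular_jump_markov_chain F M X" and gen: "infinitesimal_generator F M X Q"
    using assms(1) by (simp_all add: ergodic_chain_def)
  show "0 \<le> Q x y" if "x \<in> F" "y \<in> F" "x \<noteq> y" for x y
    by (rule generator_off_diagonal_nonneg[OF gen that])
  show "sub_generator (A n) Q" for n
    using A by (intro generator_sub_generator[OF gen]) auto
  show "(\<lambda>n. \<Sum>y\<in>A n. resolvent (mat_exp (A n) Q) \<beta> x y) \<longlonglongrightarrow> 1" if "x \<in> F" for x
    by (rule resolvent_row_sum_tendsto_1[OF chain gen A \<beta> that])
qed (use A \<beta> in auto)

lemma finite_levels_upto: "finite (levels_upto S n)"
  by (simp add: levels_upto_def lev_def)

lemma incseq_levels_upto: "incseq (levels_upto S)"
  unfolding levels_upto_def by (intro incseq_SucI UN_mono) auto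

lemma Union_levels_upto: "(\<Union>n. levels_upto S n) = levels S"
  unfolding levels_upto_def levels_def by fastforce

lemma levels_upto_nonempty: "levels_upto S n \<noteq> {}"
  by (auto simp: levels_upto_def lev_def)

lemma infsum_le_if_ennreal_infsum_le:
  assumes f: "\<And>y. y \<in> F \<Longrightarrow> f y \<ge> 0" and r: "r \<ge> 0"
    and le: "(\<Sum>\<^sub>\<infinity>y\<in>F. ennreal (f y)) \<le> ennreal r"
  shows "f summable_on F" "(\<Sum>\<^sub>\<infinity>y\<in>F. f y) \<le> r"
proof -
  have fin: "sum f G \<le> r" if G: "finite G" "G \<subseteq> F" for G
  proof -
    have "ennreal (sum f G) = (\<Sum>y\<in>G. ennreal (f y))"
      using f G by (subst sum_ennreal) auto
    also have "\<dots> \<le> (\<Sum>\<^sub>\<infinity>y\<in>F. ennreal (f y))"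
      using G by (subst nonneg_infsum_complete) (auto intro!: SUP_upper)
    also note le
    finally show ?thesis using r by (simp add: ennreal_le_iff)
  qed
  show s: "f summable_on F"
    using fin f by (intro nonneg_bdd_above_summable_on bdd_aboveI[of _ r]) auto
  show "(\<Sum>\<^sub>\<infinity>y\<in>F. f y) \<le> r"
    using s fin by (intro infsum_le_finite_sums) auto
qed

lemma row_vnorm_le:
  assumes v: "\<And>y. y \<in> F \<Longrightarrow> v y \<ge> 0" and s: "(\<lambda>y. \<bar>x y\<bar> * v y) summable_on F"
    and le: "(\<Sum>\<^sub>\<infinity>y\<in>F. \<bar>x y\<bar> * v y) \<le> r"
  shows "row_vnorm F v x \<le> ennreal r"
  unfolding row_vnorm_def
proof (rule infsum_le_finite_sums)
  fix G assume G: "finite G" "G \<subseteq> F"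
  have "(\<Sum>y\<in>G. ennreal (\<bar>x y\<bar> * v y)) = ennreal (\<Sum>y\<in>G. \<bar>x y\<bar> * v y)"
    using v G by (subst sum_ennreal) auto
  also have "(\<Sum>y\<in>G. \<bar>x y\<bar> * v y) \<le> (\<Sum>\<^sub>\<infinity>y\<in>F. \<bar>x y\<bar> * v y)"
    using s v G by (intro finite_sum_le_infsum) auto
  then have "ennreal (\<Sum>y\<in>G. \<bar>x y\<bar> * v y) \<le> ennreal r"
    using le by (intro ennreal_leI) simp
  finally show "(\<Sum>y\<in>G. ennreal (\<bar>x y\<bar> * v y)) \<le> ennreal r" .
qed (rule nonneg_summable_on_complete, simp)

lemma mat_vnorm_row_bound:
  assumes v: "\<And>y. y \<in> F \<Longrightarrow> v y > 0" and \<delta>: "\<delta> \<ge> 0" and norm: "mat_vnorm F v Z \<le> ennreal \<delta>" and x: "x \<in> F"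
  shows "(\<lambda>y. \<bar>Z x y\<bar> * v y) summable_on F" "(\<Sum>\<^sub>\<infinity>y\<in>F. \<bar>Z x y\<bar> * v y) \<le> \<delta> * v x"
proof -
  let ?s = "\<Sum>\<^sub>\<infinity>y\<in>F. ennreal (\<bar>Z x y\<bar> * v y)"
  have "?s / ennreal (v x) \<le> mat_vnorm F v Z"
    unfolding mat_vnorm_def using x by (rule SUP_upper)
  also note norm
  finally have le: "?s / ennreal (v x) * ennreal (v x) \<le> ennreal \<delta> * ennreal (v x)"
    by (rule mult_right_mono) simp
  have "?s / ennreal (v x) * ennreal (v x) = ?s * ennreal (v x) / ennreal (v x)"
    by (simp only: ennreal_times_divide mult.commute[of _ "ennreal (v x)"])
  also have "\<dots> = ?s"
    using v[OF x] by (intro ennreal_mult_divide_eq) auto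
  finally have "?s \<le> ennreal (\<delta> * v x)"
    using le v[OF x] \<delta> by (simp add: ennreal_mult)
  moreover have "0 \<le> \<bar>Z x y\<bar> * v y" if "y \<in> F" for y using v[OF that] by simp
  moreover have "0 \<le> \<delta> * v x" using \<delta> v[OF x] by simp
  ultimately show "(\<lambda>y. \<bar>Z x y\<bar> * v y) summable_on F" "(\<Sum>\<^sub>\<infinity>y\<in>F. \<bar>Z x y\<bar> * v y) \<le> \<delta> * v x"
    using infsum_le_if_ennreal_infsum_le[of F "\<lambda>y. \<bar>Z x y\<bar> * v y" "\<delta> * v x"] by blast+
qed

text \<open>
  The supremum is over a finite set, so a single column \<open>\<alpha>\<close> realizes it: from every state of the
  levels up to \<open>K\<close>, the state \<open>\<alpha>\<close> is reached with at least this weight.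
\<close>
lemma phi_bar_attained:
  obtains \<alpha> where "\<alpha> \<in> levels_upto S N" "\<And>x. x \<in> levels_upto S K \<Longrightarrow> phi_bar S Q \<beta> K N \<le> trunc_resolvent S Q \<beta> N x \<alpha>"
proof -
  define g where "g y = (MIN x\<in>levels_upto S K. trunc_resolvent S Q \<beta> N x y)" for y
  have "phi_bar S Q \<beta> K N = Max (g ` levels_upto S N)"
    unfolding phi_bar_def g_def by (intro cSup_eq_Max) (auto simp: finite_levels_upto levels_upto_nonempty)
  also have "\<dots> \<in> g ` levels_upto S N"
    by (intro Max_in) (auto simp: finite_levels_upto levels_upto_nonempty)
  finally obtain \<alpha> where \<alpha>: "\<alpha> \<in> levels_upto S N" "phi_bar S Q \<beta> K N = g \<alpha>" by auto
  have "g \<alpha> \<le> trunc_resolvent S Q \<beta> N x \<alpha>" if "x \<in> levels_upto S K" for x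
    unfolding g_def using that by (intro Min_le) (auto simp: finite_levels_upto)
  with \<alpha> that show ?thesis by metis
qed

lemma phi_bar_pos:
  assumes N: "N \<ge> K"
    and pos: "\<And>x y. x \<in> levels_upto S K \<Longrightarrow> y \<in> levels_upto S K \<Longrightarrow> 0 < trunc_resolvent S Q \<beta> N x y"
  shows "0 < phi_bar S Q \<beta> K N"
proof -
  obtain y where y: "y \<in> levels_upto S K" using levels_upto_nonempty by blast
  have "0 < (MIN x\<in>levels_upto S K. trunc_resolvent S Q \<beta> N x y)"
    using pos y by (subst Min_gr_iff) (auto simp: finite_levels_upto levels_upto_nonempty)
  also have "\<dots> \<le> phi_bar S Q \<beta> K N"
    unfolding phi_bar_def using y incseqD[OF incseq_levels_upto N]
    by (intro cSUP_upper) (auto simp: finite_levels_upto)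
  finally show ?thesis .
qed

theorem theorem5p1:
  fixes S :: "nat \<Rightarrow> nat"
    and M :: "nat \<times> nat \<Rightarrow> 'w measure" and XJ :: "real \<Rightarrow> 'w \<Rightarrow> nat \<times> nat"
    and M' :: "nat \<times> nat \<Rightarrow> 'u measure" and XJ' :: "real \<Rightarrow> 'u \<Rightarrow> nat \<times> nat"
    and Q Q' :: "nat \<times> nat \<Rightarrow> nat \<times> nat \<Rightarrow> real"
    and \<pi> \<pi>' v :: "nat \<times> nat \<Rightarrow> real"
    and b c \<beta> :: real and K N :: nat
  assumes S: "\<forall>k\<ge>1. S k = S 1"
    and Q_ergodic: "ergodic_chain (levels S) M XJ Q"
    and \<pi>: "stationary_distribution (levels S) Q \<pi>"
    and LC: "\<forall>n\<ge>1. \<exists>!C. closed_communicating_class (levels S) (LC_trunc n Q) C \<and>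
                         C \<subseteq> levels_upto S n"
    and Q'_ergodic: "ergodic_chain (levels S) M' XJ' Q'"
    and \<pi>': "stationary_distribution (levels S) Q' \<pi>'"
    and b: "b > 0" and c: "c > 0"
    and v: "\<forall>x\<in>levels S. v x \<ge> 1 / c"
    and drift: "\<forall>x\<in>levels S. (\<lambda>y. Q x y * v y) summable_on levels S \<and>
                  (\<Sum>\<^sub>\<infinity>y\<in>levels S. Q x y * v y) \<le> - c * v x + b * indicator (levels_upto S K) x"
    and \<beta>: "\<beta> > 0"
    and N: "N \<ge> K"
    and \<Phi>: "\<forall>x\<in>levels_upto S K. \<forall>y\<in>levels_upto S K.
               0 < trunc_resolvent S Q \<beta> N x y \<and>
               trunc_resolvent S Q \<beta> N x y \<le> resolvent (trans_fun M XJ) \<beta> x y"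
    and close: "mat_vnorm (levels S) v (\<lambda>x y. Q' x y - Q x y) < ennreal (1 / C_const S Q b c \<beta> K N)"
  shows "row_vnorm (levels S) v (\<lambda>x. \<pi>' x - \<pi> x) \<le>
           ennreal (b / c) *
           (ennreal (C_const S Q b c \<beta> K N) * mat_vnorm (levels S) v (\<lambda>x y. Q' x y - Q x y) /
            (1 - ennreal (C_const S Q b c \<beta> K N) * mat_vnorm (levels S) v (\<lambda>x y. Q' x y - Q x y)))"
proof -
  let ?F = "levels S" and ?A = "levels_upto S"
  interpret G: nonexplosive_generator ?F Q ?A \<beta>
    by (rule ergodic_chain_nonexplosive_generator[OF Q_ergodic finite_levels_upto incseq_levels_upto Union_levels_upto \<beta>])
  have G': "nonexplosive_generator ?F Q' ?A \<beta>"
    by (rule ergodic_chain_nonexplosive_generator[OF Q'_ergodic finite_levels_upto incseq_levels_upto Union_levels_upto \<beta>])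
  define \<phi> where "\<phi> = phi_bar S Q \<beta> K N"
  have \<phi>: "\<phi> > 0" unfolding \<phi>_def using \<Phi> N by (intro phi_bar_pos) auto
  obtain \<alpha> where \<alpha>: "\<alpha> \<in> ?A N" "\<And>x. x \<in> ?A K \<Longrightarrow> \<phi> \<le> trunc_resolvent S Q \<beta> N x \<alpha>"
    using phi_bar_attained[of S N K Q \<beta>] unfolding \<phi>_def by blast
  have minor: "\<phi> \<le> G.\<Phi> x \<alpha>" if "x \<in> ?A K" for x
  proof -
    have "\<phi> \<le> G.R N x \<alpha>"
      using \<alpha> that incseqD[OF incseq_levels_upto N] by (auto simp: G.R_def trunc_resolvent_def)
    also have "\<dots> \<le> G.\<Phi> x \<alpha>" by (rule G.R_le_\<Phi>)
    finally show ?thesis .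
  qed
  define C where "C = C_const S Q b c \<beta> K N"
  define C0 where "C0 = (b + 1) / c * (1 + 2 * b * c / (\<beta> * \<phi>))"
  \<comment> \<open>\<open>C0\<close> is the constant of the perturbation bound; it lies between \<open>(b + 1) / c\<close> and \<open>C\<close>.\<close>
  have C: "C = C0 + (b + 1) / c * b"
    by (simp add: C_def C0_def C_const_def \<phi>_def algebra_simps)
  have "1 \<le> 1 + 2 * b * c / (\<beta> * \<phi>)" using b c \<beta> \<phi> by simp
  from mult_left_mono[OF this, of "(b + 1) / c"] have C0: "(b + 1) / c \<le> C0"
    using b c by (simp add: C0_def)
  have "1 / c < (b + 1) / c" using b c by (simp add: divide_strict_right_mono)
  with C0 have "1 / c < C0" by simp
  moreover have "C0 \<le> C" unfolding C using b c by simp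
  ultimately have Cc: "1 / c < C" by simp
  then have Cpos: "C > 0" using c by (smt (verit) divide_pos_pos)
  define m where "m = mat_vnorm ?F v (\<lambda>x y. Q' x y - Q x y)"
  define \<delta> where "\<delta> = enn2real m"
  have "m < ennreal (1 / C)" using close by (simp add: m_def C_def)
  then have "m < top" using ennreal_less_top by (rule less_trans)
  then have m: "m = ennreal \<delta>" by (simp add: \<delta>_def)
  have \<delta>0: "\<delta> \<ge> 0" by (simp add: \<delta>_def)
  have \<delta>C: "\<delta> < 1 / C" using \<open>m < ennreal (1 / C)\<close> \<delta>0 by (simp add: m ennreal_less_iff)
  \<comment> \<open>As \<open>C > 1 / c\<close>, the perturbation is small enough for the drift of \<open>Q\<close> to carry over to \<open>Q'\<close>.\<close>
  have "1 / C < c" using Cc c Cpos by (simp add: field_simps)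
  then have \<delta>c: "\<delta> < c" using \<delta>C by simp
  have v0: "v x > 0" if "x \<in> ?F" for x using v that c by (smt (verit) divide_pos_pos)
  have gens: "(Q x has_sum 0) ?F" "(Q' x has_sum 0) ?F" if "x \<in> ?F" for x
    using Q_ergodic Q'_ergodic that by (auto simp: ergodic_chain_def infinitesimal_generator_def)
  have K: "finite (?A K)" "?A K \<subseteq> ?F" using finite_levels_upto Union_levels_upto[of S] by blast+
  have \<alpha>F: "\<alpha> \<in> ?F" using \<alpha>(1) Union_levels_upto by blast
  define D where "D = (\<Sum>\<^sub>\<infinity>x\<in>?F. \<bar>\<pi>' x - \<pi> x\<bar> * v x)"
  have close1: "(\<lambda>y. \<bar>Q' x y - Q x y\<bar> * v y) summable_on ?F"
    and close2: "(\<Sum>\<^sub>\<infinity>y\<in>?F. \<bar>Q' x y - Q x y\<bar> * v y) \<le> \<delta> * v x" if "x \<in> ?F" for x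
  proof -
    have "mat_vnorm ?F v (\<lambda>x y. Q' x y - Q x y) \<le> ennreal \<delta>" using m by (simp add: m_def)
    from mat_vnorm_row_bound[where F = ?F and v = v and \<delta> = \<delta>, OF v0 \<delta>0 this that]
    show "(\<lambda>y. \<bar>Q' x y - Q x y\<bar> * v y) summable_on ?F"
      "(\<Sum>\<^sub>\<infinity>y\<in>?F. \<bar>Q' x y - Q x y\<bar> * v y) \<le> \<delta> * v x" by blast+
  qed
  have v': "v x \<ge> 1 / c" if "x \<in> ?F" for x using v that by blast
  have drift1: "(\<lambda>y. Q x y * v y) summable_on ?F"
    and drift2: "(\<Sum>\<^sub>\<infinity>y\<in>?F. Q x y * v y) \<le> - c * v x + b * indicator (?A K) x" if "x \<in> ?F" for x
    using drift that by blast+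
  have sD: "(\<lambda>x. \<bar>\<pi>' x - \<pi> x\<bar> * v x) summable_on ?F"
    and D: "D \<le> C0 * \<delta> * (b / c + D)"
    unfolding D_def C0_def
    by (rule G.stationary_perturbation_bound[OF G' gens \<pi> \<pi>' b c v' K drift1 drift2 \<phi> \<alpha>F minor \<delta>0 \<delta>c close1 close2], assumption+)+
  have D0: "D \<ge> 0" unfolding D_def by (intro infsum_nonneg mult_nonneg_nonneg) (auto intro: less_imp_le v0)
  have C\<delta>: "0 \<le> C * \<delta>" "C * \<delta> < 1" using Cpos \<delta>0 \<delta>C by (auto simp: field_simps)
  \<comment> \<open>The unknown norm \<open>D\<close> is finite, so it may be absorbed into the left-hand side.\<close>
  have "D \<le> C * \<delta> * (b / c + D)"
    using D mult_right_mono[OF mult_right_mono[OF \<open>C0 \<le> C\<close> \<delta>0], of "b / c + D"] D0 b c by simp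
  then have "D * (1 - C * \<delta>) \<le> b / c * (C * \<delta>)" by (simp add: algebra_simps)
  then have "D \<le> b / c * (C * \<delta>) / (1 - C * \<delta>)" using C\<delta> by (subst pos_le_divide_eq) auto
  then have bound: "D \<le> b / c * (C * \<delta> / (1 - C * \<delta>))" by simp
  have "row_vnorm ?F v (\<lambda>x. \<pi>' x - \<pi> x) \<le> ennreal (b / c * (C * \<delta> / (1 - C * \<delta>)))"
    using sD bound v0 by (intro row_vnorm_le) (auto simp: D_def intro: less_imp_le)
  also have "\<dots> = ennreal (b / c) * (ennreal (C * \<delta>) / ennreal (1 - C * \<delta>))"
    using b c C\<delta> by (subst divide_ennreal, simp, simp, subst ennreal_mult) simp_all
  also have "ennreal (1 - C * \<delta>) = 1 - ennreal (C * \<delta>)"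
    using C\<delta> by (simp add: ennreal_minus flip: ennreal_1)
  also have "ennreal (C * \<delta>) = ennreal C * m"
    using Cpos \<delta>0 by (simp add: m ennreal_mult)
  finally show ?thesis unfolding C_def m_def .
qed

end
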